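(* Let $\mu\in\mathbb R$, $\sigma\ge 0$, let $\varphi\in\mathcal D$ and let $U:\mathbb R\to\mathbb R$ be increasing. Suppose that (A1) $\varphi$ is absolutely continuous with $\varphi'\in L^\infty(0,1)$; (A2) $U$ is locally Lipschitz; (A3) there exist $a,b\ge 0$ with $\sup_{\zeta\in\partial U(x)}|\zeta|\le a+b|x|$ for all $x\in\mathbb R$. Let $q^*\in\mathsf M\cap\mathsf K$ and suppose LICQ holds at $q^*$, i.e. $1$ and $2q^*$ are linearly independent in $L^2(0,1)$ (equivalently, $\sigma^2>0$). If $q^*$ is a local maximizer of $\Psi$ over $\mathsf M\cap\mathsf K$ (with respect to the $L^2(0,1)$ norm), then there exist multipliers $(\lambda_1,\lambda_2)\in\mathbb R^2$, an element $z^*\in N_{\mathsf K}(q^* )$ and a measurable selector $\xi(\cdot)\in\partial U(q^*(\cdot))$ such that $$0=-\varphi'\,\xi+\lambda_1+2\lambda_2\,q^*+z^*\quad\text{in }L^2(0,1).$$ On any open interval $I\subseteq(0,1)$ on which $q^*$ is (a.e.) strictly increasing, this reduces to the pointwise condition $$\lambda_1+2\lambda_2\,q^*(u)\in\varphi'(u)\,\partial U(q^*(u))\quad\text{for a.e. }u\in I.$$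
   Context: $L^2(0,1)$ is the real Hilbert space with $\langle q_1,q_2\rangle=\int_0^1q_1q_2\,\mathrm du$. $\mathcal D$ is the set of nondecreasing right-continuous $\varphi:[0,1]\to[0,1]$ with $\varphi(0)=0$, $\varphi(1)=1$. "Increasing" means nondecreasing. The functional is $\Psi(q):=\int_0^1U(q(u))\,\mathrm d\varphi(u)$; under (A1) this is $\int_0^1U(q(u))\varphi'(u)\,\mathrm du$ for $q\in L^2(0,1)$. Monotone cone: $\mathsf K:=\{q\in L^2(0,1): q\text{ has an a.e. nondecreasing representative on }(0,1)\}$. Moment set: $\mathsf M:=\{q\in L^2(0,1):\langle 1,q\rangle=\mu,\ \langle q,q\rangle=\mu^2+\sigma^2\}$. Normal cone at $q\in\mathsf K$: $N_{\mathsf K}(q):=\{z\in L^2(0,1):\langle z,h-q\rangle\le 0\ \forall h\in\mathsf K\}$. Clarke subdifferential: for a locally Lipschitz $f:\mathcal X\to\mathbb R$ on a real Banach space, $f^\circ(x;h):=\limsup_{y\to x,\,t\to0^+}\frac{f(y+th)-f(y)}{t}$ and $\partial f(x):=\{v\in\mathcal X^*:\langle v,h\rangle\le f^\circ(x;h)\ \forall h\in\mathcal X\}$. A real constant is also regarded as a constant function in $L^2(0,1)$. *)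

theory Defs
  imports "HOL-Analysis.Analysis"
begin

text \<open>
  Elements of $L^2(0,1)$ are represented by Borel functions on $(0,1)$, two of them being
  identified when they agree almost everywhere; values outside $(0,1)$ are irrelevant.
  Every class has a Borel representative, and Borel representatives (rather than
  Lebesgue measurable ones) are what can be integrated against a Stieltjes measure.
\<close>

abbreviation lborel01 :: "real measure" where
  "lborel01 \<equiv> restrict_space lborel {0<..<1}"

definition L2 :: "(real \<Rightarrow> real) set" where
  "L2 = {q \<in> borel_measurable lborel01. integrable lborel01 (\<lambda>u. (q u)\<^sup>2)}"

definition Linfty :: "(real \<Rightarrow> real) set" where
  "Linfty = {f \<in> borel_measurable lborel01. \<exists>C. AE u in lborel01. \<bar>f u\<bar> \<le> C}"

definition L2_inner :: "(real \<Rightarrow> real) \<Rightarrow> (real \<Rightarrow> real) \<Rightarrow> real" where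
  "L2_inner f g = (LINT u|lborel01. f u * g u)"

definition L2_norm :: "(real \<Rightarrow> real) \<Rightarrow> real" where
  "L2_norm f = sqrt (L2_inner f f)"

definition L2_lin_indep :: "(real \<Rightarrow> real) \<Rightarrow> (real \<Rightarrow> real) \<Rightarrow> bool" where
  "L2_lin_indep f g \<longleftrightarrow>
    (\<forall>\<alpha> \<beta>. (AE u in lborel01. \<alpha> * f u + \<beta> * g u = 0) \<longrightarrow> \<alpha> = 0 \<and> \<beta> = 0)"

definition distortions :: "(real \<Rightarrow> real) set" where
  "distortions = {\<phi>. mono_on {0..1} \<phi> \<and> \<phi> ` {0..1} \<subseteq> {0..1} \<and>
     (\<forall>u\<in>{0..<1}. continuous (at_right u) \<phi>) \<and> \<phi> 0 = 0 \<and> \<phi> 1 = 1}"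

text \<open>
  The function \<open>\<phi>\<close> matters only on $[0,1]$. Its Stieltjes measure is that of the extension
  which is constant on both sides of $[0,1]$, so there is no mass outside $[0,1]$ and no atom at $0$.
\<close>

definition stieltjes01 :: "(real \<Rightarrow> real) \<Rightarrow> real measure" where
  "stieltjes01 \<phi> = interval_measure (\<lambda>u. \<phi> (max 0 (min 1 u)))"

definition Psi :: "(real \<Rightarrow> real) \<Rightarrow> (real \<Rightarrow> real) \<Rightarrow> (real \<Rightarrow> real) \<Rightarrow> real" where
  "Psi \<phi> U q = (LINT u:{0..1}|stieltjes01 \<phi>. U (q u))"

text \<open>
  The usual \<open>\<epsilon>\<close>-\<open>\<delta>\<close> definition of absolute continuity: \<^term>\<open>\<D> division_of T\<close> says that \<open>\<D>\<close> is a
  finite family of possibly degenerate closed intervals with union \<open>T\<close> and pairwise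
  disjoint interiors.
\<close>

definition absolutely_continuous_on :: "real set \<Rightarrow> (real \<Rightarrow> real) \<Rightarrow> bool" where
  "absolutely_continuous_on S f \<longleftrightarrow>
    (\<forall>\<epsilon>>0. \<exists>\<delta>>0. \<forall>\<D> T. \<D> division_of T \<and> T \<subseteq> S \<and> (\<Sum>J\<in>\<D>. Sup J - Inf J) < \<delta> \<longrightarrow>
      (\<Sum>J\<in>\<D>. \<bar>f (Sup J) - f (Inf J)\<bar>) < \<epsilon>)"

definition locally_lipschitz :: "('a::metric_space \<Rightarrow> 'b::metric_space) \<Rightarrow> bool" where
  "locally_lipschitz f \<longleftrightarrow> (\<forall>x. \<exists>r>0. \<exists>L. L-lipschitz_on (ball x r) f)"

definition clarke_dd :: "('a::banach \<Rightarrow> real) \<Rightarrow> 'a \<Rightarrow> 'a \<Rightarrow> ereal" where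
  "clarke_dd f x h =
    Limsup (nhds x \<times>\<^sub>F at_right 0) (\<lambda>(y, t). ereal ((f (y + t *\<^sub>R h) - f y) / t))"

definition clarke_subdiff :: "('a::banach \<Rightarrow> real) \<Rightarrow> 'a \<Rightarrow> ('a \<Rightarrow>\<^sub>L real) set" where
  "clarke_subdiff f x = {v. \<forall>h. ereal (blinfun_apply v h) \<le> clarke_dd f x h}"

text \<open>On the real line, a functional \<open>v\<close> is identified with the number \<open>v 1\<close>.\<close>

definition clarke_subdiff_real :: "(real \<Rightarrow> real) \<Rightarrow> real \<Rightarrow> real set" where
  "clarke_subdiff_real f x = (\<lambda>v. blinfun_apply v 1) ` clarke_subdiff f x"

lemma mem_clarke_subdiff_real:
  "\<zeta> \<in> clarke_subdiff_real f x \<longleftrightarrow> (\<forall>h. ereal (\<zeta> * h) \<le> clarke_dd f x h)"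
proof
  assume "\<zeta> \<in> clarke_subdiff_real f x"
  then obtain v where v: "\<And>h. ereal (blinfun_apply v h) \<le> clarke_dd f x h"
    and \<zeta>: "\<zeta> = blinfun_apply v 1"
    by (auto simp: clarke_subdiff_real_def clarke_subdiff_def)
  have "blinfun_apply v h = \<zeta> * h" for h
    using blinfun.scaleR_right[of v h 1] by (simp add: \<zeta> mult.commute)
  with v show "\<forall>h. ereal (\<zeta> * h) \<le> clarke_dd f x h"
    by metis
next
  assume "\<forall>h. ereal (\<zeta> * h) \<le> clarke_dd f x h"
  then have "blinfun_inner_right \<zeta> \<in> clarke_subdiff f x"
    by (simp add: clarke_subdiff_def)
  moreover have "\<zeta> = blinfun_apply (blinfun_inner_right \<zeta>) 1"
    by simp
  ultimately show "\<zeta> \<in> clarke_subdiff_real f x"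
    unfolding clarke_subdiff_real_def by blast
qed

definition monotone_cone :: "(real \<Rightarrow> real) set" where
  "monotone_cone = {q \<in> L2. \<exists>r. mono_on {0<..<1} r \<and> (AE u in lborel01. q u = r u)}"

definition moment_set :: "real \<Rightarrow> real \<Rightarrow> (real \<Rightarrow> real) set" where
  "moment_set \<mu> \<sigma> = {q \<in> L2. L2_inner (\<lambda>_. 1) q = \<mu> \<and> L2_inner q q = \<mu>\<^sup>2 + \<sigma>\<^sup>2}"

definition normal_cone :: "(real \<Rightarrow> real) set \<Rightarrow> (real \<Rightarrow> real) \<Rightarrow> (real \<Rightarrow> real) set" where
  "normal_cone K q = {z \<in> L2. \<forall>h\<in>K. L2_inner z (\<lambda>u. h u - q u) \<le> 0}"

definition L2_local_maximizer ::
  "((real \<Rightarrow> real) \<Rightarrow> real) \<Rightarrow> (real \<Rightarrow> real) set \<Rightarrow> (real \<Rightarrow> real) \<Rightarrow> bool" where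
  "L2_local_maximizer F S q \<longleftrightarrow>
    q \<in> S \<and> (\<exists>\<epsilon>>0. \<forall>p\<in>S. L2_norm (\<lambda>u. p u - q u) < \<epsilon> \<longrightarrow> F p \<le> F q)"

definition ae_strictly_increasing_on :: "real set \<Rightarrow> (real \<Rightarrow> real) \<Rightarrow> bool" where
  "ae_strictly_increasing_on I q \<longleftrightarrow>
    (\<exists>r. strict_mono_on I r \<and> (AE u in lborel. u \<in> I \<longrightarrow> q u = r u))"

definition kkt_system ::
  "(real \<Rightarrow> real) \<Rightarrow> (real \<Rightarrow> real) \<Rightarrow> (real \<Rightarrow> real) \<Rightarrow> real \<Rightarrow> real \<Rightarrow> (real \<Rightarrow> real) \<Rightarrow>
    (real \<Rightarrow> real) \<Rightarrow> bool" where
  "kkt_system \<phi> U q l1 l2 z \<xi> \<longleftrightarrow>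
    z \<in> normal_cone monotone_cone q \<and>
    \<xi> \<in> borel_measurable lborel01 \<and>
    (AE u in lborel01. \<xi> u \<in> clarke_subdiff_real U (q u)) \<and>
    (AE u in lborel01. 0 = - (deriv \<phi> u * \<xi> u) + l1 + 2 * l2 * q u + z u)"

end

theory Submission
  imports Defs
begin

text \<open>
  Centre the maximiser: \<open>q0 = q - \<mu>\<close> has mean zero and, by the constraint qualification, positive
  norm \<open>\<sigma>\<close>. Write \<open>h\<close> for the residual of a function \<open>k\<close>, its part orthogonal to \<open>1\<close> and \<open>q0\<close>.

  The necessary condition is first derived in primal form. For \<open>k\<close> in the monotone cone, moving from
  \<open>q\<close> in the direction \<open>h\<close> preserves monotonicity for small times and both moments to first order;
  rescaling the deviation from the mean restores them exactly. Since \<open>\<Psi>\<close> is the integral of \<open>U(q)\<close>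
  with the bounded density \<open>\<phi>'\<close>, local optimality yields
  \<open>\<integral> \<phi>' * min {\<zeta> * h | \<zeta> \<in> \<partial>U(q)} \<le> 0\<close> (\<open>directional_first_order_condition\<close>). In other words, each
  such \<open>h\<close> admits some \<open>w\<close> in the order interval \<open>\<phi>' * \<partial>U(q)\<close> with \<open>\<langle>w, h\<rangle> \<le> 0\<close>.

  The multipliers come from exchanging quantifiers: one \<open>w\<close> has to serve all directions. Instead of a
  separation theorem, \<open>order_interval_selection\<close> minimises over the order interval a quadratic
  penalty for the violation of \<open>\<langle>w, h\<rangle> \<le> 0\<close> along the residuals \<open>h\<close> of all step functions. The
  gradient of the penalty at a minimiser is itself the residual of a nondecreasing function, so the
  primal condition forces the penalty to vanish. Minimisers exist by \<open>order_interval_minimizer\<close>.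

  With this \<open>w = \<phi>' * \<xi>\<close>, the coefficients of the projection of \<open>w\<close> onto the span of \<open>1\<close> and \<open>q\<close>
  are the multipliers, and the residual \<open>z\<close> lies in the normal cone, because a function of mean zero
  whose pairings with step functions are nonpositive pairs nonpositively with every nondecreasing
  function (\<open>monotone_cone_polarI\<close>). Where \<open>q\<close> is strictly increasing, \<open>q\<close> can be split into
  nondecreasing summands so finely that orthogonality to \<open>q\<close> leaves \<open>z = 0\<close>
  (\<open>normal_cone_zero_where_strictly_increasing\<close>), which gives the pointwise condition.

  That the Stieltjes measure of \<open>\<phi>\<close> has density \<open>\<phi>'\<close> rests on Lebesgue's differentiation theorem,
  obtained here from the Vitali covering theorem (\<open>interval_measure_derivative_AE\<close>).
\<close>

section \<open>Differentiation of Stieltjes measures\<close>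

text \<open>
  By outer regularity it suffices to bound \<open>\<rho> S\<close> by \<open>\<tau> V\<close> for open \<open>V \<supseteq> S\<close>. The small closed
  balls inside \<open>V\<close> on which \<open>\<rho> \<le> \<tau>\<close> form a Vitali cover of \<open>S\<close>; countably many disjoint ones
  exhaust \<open>S\<close> up to a Lebesgue null set, which \<open>\<rho>\<close> does not charge, and \<open>\<rho> \<le> \<tau>\<close> adds up over
  them.
\<close>

lemma Vitali_measure_comparison:
  fixes \<rho> \<tau> :: "real measure"
  assumes sets_\<rho>[measurable_cong]: "sets \<rho> = sets borel" and sets_\<tau>[measurable_cong]: "sets \<tau> = sets borel"
    and ac: "absolutely_continuous lborel \<rho>"
    and fin: "finite_measure \<tau>"
    and S[measurable]: "S \<in> sets borel"
    and fine: "\<And>x e. x \<in> S \<Longrightarrow> 0 < e \<Longrightarrow>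
      \<exists>c r. 0 < r \<and> r < e \<and> x \<in> cball c r \<and> emeasure \<rho> (cball c r) \<le> emeasure \<tau> (cball c r)"
  shows "emeasure \<rho> S \<le> emeasure \<tau> S"
proof -
  interpret \<tau>: finite_measure \<tau> by fact
  have "emeasure \<rho> S \<le> emeasure \<tau> V" if V: "V \<in> {V. S \<subseteq> V \<and> open V}" for V
  proof -
    define K where "K = {(c, r). 0 < r \<and> cball c r \<subseteq> V \<and> emeasure \<rho> (cball c r) \<le> emeasure \<tau> (cball c r)}"
    have fineK: "\<exists>i. i \<in> K \<and> x \<in> cball (fst i) (snd i) \<and> snd i < e" if x: "x \<in> S" "0 < e" for x e
    proof -
      obtain e' where e': "0 < e'" "cball x e' \<subseteq> V"
        using V x(1) open_contains_cball by (metis (mono_tags, lifting) mem_Collect_eq subsetD)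
      obtain c r where cr: "0 < r" "r < min e (e'/2)" "x \<in> cball c r"
        "emeasure \<rho> (cball c r) \<le> emeasure \<tau> (cball c r)"
        using fine[of x "min e (e'/2)"] x e' by auto
      have "cball c r \<subseteq> cball x e'"
      proof
        fix y assume "y \<in> cball c r"
        then show "y \<in> cball x e'"
          using cr(2,3) dist_triangle[of x y c] by (simp add: dist_commute)
      qed
      then have "(c, r) \<in> K" using cr e' by (auto simp: K_def)
      then show ?thesis using cr by (intro exI[of _ "(c, r)"]) auto
    qed
    have posK: "0 < snd i" if "i \<in> K" for i
      using that by (simp add: K_def case_prod_beta)
    obtain C where C: "countable C" "C \<subseteq> K"
      "pairwise (\<lambda>i j. disjnt (cball (fst i) (snd i)) (cball (fst j) (snd j))) C"
      "negligible (S - (\<Union>i\<in>C. cball (fst i) (snd i)))"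
      by (rule Vitali_covering_theorem_cballs[of K snd S fst, OF posK fineK])
    let ?B = "\<lambda>i. cball (fst i) (snd i) :: real set"
    let ?N = "S - (\<Union>i\<in>C. ?B i)"
    have [measurable]: "(\<Union>i\<in>C. ?B i) \<in> sets borel"
      using C(1) by (intro sets.countable_UN') auto
    have disj: "disjoint_family_on ?B C"
      using C(3) by (simp add: disjoint_family_on_def pairwise_def disjnt_def)
    have "emeasure lborel ?N = 0"
    proof -
      have "?N \<in> null_sets (completion lborel)"
        using C(4) negligible_iff_null_sets by blast
      then show ?thesis
        by (subst (asm) null_sets_completion_iff) (measurable, auto)
    qed
    then have "emeasure \<rho> ?N = 0"
      by (intro absolutely_continuousD[OF ac]) auto
    have "emeasure \<rho> S \<le> emeasure \<rho> (?N \<union> (\<Union>i\<in>C. ?B i))"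
      by (intro emeasure_mono) auto
    also have "\<dots> \<le> emeasure \<rho> ?N + emeasure \<rho> (\<Union>i\<in>C. ?B i)"
      by (intro emeasure_subadditive) auto
    also have "\<dots> = (\<integral>\<^sup>+i. emeasure \<rho> (?B i) \<partial>count_space C)"
      unfolding \<open>emeasure \<rho> ?N = 0\<close> by (subst emeasure_UN_countable[OF _ C(1) disj]) auto
    also have "\<dots> \<le> (\<integral>\<^sup>+i. emeasure \<tau> (?B i) \<partial>count_space C)"
    proof (intro nn_integral_mono)
      fix i assume "i \<in> space (count_space C)"
      then have "i \<in> K" using C(2) by auto
      then show "emeasure \<rho> (?B i) \<le> emeasure \<tau> (?B i)" by (simp add: K_def case_prod_beta)
    qed
    also have "\<dots> = emeasure \<tau> (\<Union>i\<in>C. ?B i)"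
      by (subst emeasure_UN_countable[OF _ C(1) disj]) auto
    also have "\<dots> \<le> emeasure \<tau> V"
    proof (intro emeasure_mono UN_least)
      fix i assume "i \<in> C"
      then have "i \<in> K" using C(2) by blast
      then show "?B i \<subseteq> V" by (simp add: K_def case_prod_beta)
    qed (use V in auto)
    finally show ?thesis .
  qed
  then have "emeasure \<rho> S \<le> (INF V\<in>{V. S \<subseteq> V \<and> open V}. emeasure \<tau> V)"
    by (rule INF_greatest)
  also have "\<dots> = emeasure \<tau> S"
    by (rule outer_regular[OF sets_\<tau> _ S, symmetric]) simp
  finally show ?thesis .
qed


text \<open>
  The interval between \<open>x\<close> and \<open>x + h\<close>, for either sign of \<open>h\<close>, is written as a ball because
  that is the shape of a Vitali cover; \<open>x\<close> is one of its end points, so one-sided difference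
  quotients of \<open>F\<close> become quotients of measures.
\<close>

lemma interval_measure_cball:
  fixes F :: "real \<Rightarrow> real"
  assumes F: "mono F" "continuous_on UNIV F" and h: "h \<noteq> 0"
  shows "emeasure (interval_measure F) (cball (x + h/2) (\<bar>h\<bar>/2)) = ennreal (\<bar>h\<bar> * ((F (x + h) - F x) / h))"
    and "emeasure lborel (cball (x + h/2) (\<bar>h\<bar>/2)) = ennreal \<bar>h\<bar>"
    and "x \<in> cball (x + h/2) (\<bar>h\<bar>/2)"
proof -
  have mono: "x \<le> y \<Longrightarrow> F x \<le> F y" for x y using F(1) by (simp add: mono_def)
  have eq: "cball (x + h/2) (\<bar>h\<bar>/2) = (if h > 0 then {x..x+h} else {x+h..x})"
    using h by (auto simp: cball_eq_atLeastAtMost field_simps)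
  show "emeasure (interval_measure F) (cball (x + h/2) (\<bar>h\<bar>/2)) = ennreal (\<bar>h\<bar> * ((F (x + h) - F x) / h))"
    unfolding eq using h by (auto simp: emeasure_interval_measure_Icc[OF _ mono F(2)])
  show "emeasure lborel (cball (x + h/2) (\<bar>h\<bar>/2)) = ennreal \<bar>h\<bar>"
    unfolding eq using h by auto
  show "x \<in> cball (x + h/2) (\<bar>h\<bar>/2)"
    by (simp add: dist_real_def)
qed

text \<open>
  For a fixed increment \<open>h\<close> the condition on the difference quotient is open, by continuity of
  \<open>F\<close>. The union over all \<open>h\<close> is therefore open too, and both sets are countable intersections
  of open sets.
\<close>

lemma slope_exceptional_set_borel:
  fixes F :: "real \<Rightarrow> real"
  assumes F: "continuous_on UNIV F"
  shows "{x. \<forall>n::nat. \<exists>h. 0 < \<bar>h\<bar> \<and> \<bar>h\<bar> < 1 / (real n + 1) \<and> \<alpha> < (F (x + h) - F x) / h} \<in> sets borel"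
    and "{x. \<forall>n::nat. \<exists>h. 0 < \<bar>h\<bar> \<and> \<bar>h\<bar> < 1 / (real n + 1) \<and> (F (x + h) - F x) / h < \<alpha>} \<in> sets borel"
proof -
  have [continuous_intros]: "continuous_on UNIV (\<lambda>x. F (x + h))" for h
    by (intro continuous_on_compose2[OF F] continuous_intros) auto
  have "open {x. \<alpha> < (F (x + h) - F x) / h}" "open {x. (F (x + h) - F x) / h < \<alpha>}" if "0 < \<bar>h\<bar>" for h
    using that by (auto intro!: open_Collect_less continuous_intros F)
  then have "open (\<Union>h\<in>{h. 0 < \<bar>h\<bar> \<and> \<bar>h\<bar> < 1 / (real n + 1)}. {x. \<alpha> < (F (x + h) - F x) / h})"
    "open (\<Union>h\<in>{h. 0 < \<bar>h\<bar> \<and> \<bar>h\<bar> < 1 / (real n + 1)}. {x. (F (x + h) - F x) / h < \<alpha>})" for n :: nat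
    by (auto intro!: open_UN)
  then have *: "(\<Inter>n::nat. \<Union>h\<in>{h. 0 < \<bar>h\<bar> \<and> \<bar>h\<bar> < 1 / (real n + 1)}. {x. \<alpha> < (F (x + h) - F x) / h}) \<in> sets borel"
    "(\<Inter>n::nat. \<Union>h\<in>{h. 0 < \<bar>h\<bar> \<and> \<bar>h\<bar> < 1 / (real n + 1)}. {x. (F (x + h) - F x) / h < \<alpha>}) \<in> sets borel"
    by (intro sets.countable_INT'; force)+
  show "{x. \<forall>n::nat. \<exists>h. 0 < \<bar>h\<bar> \<and> \<bar>h\<bar> < 1 / (real n + 1) \<and> \<alpha> < (F (x + h) - F x) / h} \<in> sets borel"
    by (rule back_subst[of "\<lambda>A. A \<in> sets borel", OF *(1)]) auto
  show "{x. \<forall>n::nat. \<exists>h. 0 < \<bar>h\<bar> \<and> \<bar>h\<bar> < 1 / (real n + 1) \<and> (F (x + h) - F x) / h < \<alpha>} \<in> sets borel"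
    by (rule back_subst[of "\<lambda>A. A \<in> sets borel", OF *(2)]) auto
qed

text \<open>
  Where a difference quotient along arbitrarily small increments exceeds \<open>r\<close> although \<open>f < p < r\<close>,
  the Vitali comparison of \<open>r\<close> times Lebesgue measure with the Stieltjes measure gives
  \<open>r * \<lambda>(S) \<le> \<integral>\<^sub>S f \<le> p * \<lambda>(S)\<close> for the set \<open>S\<close> of such points, so \<open>\<lambda>(S) = 0\<close>. Small quotients are
  excluded by the same comparison with the two measures exchanged. Letting \<open>p < r\<close> range over the
  rationals leaves a null set.
\<close>

lemma interval_measure_derivative_AE:
  fixes F f :: "real \<Rightarrow> real"
  assumes F: "mono F" "continuous_on UNIV F"
    and fin: "finite_measure (interval_measure F)"
    and f[measurable]: "f \<in> borel_measurable borel" and f0: "\<And>x. 0 \<le> f x"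
    and dens: "interval_measure F = density lborel (\<lambda>x. ennreal (f x))"
  shows "AE x in lborel. x \<in> {a<..<b} \<longrightarrow> (F has_real_derivative f x) (at x)"
proof -
  define \<nu> where "\<nu> = interval_measure F"
  have dens': "\<nu> = density lborel (\<lambda>x. ennreal (f x))" by (simp add: \<nu>_def dens)
  interpret \<nu>: finite_measure \<nu> unfolding \<nu>_def by (rule fin)
  let ?s = "\<lambda>x h. (F (x + h) - F x) / h"
  define U where "U = (\<lambda>r. {x. \<forall>n::nat. \<exists>h. 0 < \<bar>h\<bar> \<and> \<bar>h\<bar> < 1 / (real n + 1) \<and> r < ?s x h})"
  define L where "L = (\<lambda>p. {x. \<forall>n::nat. \<exists>h. 0 < \<bar>h\<bar> \<and> \<bar>h\<bar> < 1 / (real n + 1) \<and> ?s x h < p})"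
  have ULm[measurable]: "U r \<in> sets borel" "L r \<in> sets borel" for r
    unfolding U_def L_def by (rule slope_exceptional_set_borel[OF F(2)])+
  have s0: "0 \<le> ?s x h" if "h \<noteq> 0" for x h
    using that monoD[OF F(1), of x "x + h"] monoD[OF F(1), of "x + h" x]
    by (cases "h > 0") (auto simp: divide_nonpos_neg)
  have small: "\<exists>h. 0 < \<bar>h\<bar> \<and> \<bar>h\<bar> < e \<and> P h"
    if "\<forall>n::nat. \<exists>h. 0 < \<bar>h\<bar> \<and> \<bar>h\<bar> < 1 / (real n + 1) \<and> P h" "0 < e" for P and e :: real
  proof -
    obtain n :: nat where "1 / (real n + 1) < e"
      using reals_Archimedean[OF \<open>0 < e\<close>] by (auto simp: inverse_eq_divide add.commute)
    then show ?thesis using that(1) by (meson less_trans)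
  qed
  have le_imp_0: "x = 0" if "ennreal r * x \<le> ennreal p * x" "0 \<le> p" "p < r" "x < \<infinity>" for r p x
  proof (cases x)
    case (real y)
    then have "r * y \<le> p * y" using that by (simp flip: ennreal_mult)
    then show ?thesis using that real by (metis ennreal_0 mult_le_cancel_right not_le order_antisym)
  qed (use that in auto)
  have finI: "emeasure lborel (S \<inter> {a<..<b}) < \<infinity>" for S
    using emeasure_mono[of "S \<inter> {a<..<b}" "{a<..<b}" lborel] emeasure_lborel_Ioo[of a b]
    by (cases "a \<le> b") (auto simp: less_top[symmetric] top_unique)
  have upper: "emeasure lborel (U r \<inter> {x. f x < p} \<inter> {a<..<b}) = 0" (is "emeasure lborel ?S = 0")
    if pr: "0 \<le> p" "p < r" for p r
  proof -
    let ?\<rho> = "density lborel (\<lambda>x. ennreal r)"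
    have Sm[measurable]: "?S \<in> sets borel" by measurable
    have "emeasure ?\<rho> ?S \<le> emeasure \<nu> ?S"
    proof (rule Vitali_measure_comparison)
      show "absolutely_continuous lborel ?\<rho>" by (rule absolutely_continuousI_density) simp
      fix x e :: real assume "x \<in> ?S" "0 < e"
      then obtain h where h: "0 < \<bar>h\<bar>" "\<bar>h\<bar> < e" "r < ?s x h"
        using small[of "\<lambda>h. r < ?s x h" e] by (auto simp: U_def)
      have "emeasure ?\<rho> (cball (x + h/2) (\<bar>h\<bar>/2)) = ennreal (r * \<bar>h\<bar>)"
        using pr h by (simp add: emeasure_density_const interval_measure_cball(2)[OF F] ennreal_mult)
      also have "\<dots> \<le> emeasure \<nu> (cball (x + h/2) (\<bar>h\<bar>/2))"
        using h mult_left_mono[of r "?s x h" "\<bar>h\<bar>"] unfolding \<nu>_def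
        by (subst interval_measure_cball(1)[OF F]) (auto simp: mult.commute intro!: ennreal_leI)
      finally show "\<exists>c \<rho>'. 0 < \<rho>' \<and> \<rho>' < e \<and> x \<in> cball c \<rho>' \<and> emeasure ?\<rho> (cball c \<rho>') \<le> emeasure \<nu> (cball c \<rho>')"
        using h interval_measure_cball(3)[OF F, of h x] by (intro exI[of _ "x + h/2"] exI[of _ "\<bar>h\<bar>/2"]) auto
    qed (auto simp: \<nu>_def fin)
    also have "\<dots> = (\<integral>\<^sup>+x. ennreal (f x) * indicator ?S x \<partial>lborel)"
      unfolding dens' by (rule emeasure_density) (use Sm in measurable)
    also have "\<dots> \<le> (\<integral>\<^sup>+x. ennreal p * indicator ?S x \<partial>lborel)"
      by (intro nn_integral_mono) (auto simp: indicator_def intro!: ennreal_leI)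
    also have "\<dots> = ennreal p * emeasure lborel ?S"
      using Sm by (simp add: nn_integral_cmult_indicator)
    finally have "ennreal r * emeasure lborel ?S \<le> ennreal p * emeasure lborel ?S"
      using Sm by (simp add: emeasure_density_const)
    then show ?thesis
      by (rule le_imp_0) (use pr finI in auto)
  qed
  have lower: "emeasure lborel (L p \<inter> {x. r < f x} \<inter> {a<..<b}) = 0" (is "emeasure lborel ?S = 0")
    if pr: "0 \<le> p" "p < r" for p r
  proof -
    \<comment> \<open>The dominating measure in a Vitali comparison must be finite, hence the restriction to \<open>(a, b)\<close>.\<close>
    let ?\<tau> = "density lborel (\<lambda>x. ennreal p * indicator {a<..<b} x)"
    have Sm[measurable]: "?S \<in> sets borel" by measurable
    have tau: "emeasure ?\<tau> A = ennreal p * emeasure lborel (A \<inter> {a<..<b})" if "A \<in> sets borel" for A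
    proof -
      have "emeasure ?\<tau> A = (\<integral>\<^sup>+x. ennreal p * indicator (A \<inter> {a<..<b}) x \<partial>lborel)"
        using that by (subst emeasure_density) (auto simp: indicator_def intro!: nn_integral_cong)
      then show ?thesis using that by (simp add: nn_integral_cmult_indicator)
    qed
    have "ennreal r * emeasure lborel ?S = (\<integral>\<^sup>+x. ennreal r * indicator ?S x \<partial>lborel)"
      using Sm by (simp add: nn_integral_cmult_indicator)
    also have "\<dots> \<le> (\<integral>\<^sup>+x. ennreal (f x) * indicator ?S x \<partial>lborel)"
      by (intro nn_integral_mono) (auto simp: indicator_def intro!: ennreal_leI)
    also have "\<dots> = emeasure \<nu> ?S"
      unfolding dens' by (rule emeasure_density[symmetric]) (use Sm in measurable)
    also have "\<dots> \<le> emeasure ?\<tau> ?S"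
    proof (rule Vitali_measure_comparison)
      show "absolutely_continuous lborel \<nu>" unfolding dens' by (rule absolutely_continuousI_density) simp
      have "emeasure ?\<tau> UNIV \<noteq> \<infinity>"
        using finI[of UNIV] by (subst tau) (auto simp: ennreal_mult_eq_top_iff)
      then show "finite_measure ?\<tau>" by (intro finite_measureI) auto
      fix x e :: real assume x: "x \<in> ?S" "0 < e"
      obtain e' where e': "0 < e'" "ball x e' \<subseteq> {a<..<b}"
        using x open_contains_ball[of "{a<..<b}"] by (metis IntE open_greaterThanLessThan)
      obtain h where h: "0 < \<bar>h\<bar>" "\<bar>h\<bar> < min e e'" "?s x h < p"
        using small[of "\<lambda>h. ?s x h < p" "min e e'"] x e' by (auto simp: L_def)
      have "cball (x + h/2) (\<bar>h\<bar>/2) \<subseteq> ball x e'"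
      proof
        fix y assume "y \<in> cball (x + h/2) (\<bar>h\<bar>/2)"
        then have "\<bar>x + h/2 - y\<bar> \<le> \<bar>h\<bar>/2" by (simp add: dist_real_def)
        then show "y \<in> ball x e'" using h(2) unfolding mem_ball dist_real_def by linarith
      qed
      then have sub: "cball (x + h/2) (\<bar>h\<bar>/2) \<inter> {a<..<b} = cball (x + h/2) (\<bar>h\<bar>/2)"
        using e' by auto
      have "emeasure \<nu> (cball (x + h/2) (\<bar>h\<bar>/2)) \<le> ennreal (p * \<bar>h\<bar>)"
        using h mult_left_mono[of "?s x h" p "\<bar>h\<bar>"] unfolding \<nu>_def
        by (subst interval_measure_cball(1)[OF F]) (auto simp: mult.commute intro!: ennreal_leI)
      also have "\<dots> = emeasure ?\<tau> (cball (x + h/2) (\<bar>h\<bar>/2))"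
        using pr h by (subst tau) (auto simp: interval_measure_cball(2)[OF F] ennreal_mult sub)
      finally show "\<exists>c \<rho>'. 0 < \<rho>' \<and> \<rho>' < e \<and> x \<in> cball c \<rho>' \<and> emeasure \<nu> (cball c \<rho>') \<le> emeasure ?\<tau> (cball c \<rho>')"
        using h interval_measure_cball(3)[OF F, of h x] by (intro exI[of _ "x + h/2"] exI[of _ "\<bar>h\<bar>/2"]) auto
    qed (auto simp: \<nu>_def)
    also have "\<dots> = ennreal p * emeasure lborel ?S"
      using Sm by (subst tau) (auto simp: Int_assoc)
    finally show ?thesis
      by (rule le_imp_0) (use pr finI in auto)
  qed
  have "AE x in lborel. \<forall>p\<in>\<rat>. \<forall>r\<in>\<rat>. 0 \<le> p \<and> p < r \<longrightarrow>
      x \<notin> U r \<inter> {x. f x < p} \<inter> {a<..<b} \<and> x \<notin> L p \<inter> {x. r < f x} \<inter> {a<..<b}"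
  proof (intro AE_ball_countable' countable_rat)
    fix p r :: real
    show "AE x in lborel. 0 \<le> p \<and> p < r \<longrightarrow>
      x \<notin> U r \<inter> {x. f x < p} \<inter> {a<..<b} \<and> x \<notin> L p \<inter> {x. r < f x} \<inter> {a<..<b}"
    proof (cases "0 \<le> p \<and> p < r")
      case True
      have "U r \<inter> {x. f x < p} \<inter> {a<..<b} \<in> null_sets lborel" "L p \<inter> {x. r < f x} \<inter> {a<..<b} \<in> null_sets lborel"
        using upper lower True by (auto intro!: null_setsI)
      from AE_not_in[OF this(1)] AE_not_in[OF this(2)] show ?thesis by eventually_elim simp
    qed auto
  qed
  then show ?thesis
  proof (rule AE_mp, intro AE_I2 impI)
    fix x assume ex: "\<forall>p\<in>\<rat>. \<forall>r\<in>\<rat>. 0 \<le> p \<and> p < r \<longrightarrow>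
      x \<notin> U r \<inter> {x. f x < p} \<inter> {a<..<b} \<and> x \<notin> L p \<inter> {x. r < f x} \<inter> {a<..<b}" and x: "x \<in> {a<..<b}"
    have ev: "eventually P (at 0)" if "0 < (e::real)" "\<And>h. 0 < \<bar>h\<bar> \<Longrightarrow> \<bar>h\<bar> < e \<Longrightarrow> P h" for e and P :: "real \<Rightarrow> bool"
      unfolding eventually_at using that by (intro exI[of _ e]) auto
    have "((\<lambda>h. ?s x h) \<longlongrightarrow> f x) (at 0)"
    proof (rule order_tendstoI)
      fix c assume c: "c < f x"
      show "\<forall>\<^sub>F h in at 0. c < ?s x h"
      proof (cases "c < 0")
        case True
        then show ?thesis using s0[of _ x] by (intro ev[of 1]) (auto intro: less_le_trans)
      next
        case False
        obtain p where p: "p \<in> \<rat>" "c < p" "p < f x" using Rats_dense_in_real[OF c] by auto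
        obtain r where r: "r \<in> \<rat>" "p < r" "r < f x" using Rats_dense_in_real[OF p(3)] by auto
        have "x \<notin> L p" using ex p r x False by auto
        then obtain n :: nat where "\<And>h. 0 < \<bar>h\<bar> \<Longrightarrow> \<bar>h\<bar> < 1 / (real n + 1) \<Longrightarrow> \<not> ?s x h < p" unfolding L_def by blast
        then show ?thesis using p by (intro ev[of "1 / (real n + 1)"]) force+
      qed
    next
      fix c assume c: "f x < c"
      obtain r where r: "r \<in> \<rat>" "f x < r" "r < c" using Rats_dense_in_real[OF c] by auto
      obtain p where p: "p \<in> \<rat>" "f x < p" "p < r" using Rats_dense_in_real[OF r(2)] by auto
      have "0 \<le> p" using f0[of x] p by simp
      then have "x \<notin> U r" using ex p r x by auto
      then obtain n :: nat where "\<And>h. 0 < \<bar>h\<bar> \<Longrightarrow> \<bar>h\<bar> < 1 / (real n + 1) \<Longrightarrow> \<not> r < ?s x h" unfolding U_def by blast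
      then show "\<forall>\<^sub>F h in at 0. ?s x h < c" using r by (intro ev[of "1 / (real n + 1)"]) force+
    qed
    then show "(F has_real_derivative f x) (at x)" by (simp add: DERIV_def)
  qed
qed

section \<open>The density of a distortion\<close>

text \<open>
  The intervals of a division overlap in end points only, so their interiors are disjoint and have
  the same lengths.
\<close>

lemma division_lengths_le_emeasure:
  fixes \<D> :: "real set set"
  assumes \<D>: "\<D> division_of T"
  shows "ennreal (\<Sum>J\<in>\<D>. Sup J - Inf J) \<le> emeasure lborel T"
proof -
  have fin: "finite \<D>" using \<D> by auto
  have J: "\<exists>a b. a \<le> b \<and> J = {a..b}" if "J \<in> \<D>" for J
    using division_ofD(3,4)[OF \<D> that] by (metis atLeastatMost_empty_iff box_real(2))
  have len: "emeasure lborel (interior J) = ennreal (Sup J - Inf J)" "0 \<le> Sup J - Inf J" if "J \<in> \<D>" for J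
    using J[OF that] by (auto simp: interior_atLeastAtMost_real)
  have disj: "disjoint_family_on interior \<D>"
    using division_ofD(5)[OF \<D>] by (auto simp: disjoint_family_on_def)
  have T: "T \<in> sets borel"
    using division_ofD(6)[OF \<D>] J fin by (metis (no_types, lifting) borel_closed closed_atLeastAtMost closed_Union)
  have "ennreal (\<Sum>J\<in>\<D>. Sup J - Inf J) = (\<Sum>J\<in>\<D>. emeasure lborel (interior J))"
    using len by (subst sum_ennreal[symmetric]) (auto intro!: sum.cong)
  also have "\<dots> = emeasure lborel (\<Union>J\<in>\<D>. interior J)"
    by (rule sum_emeasure) (use fin disj in auto)
  also have "\<dots> \<le> emeasure lborel T"
  proof (rule emeasure_mono)
    show "(\<Union>J\<in>\<D>. interior J) \<subseteq> T"
      using division_ofD(2)[OF \<D>] interior_subset by blast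
  qed (use T in simp)
  finally show ?thesis .
qed

lemma absolutely_continuous_onE:
  assumes "absolutely_continuous_on S f" "0 < \<epsilon>"
  obtains \<delta> where "0 < \<delta>" "\<forall>\<D> T. \<D> division_of T \<longrightarrow> T \<subseteq> S \<longrightarrow> (\<Sum>J\<in>\<D>. Sup J - Inf J) < \<delta> \<longrightarrow>
    (\<Sum>J\<in>\<D>. \<bar>f (Sup J) - f (Inf J)\<bar>) < \<epsilon>"
  using assms(1)[unfolded absolutely_continuous_on_def imp_conjL, rule_format, OF assms(2)]
  by (elim exE conjE) (rule that)

lemma absolutely_continuous_on_imp_continuous_on:
  fixes f :: "real \<Rightarrow> real"
  assumes f: "absolutely_continuous_on {a..b} f"
  shows "continuous_on {a..b} f"
  unfolding continuous_on_iff
proof (intro ballI allI impI)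
  fix x \<epsilon> :: real assume x: "x \<in> {a..b}" "0 < \<epsilon>"
  obtain \<delta> where \<delta>: "\<delta> > 0" and D0: "\<forall>\<D> T. \<D> division_of T \<longrightarrow> T \<subseteq> {a..b} \<longrightarrow>
      (\<Sum>J\<in>\<D>. Sup J - Inf J) < \<delta> \<longrightarrow> (\<Sum>J\<in>\<D>. \<bar>f (Sup J) - f (Inf J)\<bar>) < \<epsilon>"
    by (rule absolutely_continuous_onE[OF f x(2)])
  note D = D0[rule_format]
  have "\<bar>f y - f z\<bar> < \<epsilon>" if "z \<le> y" "y \<in> {a..b}" "z \<in> {a..b}" "y - z < \<delta>" for y z
    using D[OF division_of_self[of z y]] that by auto
  then have "dist y x < \<delta> \<Longrightarrow> dist (f y) (f x) < \<epsilon>" if "y \<in> {a..b}" for y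
    using that x(1) unfolding dist_real_def
    by (metis abs_if abs_minus_commute linorder_le_cases minus_diff_eq diff_ge_0_iff_ge not_less)
  then show "\<exists>d>0. \<forall>x'\<in>{a..b}. dist x' x < d \<longrightarrow> dist (f x') (f x) < \<epsilon>"
    using \<delta> by blast
qed

lemma open_countable_cbox_cover:
  fixes V :: "real set"
  assumes "open V"
  obtains D :: "nat \<Rightarrow> real set" where "\<And>n. \<exists>a b. D n = cbox a b" "V = (\<Union>n. D n)"
proof -
  define \<F> where "\<F> = insert {} {cbox a b |a b. a \<in> \<rat> \<and> b \<in> \<rat> \<and> cbox a b \<subseteq> V}"
  have "\<F> \<subseteq> insert {} ((\<lambda>(a, b). cbox a b) ` (\<rat> \<times> \<rat>))" unfolding \<F>_def by auto
  then have "countable \<F>"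
    by (rule countable_subset) (intro countable_insert countable_image countable_SIGMA countable_rat)
  have un: "V = \<Union>\<F>"
  proof
    show "V \<subseteq> \<Union>\<F>"
    proof
      fix x assume "x \<in> V"
      then obtain e where e: "e > 0" "ball x e \<subseteq> V" using assms open_contains_ball by blast
      obtain p where p: "p \<in> \<rat>" "x - e < p" "p < x" using Rats_dense_in_real[of "x - e" x] e by auto
      obtain r where r: "r \<in> \<rat>" "x < r" "r < x + e" using Rats_dense_in_real[of x "x + e"] e by auto
      have "cbox p r \<subseteq> ball x e" using p r by (auto simp: dist_real_def)
      then have "cbox p r \<in> \<F>" unfolding \<F>_def using p r e by blast
      moreover have "x \<in> cbox p r" using p r by simp
      ultimately show "x \<in> \<Union>\<F>" by blast
    qed
  qed (auto simp: \<F>_def)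
  have box: "\<exists>a b. D = cbox a b" if "D \<in> \<F>" for D
  proof (cases "D = {}")
    case True
    then show ?thesis by (intro exI[of _ 1] exI[of _ 0]) simp
  qed (use that in \<open>auto simp: \<F>_def\<close>)
  have "range (from_nat_into \<F>) = \<F>"
    using \<open>countable \<F>\<close> by (intro range_from_nat_into) (auto simp: \<F>_def)
  then show thesis
    using un box by (intro that[of "from_nat_into \<F>"]) (metis rangeI, simp)
qed

lemma interval_measure_null_outside:
  fixes F :: "real \<Rightarrow> real"
  assumes F: "mono F" "continuous_on UNIV F"
    and out: "\<And>x. x \<le> a \<Longrightarrow> F x = F a" "\<And>x. b \<le> x \<Longrightarrow> F x = F b" and ab: "a < b"
  shows "- {a<..<b} \<in> null_sets (interval_measure F)"
proof -
  let ?\<nu> = "interval_measure F"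
  have mono: "x \<le> y \<Longrightarrow> F x \<le> F y" for x y using F(1) by (simp add: mono_def)
  have Icc: "emeasure ?\<nu> {x..y} = ennreal (F y - F x)" if "x \<le> y" for x y
    using emeasure_interval_measure_Icc[OF that mono F(2)] .
  have "(\<Union>n::nat. {a - real n..a} \<union> {b..b + real n}) \<in> null_sets ?\<nu>"
  proof (intro null_sets_UN null_sets.Un)
    fix n :: nat
    show "{a - real n..a} \<in> null_sets ?\<nu>" using Icc[of "a - real n" a] out(1)[of "a - real n"] by (auto intro!: null_setsI)
    show "{b..b + real n} \<in> null_sets ?\<nu>" using Icc[of b "b + real n"] out(2)[of "b + real n"] by (auto intro!: null_setsI)
  qed
  moreover have "(\<Union>n::nat. {a - real n..a} \<union> {b..b + real n}) = - {a<..<b}"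
  proof -
    have "x \<in> (\<Union>n::nat. {a - real n..a} \<union> {b..b + real n})" if "x \<in> - {a<..<b}" for x
    proof -
      obtain n :: nat where "\<bar>x - a\<bar> + \<bar>x - b\<bar> \<le> real n" using real_arch_simple by blast
      then have "x \<in> {a - real n..a} \<union> {b..b + real n}" using that by auto
      then show ?thesis by blast
    qed
    then show ?thesis using ab by auto
  qed
  ultimately show ?thesis by simp
qed

text \<open>
  A Lebesgue null set lies in an open set of measure less than \<open>\<delta>\<close>, which is an increasing union
  of finite unions of closed intervals. Each such finite union carries a division, to which the
  \<open>\<epsilon>\<close>-\<open>\<delta>\<close> condition applies directly.
\<close>

lemma interval_measure_absolutely_continuous:
  fixes F :: "real \<Rightarrow> real"
  assumes F: "mono F" "continuous_on UNIV F"
    and out: "\<And>x. x \<le> a \<Longrightarrow> F x = F a" "\<And>x. b \<le> x \<Longrightarrow> F x = F b" and ab: "a < b"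
    and ac: "absolutely_continuous_on {a..b} F"
  shows "absolutely_continuous lborel (interval_measure F)"
  unfolding absolutely_continuous_def
proof
  let ?\<nu> = "interval_measure F"
  have mono: "x \<le> y \<Longrightarrow> F x \<le> F y" for x y using F(1) by (simp add: mono_def)
  have Icc: "emeasure ?\<nu> {x..y} = ennreal (F y - F x)" if "x \<le> y" for x y
    using emeasure_interval_measure_Icc[OF that mono F(2)] .
  fix N :: "real set" assume N: "N \<in> null_sets lborel"
  then have Nm[measurable]: "N \<in> sets borel" by auto
  have outer: "- {a<..<b} \<in> null_sets ?\<nu>"
    by (rule interval_measure_null_outside[OF F out ab])
  let ?N = "N \<inter> {a<..<b}"
  have "emeasure ?\<nu> ?N \<le> ennreal \<epsilon>" if "0 < \<epsilon>" for \<epsilon>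
  proof -
    obtain \<delta> where \<delta>: "\<delta> > 0" and D0: "\<forall>\<D> T. \<D> division_of T \<longrightarrow> T \<subseteq> {a..b} \<longrightarrow>
        (\<Sum>J\<in>\<D>. Sup J - Inf J) < \<delta> \<longrightarrow> (\<Sum>J\<in>\<D>. \<bar>F (Sup J) - F (Inf J)\<bar>) < \<epsilon>"
      by (rule absolutely_continuous_onE[OF ac \<open>0 < \<epsilon>\<close>])
    note D = D0[rule_format]
    obtain V0 where V0: "open V0" "N \<subseteq> V0" "emeasure lborel (V0 - N) < ennreal \<delta>"
      using outer_regular_lborel[OF Nm \<delta>] by metis
    define V where "V = V0 \<inter> {a<..<b}"
    have V: "open V" "?N \<subseteq> V" "V \<subseteq> {a..b}" using V0 by (auto simp: V_def)
    have [measurable]: "V \<in> sets borel" "V0 \<in> sets borel" using V V0 by auto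
    have "emeasure lborel V \<le> emeasure lborel ((V0 - N) \<union> N)" by (intro emeasure_mono) (auto simp: V_def)
    also have "\<dots> \<le> emeasure lborel (V0 - N) + emeasure lborel N" by (intro emeasure_subadditive) auto
    also have "\<dots> < ennreal \<delta>" using V0 N by (simp add: null_setsD1)
    finally have Vsmall: "emeasure lborel V < ennreal \<delta>" .
    obtain Q :: "nat \<Rightarrow> real set" where Q: "\<And>n. \<exists>a b. Q n = cbox a b" "V = (\<Union>n. Q n)"
      using open_countable_cbox_cover[OF V(1)] by metis
    define T where "T n = (\<Union>(Q ` {..n}))" for n
    have TV: "T n \<subseteq> V" for n unfolding T_def Q(2) by blast
    have Tn: "emeasure ?\<nu> (T n) \<le> ennreal \<epsilon>" for n
    proof -
      have "finite (Q ` {..n})" "\<And>S. S \<in> Q ` {..n} \<Longrightarrow> \<exists>a b. S = cbox a b" using Q(1) by blast+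
      then obtain \<D> where \<D>: "\<D> division_of T n"
        unfolding T_def by (rule elementary_unions_intervals)
      have J: "\<exists>x y. x \<le> y \<and> J = {x..y}" if "J \<in> \<D>" for J
        using division_ofD(3,4)[OF \<D> that] by (metis atLeastatMost_empty_iff box_real(2))
      have "ennreal (\<Sum>J\<in>\<D>. Sup J - Inf J) < ennreal \<delta>"
        using division_lengths_le_emeasure[OF \<D>] emeasure_mono[OF TV[of n], of lborel] Vsmall
        by (auto intro: le_less_trans)
      moreover have "0 \<le> (\<Sum>J\<in>\<D>. Sup J - Inf J)" using J by (intro sum_nonneg) force
      ultimately have "(\<Sum>J\<in>\<D>. \<bar>F (Sup J) - F (Inf J)\<bar>) < \<epsilon>"
        using TV[of n] V(3) by (intro D[OF \<D>]) (auto simp: ennreal_less_iff)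
      have "emeasure ?\<nu> (T n) = emeasure ?\<nu> (\<Union>J\<in>\<D>. J)" using division_ofD(6)[OF \<D>] by simp
      also have "\<dots> \<le> (\<Sum>J\<in>\<D>. emeasure ?\<nu> J)"
        using J by (intro emeasure_subadditive_finite division_ofD(1)[OF \<D>]) force
      also have "\<dots> = (\<Sum>J\<in>\<D>. ennreal \<bar>F (Sup J) - F (Inf J)\<bar>)"
      proof (intro sum.cong refl)
        fix J assume "J \<in> \<D>"
        then obtain x y where "x \<le> y" "J = {x..y}" using J by blast
        then show "emeasure ?\<nu> J = ennreal \<bar>F (Sup J) - F (Inf J)\<bar>" using mono[of x y] by (simp add: Icc)
      qed
      also have "\<dots> \<le> ennreal \<epsilon>"
        using \<open>(\<Sum>J\<in>\<D>. \<bar>F (Sup J) - F (Inf J)\<bar>) < \<epsilon>\<close> by (simp add: sum_ennreal ennreal_leI)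
      finally show ?thesis .
    qed
    have Tm: "range T \<subseteq> sets ?\<nu>"
    proof -
      have "Q i \<in> sets borel" for i using Q(1)[of i] borel_closed closed_cbox by metis
      then show ?thesis unfolding T_def by (auto intro!: sets.finite_UN)
    qed
    have "incseq T" unfolding T_def by (intro monoI) force
    have "emeasure ?\<nu> ?N \<le> emeasure ?\<nu> V" using V by (intro emeasure_mono) auto
    also have "V = (\<Union>n. T n)" unfolding T_def Q(2) by blast
    also have "emeasure ?\<nu> (\<Union>n. T n) = (SUP n. emeasure ?\<nu> (T n))"
      by (rule SUP_emeasure_incseq[OF Tm \<open>incseq T\<close>, symmetric])
    also have "\<dots> \<le> ennreal \<epsilon>" by (intro SUP_least Tn)
    finally show ?thesis .
  qed
  then have "emeasure ?\<nu> ?N \<le> 0 + ennreal \<epsilon>" if "0 < \<epsilon>" for \<epsilon>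
    using that by simp
  then have "emeasure ?\<nu> ?N \<le> 0"
    by (rule ennreal_le_epsilon)
  then have "?N \<in> null_sets ?\<nu>" by (intro null_setsI) auto
  then have "?N \<union> - {a<..<b} \<in> null_sets ?\<nu>" using outer by (rule null_sets.Un)
  then show "N \<in> null_sets ?\<nu>" by (rule null_sets_subset) auto
qed

text \<open>
  The Stieltjes measure has a Radon-Nikodym density by absolute continuity, and the differentiation
  theorem identifies this density with \<open>deriv \<phi>\<close> almost everywhere on \<open>(0, 1)\<close>. The
  representative \<open>d\<close> is clamped so that nonnegativity and the bound hold at every point, including
  those where \<open>deriv \<phi>\<close> has no meaning.
\<close>

lemma distortion_density:
  assumes \<phi>: "\<phi> \<in> distortions" and ac: "absolutely_continuous_on {0..1} \<phi>" and bd: "deriv \<phi> \<in> Linfty"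
  shows "\<exists>d C. d \<in> borel_measurable borel \<and> (\<forall>u. 0 \<le> d u) \<and> (\<forall>u. d u \<le> C) \<and>
    (AE u in lborel01. d u = deriv \<phi> u) \<and>
    stieltjes01 \<phi> = density lborel (\<lambda>u. ennreal (indicator {0<..<1} u * d u))"
proof -
  define F where "F = (\<lambda>u. \<phi> (max 0 (min 1 u)))"
  have st: "stieltjes01 \<phi> = interval_measure F" by (simp add: stieltjes01_def F_def)
  have mono\<phi>: "mono_on {0..1} \<phi>" and \<phi>01: "\<phi> 0 = 0" "\<phi> 1 = 1" using \<phi> by (auto simp: distortions_def)
  have F1: "mono F" unfolding F_def by (intro monoI mono_onD[OF mono\<phi>]) auto
  have F2: "continuous_on UNIV F" unfolding F_def
    by (rule continuous_on_compose2[OF absolutely_continuous_on_imp_continuous_on[OF ac]]) (auto intro!: continuous_intros)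
  have F\<phi>: "F u = \<phi> u" if "u \<in> {0..1}" for u using that by (auto simp: F_def min_def max_def dest: order_antisym)
  have out: "x \<le> 0 \<Longrightarrow> F x = F 0" "1 \<le> x \<Longrightarrow> F x = F 1" for x by (auto simp: F_def)
  have Fac: "absolutely_continuous_on {0..1} F"
    unfolding absolutely_continuous_on_def
  proof (intro allI impI)
    fix \<epsilon> :: real assume "0 < \<epsilon>"
    then obtain \<delta> where \<delta>: "\<delta> > 0" and D0: "\<forall>\<D> T. \<D> division_of T \<longrightarrow> T \<subseteq> {0..1} \<longrightarrow>
        (\<Sum>J\<in>\<D>. Sup J - Inf J) < \<delta> \<longrightarrow> (\<Sum>J\<in>\<D>. \<bar>\<phi> (Sup J) - \<phi> (Inf J)\<bar>) < \<epsilon>"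
      by (rule absolutely_continuous_onE[OF ac])
    note D = D0[rule_format]
    have "(\<Sum>J\<in>\<D>. \<bar>F (Sup J) - F (Inf J)\<bar>) < \<epsilon>"
      if A: "\<D> division_of T" "T \<subseteq> {0..1}" "(\<Sum>J\<in>\<D>. Sup J - Inf J) < \<delta>" for \<D> T
    proof -
      have "(\<Sum>J\<in>\<D>. \<bar>F (Sup J) - F (Inf J)\<bar>) = (\<Sum>J\<in>\<D>. \<bar>\<phi> (Sup J) - \<phi> (Inf J)\<bar>)"
      proof (intro sum.cong refl)
        fix J assume J: "J \<in> \<D>"
        then obtain x y where xy: "J = {x..y}" "x \<le> y"
          using division_ofD(3,4)[OF A(1) J] by (metis atLeastatMost_empty_iff box_real(2))
        then have "x \<in> T" "y \<in> T" using division_ofD(2)[OF A(1) J] by auto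
        then have "x \<in> {0..1}" "y \<in> {0..1}" using A(2) by blast+
        then show "\<bar>F (Sup J) - F (Inf J)\<bar> = \<bar>\<phi> (Sup J) - \<phi> (Inf J)\<bar>" using xy by (simp add: F\<phi>)
      qed
      then show ?thesis using D[OF A] by simp
    qed
    then show "\<exists>\<delta>>0. \<forall>\<D> T. \<D> division_of T \<and> T \<subseteq> {0..1} \<and> (\<Sum>J\<in>\<D>. Sup J - Inf J) < \<delta> \<longrightarrow>
      (\<Sum>J\<in>\<D>. \<bar>F (Sup J) - F (Inf J)\<bar>) < \<epsilon>" using \<delta> by blast
  qed
  have AC: "absolutely_continuous lborel (interval_measure F)"
    by (rule interval_measure_absolutely_continuous[OF F1 F2 out _ Fac]) auto
  then obtain g where g[measurable]: "g \<in> borel_measurable lborel" and gd: "density lborel g = interval_measure F"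
    using sigma_finite_measure.Radon_Nikodym[OF sigma_finite_lborel AC] by auto
  let ?\<nu> = "interval_measure F"
  have Icc1: "emeasure ?\<nu> {- real n..real n} \<le> 1" for n :: nat
  proof -
    have "emeasure ?\<nu> {- real n..real n} = ennreal (F (real n) - F (- real n))"
      using monoD[OF F1] F2 by (intro emeasure_interval_measure_Icc) auto
    also have "\<dots> \<le> ennreal 1"
      using monoD[OF F1, of "-real n" 0] monoD[OF F1, of "real n" "max 1 (real n)"] out(1)[of "- real n"] out(2)[of "max 1 (real n)"] F\<phi>[of 0] F\<phi>[of 1]
      by (intro ennreal_leI) (simp add: \<phi>01)
    finally show ?thesis by simp
  qed
  have "emeasure ?\<nu> UNIV = emeasure ?\<nu> (\<Union>n::nat. {- real n..real n})"
    by (intro arg_cong[where f="emeasure ?\<nu>"]) (auto, metis abs_le_iff minus_le_iff real_arch_simple)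
  also have "\<dots> = (SUP n. emeasure ?\<nu> {- real n..real n})"
    by (intro SUP_emeasure_incseq[symmetric]) (auto intro!: monoI)
  also have "\<dots> \<le> 1" by (intro SUP_least Icc1)
  finally have fin: "finite_measure ?\<nu>" by (intro finite_measureI) (auto simp: top_unique)
  interpret \<nu>: finite_measure ?\<nu> by (rule fin)
  have "(\<integral>\<^sup>+x. g x \<partial>lborel) = emeasure ?\<nu> UNIV" unfolding gd[symmetric] by (subst emeasure_density) auto
  then have gfin: "AE x in lborel. g x \<noteq> \<infinity>" 
    by (intro nn_integral_PInf_AE) (auto simp: \<nu>.emeasure_finite)
  define f where "f x = enn2real (g x)" for x
  have f[measurable]: "f \<in> borel_measurable borel" and f0: "0 \<le> f x" for x unfolding f_def by auto
  have dens: "?\<nu> = density lborel (\<lambda>x. ennreal (f x))"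
    unfolding gd[symmetric] using gfin by (intro density_cong) (auto simp: f_def less_top[symmetric])
  have der: "AE x in lborel. x \<in> {0<..<1} \<longrightarrow> (F has_real_derivative f x) (at x)"
    by (rule interval_measure_derivative_AE[OF F1 F2 fin f f0 dens])
  have der\<phi>: "deriv \<phi> x = f x" if "x \<in> {0<..<1}" "(F has_real_derivative f x) (at x)" for x
  proof -
    have "(\<phi> has_real_derivative f x) (at x)"
      by (rule has_field_derivative_transform_within_open[OF that(2), of "{0<..<1}"]) (use that F\<phi> in auto)
    then show ?thesis by (rule DERIV_imp_deriv)
  qed
  have AE01: "(AE u in lborel01. P u) \<longleftrightarrow> (AE u in lborel. u \<in> {0<..<1} \<longrightarrow> P u)" for P
    by (subst AE_restrict_space_iff) auto
  obtain C0 where C0: "AE u in lborel01. \<bar>deriv \<phi> u\<bar> \<le> C0" using bd by (auto simp: Linfty_def)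
  define C where "C = max 0 C0"
  define d where "d u = min C (f u)" for u
  have fd: "AE u in lborel. u \<in> {0<..<1} \<longrightarrow> f u = d u \<and> d u = deriv \<phi> u"
    using der C0[unfolded AE01] 
  proof eventually_elim
    case (elim u)
    show ?case
    proof
      assume "u \<in> {0<..<1}"
      then have "deriv \<phi> u = f u" "\<bar>f u\<bar> \<le> C0" using elim der\<phi>[of u] by auto
      then show "f u = d u \<and> d u = deriv \<phi> u" by (simp add: d_def C_def)
    qed
  qed
  show ?thesis
  proof (intro exI conjI allI)
    show "d \<in> borel_measurable borel" unfolding d_def by measurable
    show "0 \<le> d u" "d u \<le> C" for u by (auto simp: d_def C_def f0)
    show "AE u in lborel01. d u = deriv \<phi> u" unfolding AE01 using fd by eventually_elim simp
    have "- {0<..<1} \<in> null_sets ?\<nu>"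
      by (rule interval_measure_null_outside[OF F1 F2 out]) auto
    from AE_not_in[OF this] have "AE u in ?\<nu>. u \<in> {0<..<1}"
      by eventually_elim simp
    then have "AE u in lborel. u \<in> {0<..<1} \<or> f u = 0"
      unfolding dens
      by (subst (asm) AE_density) (auto elim!: eventually_mono, (use f0 order_le_less in metis)+)
    then have "AE u in lborel. ennreal (f u) = ennreal (indicator {0<..<1} u * d u)"
      using fd by eventually_elim (auto simp: indicator_def)
    then show "stieltjes01 \<phi> = density lborel (\<lambda>u. ennreal (indicator {0<..<1} u * d u))"
      unfolding st dens by (intro density_cong) (auto simp: d_def)
  qed
qed

text \<open>
  Elements of \<open>L2\<close> are arbitrary outside \<open>(0, 1)\<close>. Of those values only
  the ones at 0 and 1 enter \<open>Psi\<close>; these points are null, but they have to be split off for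
  measurability.
\<close>

lemma Psi_eq_weighted_integral:
  assumes [measurable]: "d \<in> borel_measurable borel" "U \<in> borel_measurable borel" "p \<in> borel_measurable lborel01"
    and d0: "\<And>u. 0 \<le> d u"
    and dens: "stieltjes01 \<phi> = density lborel (\<lambda>u. ennreal (indicator {0<..<1} u * d u))"
  shows "Psi \<phi> U p = (LINT u|lborel01. d u * U (p u))"
proof -
  define h where "h u = indicator {0<..<1} u *\<^sub>R U (p u)" for u :: real
  have "(\<lambda>u. U (p u)) \<in> borel_measurable lborel01" by measurable
  then have hm[measurable]: "h \<in> borel_measurable lborel"
    unfolding h_def by (subst (asm) borel_measurable_restrict_space_iff) auto
  have "Psi \<phi> U p = (LINT u|stieltjes01 \<phi>. indicator {0..1} u *\<^sub>R U (p u))"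
    by (simp add: Psi_def set_lebesgue_integral_def)
  also have "(\<lambda>u. indicator {0..1} u *\<^sub>R U (p u)) = (\<lambda>u. h u + (indicator {0} u * U (p 0) + indicator {1} u * U (p 1)))"
    by (auto simp: h_def fun_eq_iff of_bool_def indicator_def)
  also have "(LINT u|stieltjes01 \<phi>. h u + (indicator {0} u * U (p 0) + indicator {1} u * U (p 1))) =
     (LINT u|lborel. (indicator {0<..<1} u * d u) *\<^sub>R (h u + (indicator {0} u * U (p 0) + indicator {1} u * U (p 1))))"
    unfolding dens by (rule integral_density) (auto simp: d0)
  also have "\<dots> = (LINT u|lborel. indicator {0<..<1} u *\<^sub>R (d u * U (p u)))"
    by (intro Bochner_Integration.integral_cong refl) (auto simp: h_def indicator_def)
  also have "\<dots> = (LINT u|lborel01. d u * U (p u))"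
    by (rule integral_restrict_space[symmetric]) simp
  finally show ?thesis .
qed

section \<open>Clarke subdifferentials on the real line\<close>

text \<open>
  On the real line the Clarke subdifferential of a locally Lipschitz function is the compact interval
  between these two numbers, and everything below is phrased with its end points. They are junk
  where \<open>clarke_dd\<close> is infinite, which the local Lipschitz condition excludes.
\<close>

definition clarke_upper :: "(real \<Rightarrow> real) \<Rightarrow> real \<Rightarrow> real" where
  "clarke_upper f x = real_of_ereal (clarke_dd f x 1)"

definition clarke_lower :: "(real \<Rightarrow> real) \<Rightarrow> real \<Rightarrow> real" where
  "clarke_lower f x = - real_of_ereal (clarke_dd f x (- 1))"

lemma eventually_nhds_at_right_0:
  fixes x :: real
  shows "eventually P (nhds x \<times>\<^sub>F at_right (0::real)) \<longleftrightarrow>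
    (\<exists>r>0. \<forall>y t. \<bar>y - x\<bar> < r \<and> 0 < t \<and> t < r \<longrightarrow> P (y, t))"
proof
  assume "eventually P (nhds x \<times>\<^sub>F at_right (0::real))"
  then obtain Q R where Q: "eventually Q (nhds x)" and R: "eventually R (at_right (0::real))"
    and P: "\<And>y t. Q y \<Longrightarrow> R t \<Longrightarrow> P (y, t)"
    unfolding eventually_prod_filter by metis
  obtain d where "d > 0" "\<And>y. dist y x < d \<Longrightarrow> Q y" using Q unfolding eventually_nhds_metric by metis
  moreover obtain b where "b > 0" "\<And>t. 0 < t \<Longrightarrow> t < b \<Longrightarrow> R t"
    using R unfolding eventually_at_right_field by metis
  ultimately show "\<exists>r>0. \<forall>y t. \<bar>y - x\<bar> < r \<and> 0 < t \<and> t < r \<longrightarrow> P (y, t)"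
    using P by (intro exI[of _ "min d b"]) (auto simp: dist_real_def)
next
  assume "\<exists>r>0. \<forall>y t. \<bar>y - x\<bar> < r \<and> 0 < t \<and> t < r \<longrightarrow> P (y, t)"
  then obtain r where r: "r > 0" "\<And>y t. \<bar>y - x\<bar> < r \<Longrightarrow> 0 < t \<Longrightarrow> t < r \<Longrightarrow> P (y, t)" by blast
  have "eventually (\<lambda>y. \<bar>y - x\<bar> < r) (nhds x)"
    unfolding eventually_nhds_metric using r(1) by (auto simp: dist_real_def)
  moreover have "eventually (\<lambda>t. 0 < t \<and> t < r) (at_right 0)"
    unfolding eventually_at_right_field using r(1) by blast
  ultimately show "eventually P (nhds x \<times>\<^sub>F at_right 0)"
    unfolding eventually_prod_filter using r(2) by blast
qed

lemma clarke_dd_lessD: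
  fixes f :: "real \<Rightarrow> real"
  assumes "clarke_dd f x h < ereal c"
  shows "\<exists>r>0. \<forall>y t. \<bar>y - x\<bar> < r \<and> 0 < t \<and> t < r \<longrightarrow> f (y + t * h) - f y < c * t"
  using Limsup_lessD[OF assms[unfolded clarke_dd_def]]
  unfolding eventually_nhds_at_right_0 by (auto simp: divide_less_eq)

lemma clarke_dd_leI:
  fixes f :: "real \<Rightarrow> real"
  assumes "r > 0" "\<And>y t. \<bar>y - x\<bar> < r \<Longrightarrow> 0 < t \<Longrightarrow> t < r \<Longrightarrow> f (y + t * h) - f y \<le> c * t"
  shows "clarke_dd f x h \<le> ereal c"
  unfolding clarke_dd_def
  by (rule Limsup_bounded) (use assms in \<open>auto simp: eventually_nhds_at_right_0 divide_le_eq intro!: exI[of _ r]\<close>)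

lemma clarke_dd_geI:
  fixes f :: "real \<Rightarrow> real"
  assumes "r > 0" "\<And>y t. \<bar>y - x\<bar> < r \<Longrightarrow> 0 < t \<Longrightarrow> t < r \<Longrightarrow> c * t \<le> f (y + t * h) - f y"
  shows "ereal c \<le> clarke_dd f x h"
  unfolding clarke_dd_def
  by (rule le_Limsup) (use assms in \<open>auto simp: prod_filter_eq_bot eventually_nhds_at_right_0 le_divide_eq intro!: exI[of _ r]\<close>)

lemma clarke_dd_finite:
  fixes f :: "real \<Rightarrow> real"
  assumes "locally_lipschitz f"
  shows "\<bar>clarke_dd f x h\<bar> \<noteq> \<infinity>"
proof -
  obtain r L where r: "r > 0" and L: "L-lipschitz_on (ball x r) f"
    using assms unfolding locally_lipschitz_def by blast
  define r' where "r' = r / (2 * (\<bar>h\<bar> + 1))"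
  have r': "0 < r'" "r' \<le> r / 2" using r by (auto simp: r'_def field_simps)
  have bd: "\<bar>f (y + t * h) - f y\<bar> \<le> (L * \<bar>h\<bar>) * t" if "\<bar>y - x\<bar> < r'" "0 < t" "t < r'" for y t
  proof -
    have "\<bar>t * h\<bar> \<le> r' * \<bar>h\<bar>" using that by (simp add: abs_mult mult_right_mono)
    also have "\<dots> < r / 2" using r by (simp add: r'_def field_simps)
    finally have "\<bar>t * h\<bar> < r / 2" .
    then have "y \<in> ball x r" "y + t * h \<in> ball x r" using that r' by (auto simp: dist_real_def)
    from lipschitz_onD[OF L this(2,1)] show ?thesis using that by (simp add: dist_real_def abs_mult ac_simps)
  qed
  have "clarke_dd f x h \<le> ereal (L * \<bar>h\<bar>)"
    by (rule clarke_dd_leI[OF r'(1)]) (use bd in force)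
  moreover have "ereal (- (L * \<bar>h\<bar>)) \<le> clarke_dd f x h"
    by (rule clarke_dd_geI[OF r'(1)]) (use bd in \<open>force simp: abs_le_iff\<close>)
  ultimately show ?thesis by auto
qed

lemma clarke_dd_real:
  fixes f :: "real \<Rightarrow> real"
  assumes "locally_lipschitz f"
  shows "clarke_dd f x 1 = ereal (clarke_upper f x)" "clarke_dd f x (- 1) = ereal (- clarke_lower f x)"
  using clarke_dd_finite[OF assms] by (simp_all add: clarke_upper_def clarke_lower_def ereal_real)

text \<open>
  The end points of the subdifferential control all difference quotients near \<open>x\<close>, not only those
  based at \<open>x\<close>.
\<close>

lemma clarke_upper_lessD:
  assumes "locally_lipschitz f" "clarke_upper f x < c"
  shows "\<exists>r>0. \<forall>y z. \<bar>y - x\<bar> < r \<and> \<bar>z - x\<bar> < r \<and> y < z \<longrightarrow> f z - f y < c * (z - y)"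
proof -
  obtain r where r: "r > 0" "\<And>y t. \<bar>y - x\<bar> < r \<Longrightarrow> 0 < t \<Longrightarrow> t < r \<Longrightarrow> f (y + t) - f y < c * t"
    using clarke_dd_lessD[of f x 1 c] assms by (auto simp: clarke_dd_real)
  have "f z - f y < c * (z - y)" if "\<bar>y - x\<bar> < r / 2" "\<bar>z - x\<bar> < r / 2" "y < z" for y z
  proof -
    have "z - y < r" using that by linarith
    then show ?thesis using r(2)[of y "z - y"] that r(1) by simp
  qed
  then show ?thesis using r(1) by (intro exI[of _ "r/2"]) auto
qed

lemma clarke_lower_greaterD:
  assumes "locally_lipschitz f" "c < clarke_lower f x"
  shows "\<exists>r>0. \<forall>y z. \<bar>y - x\<bar> < r \<and> \<bar>z - x\<bar> < r \<and> y < z \<longrightarrow> c * (z - y) < f z - f y"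
proof -
  obtain r where r: "r > 0" "\<And>y t. \<bar>y - x\<bar> < r \<Longrightarrow> 0 < t \<Longrightarrow> t < r \<Longrightarrow> f (y - t) - f y < - c * t"
    using clarke_dd_lessD[of f x "-1" "- c"] assms by (auto simp: clarke_dd_real)
  have "c * (z - y) < f z - f y" if "\<bar>y - x\<bar> < r / 2" "\<bar>z - x\<bar> < r / 2" "y < z" for y z
  proof -
    have "z - y < r" using that by linarith
    then have "f (z - (z - y)) - f z < - c * (z - y)" using that r(1) by (intro r(2)) auto
    then show ?thesis by simp
  qed
  then show ?thesis using r(1) by (intro exI[of _ "r/2"]) auto
qed

lemma clarke_lower_le_upper:
  assumes "locally_lipschitz f"
  shows "clarke_lower f x \<le> clarke_upper f x"
proof (rule ccontr)
  assume "\<not> ?thesis"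
  then obtain c where c: "clarke_upper f x < c" "c < clarke_lower f x" using dense not_le by metis
  obtain r s where r: "r > 0" "\<forall>y z. \<bar>y - x\<bar> < r \<and> \<bar>z - x\<bar> < r \<and> y < z \<longrightarrow> f z - f y < c * (z - y)"
    and s: "s > 0" "\<forall>y z. \<bar>y - x\<bar> < s \<and> \<bar>z - x\<bar> < s \<and> y < z \<longrightarrow> c * (z - y) < f z - f y"
    using clarke_upper_lessD[OF assms c(1)] clarke_lower_greaterD[OF assms c(2)] by blast
  define z where "z = x + min r s / 2"
  have z: "\<bar>z - x\<bar> < r" "\<bar>z - x\<bar> < s" "x < z" using r(1) s(1) by (auto simp: z_def min_def)
  show False
    using r(2)[rule_format, of x z] s(2)[rule_format, of x z] r(1) s(1) z by auto
qed

text \<open>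
  A direction \<open>h \<noteq> 0\<close> differs from \<open>1\<close> or \<open>-1\<close> by the positive factor \<open>\<bar>h\<bar>\<close>, which is absorbed
  into the step length \<open>t\<close>; so the two directions \<open>1\<close> and \<open>-1\<close> decide membership.
\<close>

lemma clarke_interval_subset_subdiff:
  assumes lip: "locally_lipschitz f" and \<zeta>: "clarke_lower f x \<le> \<zeta>" "\<zeta> \<le> clarke_upper f x"
  shows "\<zeta> \<in> clarke_subdiff_real f x"
  unfolding mem_clarke_subdiff_real
proof (intro allI leI notI)
  fix h assume "clarke_dd f x h < ereal (\<zeta> * h)"
  then obtain c where c: "clarke_dd f x h < ereal c" "c < \<zeta> * h"
    using ereal_dense3[of "clarke_dd f x h" "ereal (\<zeta> * h)"] by auto
  obtain r where r: "r > 0" "\<And>y t. \<bar>y - x\<bar> < r \<Longrightarrow> 0 < t \<Longrightarrow> t < r \<Longrightarrow> f (y + t * h) - f y < c * t"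
    using clarke_dd_lessD[OF c(1)] by blast
  consider "h = 0" | "h > 0" | "h < 0" by linarith
  then show False
  proof cases
    case 1
    then show False using r(2)[of x "r/2"] r(1) c(2) by (auto simp: zero_less_mult_iff)
  next
    case 2
    have "clarke_dd f x 1 \<le> ereal (c / h)"
    proof (rule clarke_dd_leI)
      show "min r (r * h) > 0" using r 2 by simp
      fix y t assume "\<bar>y - x\<bar> < min r (r * h)" "0 < t" "t < min r (r * h)"
      then show "f (y + t * 1) - f y \<le> c / h * t"
        using r(2)[of y "t / h"] 2 by (simp add: divide_less_eq)
    qed
    then have "\<zeta> \<le> c / h" using \<zeta>(2) by (simp add: clarke_dd_real[OF lip])
    then show False using c(2) 2 by (simp add: le_divide_eq)
  next
    case 3
    have "clarke_dd f x (- 1) \<le> ereal (c / - h)"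
    proof (rule clarke_dd_leI)
      show "min r (r * - h) > 0" using r 3 by (simp add: mult_pos_neg)
      fix y t assume "\<bar>y - x\<bar> < min r (r * - h)" "0 < t" "t < min r (r * - h)"
      then have "\<bar>y - x\<bar> < r" "0 < t / - h" "t / - h < r"
        using 3 pos_divide_less_eq[of "- h" t r] by (auto simp: divide_pos_pos divide_pos_neg)
      from r(2)[OF this] show "f (y + t * - 1) - f y \<le> c / - h * t"
        using 3 by simp
    qed
    then have "- \<zeta> \<le> c / - h" using \<zeta>(1) by (simp add: clarke_dd_real[OF lip])
    then have "- \<zeta> * (- h) \<le> c" using 3 by (subst (asm) le_divide_eq) auto
    then show False using c(2) by simp
  qed
qed

text \<open>
  Clarke directional derivatives are upper semicontinuous in the base point: a bound on the quotients
  based in a ball around \<open>x\<close> also bounds the quotients based near any point of a smaller ball.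
\<close>

lemma clarke_endpoint_measurable:
  assumes lip: "locally_lipschitz f"
  shows "clarke_upper f \<in> borel_measurable borel" "clarke_lower f \<in> borel_measurable borel"
proof -
  have op: "open {x. real_of_ereal (clarke_dd f x h) < c}" for h c
    unfolding open_dist
  proof (intro ballI)
    fix x assume "x \<in> {x. real_of_ereal (clarke_dd f x h) < c}"
    then obtain c' where c': "real_of_ereal (clarke_dd f x h) < c'" "c' < c" using dense by blast
    then have "clarke_dd f x h < ereal c'"
      using clarke_dd_finite[OF lip, of x h] by (cases "clarke_dd f x h") auto
    then obtain r where r: "r > 0" "\<And>y t. \<bar>y - x\<bar> < r \<Longrightarrow> 0 < t \<Longrightarrow> t < r \<Longrightarrow> f (y + t * h) - f y < c' * t"
      using clarke_dd_lessD by blast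
    have "real_of_ereal (clarke_dd f z h) < c" if "dist z x < r / 2" for z
    proof -
      have "clarke_dd f z h \<le> ereal c'"
      proof (rule clarke_dd_leI)
        show "r / 2 > 0" using r by simp
        fix y t assume "\<bar>y - z\<bar> < r / 2" "0 < t" "t < r / 2"
        then show "f (y + t * h) - f y \<le> c' * t"
        proof -
          have "\<bar>y - x\<bar> < r" "t < r"
            using that \<open>\<bar>y - z\<bar> < r / 2\<close> \<open>t < r / 2\<close> r(1) unfolding dist_real_def by linarith+
          then show ?thesis using r(2)[of y t] \<open>0 < t\<close> by simp
        qed
      qed
      then show ?thesis using clarke_dd_finite[OF lip, of z h] c'(2) by (cases "clarke_dd f z h") auto
    qed
    then show "\<exists>e>0. \<forall>y. dist y x < e \<longrightarrow> y \<in> {x. real_of_ereal (clarke_dd f x h) < c}"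
      using r(1) by (intro exI[of _ "r/2"]) auto
  qed
  have m: "(\<lambda>x. real_of_ereal (clarke_dd f x h)) \<in> borel_measurable borel" for h
    unfolding borel_measurable_iff_less using op by auto
  show "clarke_upper f \<in> borel_measurable borel"
    using m[of 1] by (simp add: clarke_upper_def[abs_def])
  show "clarke_lower f \<in> borel_measurable borel"
    using borel_measurable_uminus[OF m[of "-1"]] by (simp add: clarke_lower_def[abs_def])
qed

text \<open>
  The last part is a mean value inequality. Near each point of the segment the quotients are bounded
  by the subdifferential there, up to an arbitrarily small error, and Bolzano's bisection principle
  patches these local estimates together.
\<close>

lemma clarke_growth:
  assumes lip: "locally_lipschitz f" and b: "b \<ge> 0"
    and A3: "\<And>x \<zeta>. \<zeta> \<in> clarke_subdiff_real f x \<Longrightarrow> \<bar>\<zeta>\<bar> \<le> a + b * \<bar>x\<bar>"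
  shows "\<bar>clarke_upper f x\<bar> \<le> a + b * \<bar>x\<bar>" "\<bar>clarke_lower f x\<bar> \<le> a + b * \<bar>x\<bar>"
    and "\<bar>f y - f x\<bar> \<le> (a + b * (\<bar>x\<bar> + \<bar>y\<bar>)) * \<bar>y - x\<bar>"
proof -
  show up: "\<bar>clarke_upper f x\<bar> \<le> a + b * \<bar>x\<bar>" and lo: "\<bar>clarke_lower f x\<bar> \<le> a + b * \<bar>x\<bar>" for x
    using clarke_lower_le_upper[OF lip] by (auto intro!: A3 clarke_interval_subset_subdiff[OF lip])
  have incr: "\<bar>f y - f x\<bar> \<le> (a + b * (\<bar>x\<bar> + \<bar>y\<bar>)) * (y - x)" if "x \<le> y" for x y
  proof (rule field_le_epsilon)
    fix e :: real assume e: "0 < e"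
    define M where "M = a + b * (\<bar>x\<bar> + \<bar>y\<bar>) + e / (1 + (y - x))"
    have M: "\<bar>clarke_upper f z\<bar> < M" "\<bar>clarke_lower f z\<bar> < M" if "x \<le> z" "z \<le> y" for z
    proof -
      have "b * \<bar>z\<bar> \<le> b * (\<bar>x\<bar> + \<bar>y\<bar>)" using that b by (intro mult_left_mono) auto
      then show "\<bar>clarke_upper f z\<bar> < M" "\<bar>clarke_lower f z\<bar> < M"
        using up[of z] lo[of z] e \<open>x \<le> y\<close> divide_pos_pos[of e "1 + (y - x)"] unfolding M_def by linarith+
    qed
    have "\<bar>f y - f x\<bar> \<le> M * (y - x)"
    proof (rule Bolzano[where P="\<lambda>u v. \<bar>f v - f u\<bar> \<le> M * (v - u)", OF \<open>x \<le> y\<close>])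
      fix u v w assume "\<bar>f v - f u\<bar> \<le> M * (v - u)" "\<bar>f w - f v\<bar> \<le> M * (w - v)"
      then have "\<bar>f w - f u\<bar> \<le> M * (v - u) + M * (w - v)" by linarith
      then show "\<bar>f w - f u\<bar> \<le> M * (w - u)" by (simp add: algebra_simps)
    next
      fix z assume "x \<le> z" "z \<le> y"
      then have z: "clarke_upper f z < M" "- M < clarke_lower f z" using M[of z] by auto
      obtain r s where r: "r > 0" "\<forall>u v. \<bar>u - z\<bar> < r \<and> \<bar>v - z\<bar> < r \<and> u < v \<longrightarrow> f v - f u < M * (v - u)"
        and s: "s > 0" "\<forall>u v. \<bar>u - z\<bar> < s \<and> \<bar>v - z\<bar> < s \<and> u < v \<longrightarrow> - M * (v - u) < f v - f u"
        using clarke_upper_lessD[OF lip z(1)] clarke_lower_greaterD[OF lip z(2)] by blast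
      have "\<bar>f v - f u\<bar> \<le> M * (v - u)" if "u \<le> z" "z \<le> v" "v - u < min r s" for u v
      proof (cases "u = v")
        case False
        then have "f v - f u < M * (v - u)" "- M * (v - u) < f v - f u"
          using that r(2)[rule_format, of u v] s(2)[rule_format, of u v] by auto
        then show ?thesis by auto
      qed simp
      then show "\<exists>d>0. \<forall>u v. u \<le> z \<and> z \<le> v \<and> v - u < d \<longrightarrow> \<bar>f v - f u\<bar> \<le> M * (v - u)"
        using r(1) s(1) by (intro exI[of _ "min r s"]) auto
    qed
    also have "\<dots> = (a + b * (\<bar>x\<bar> + \<bar>y\<bar>)) * (y - x) + e * ((y - x) / (1 + (y - x)))"
      by (simp add: M_def algebra_simps)
    also have "\<dots> \<le> (a + b * (\<bar>x\<bar> + \<bar>y\<bar>)) * (y - x) + e * 1"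
      using e that by (intro add_left_mono mult_left_mono) (auto simp: divide_le_eq)
    finally show "\<bar>f y - f x\<bar> \<le> (a + b * (\<bar>x\<bar> + \<bar>y\<bar>)) * (y - x) + e" by simp
  qed
  show "\<bar>f y - f x\<bar> \<le> (a + b * (\<bar>x\<bar> + \<bar>y\<bar>)) * \<bar>y - x\<bar>"
    using incr[of x y] incr[of y x] by (cases "x \<le> y") (auto simp: abs_minus_commute add.commute)
qed

lemma locally_lipschitz_imp_continuous_on:
  fixes f :: "real \<Rightarrow> real"
  assumes "locally_lipschitz f"
  shows "continuous_on UNIV f"
proof -
  have "isCont f x" for x
  proof -
    obtain r L where "r > 0" "L-lipschitz_on (ball x r) f"
      using assms unfolding locally_lipschitz_def by blast
    then show ?thesis
      using lipschitz_on_continuous_on continuous_on_eq_continuous_at[of "ball x r" f] by fastforce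
  qed
  then show ?thesis by (simp add: continuous_at_imp_continuous_on)
qed

text \<open>
  This is the minimum of \<open>\<zeta> * h\<close> over the Clarke subdifferential of a locally
  Lipschitz \<open>f\<close> at \<open>x\<close>, that is \<open>- f\<degree>(x; -h)\<close> for the Clarke directional derivative \<open>f\<degree>\<close>: the best general lower bound for a
  directional derivative of \<open>f\<close> at \<open>x\<close>.
\<close>

definition clarke_min_dd :: "(real \<Rightarrow> real) \<Rightarrow> real \<Rightarrow> real \<Rightarrow> real" where
  "clarke_min_dd f x h = (if h > 0 then clarke_lower f x * h else clarke_upper f x * h)"

text \<open>
  The quotients themselves need not converge, but their limit inferior is at least
  \<open>clarke_min_dd f x h\<close>. Truncating them from above at that value turns this into convergence, as
  required for dominated convergence.
\<close>

lemma tendsto_min_clarke_quotient: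
  fixes f :: "real \<Rightarrow> real" and p t :: "nat \<Rightarrow> real"
  assumes lip: "locally_lipschitz f"
    and t: "\<And>n. t n > 0" and p: "p \<longlonglongrightarrow> x" and h: "(\<lambda>n. (p n - x) / t n) \<longlonglongrightarrow> h"
  shows "(\<lambda>n. min ((f (p n) - f x) / t n) (clarke_min_dd f x h)) \<longlonglongrightarrow> clarke_min_dd f x h"
proof (rule order_tendstoI)
  let ?m = "clarke_min_dd f x h"
  fix c assume c: "c < ?m"
  have key: "\<forall>\<^sub>F n in sequentially. c < (f (p n) - f x) / t n"
    if C: "c < C * h" and ev: "\<forall>\<^sub>F n in sequentially. C * (p n - x) \<le> f (p n) - f x" for C
  proof -
    have "(\<lambda>n. C * ((p n - x) / t n)) \<longlonglongrightarrow> C * h" using h by (intro tendsto_intros)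
    from order_tendstoD(1)[OF this C] ev show ?thesis
    proof eventually_elim
      case (elim n)
      have "C * ((p n - x) / t n) \<le> (f (p n) - f x) / t n"
        using elim(2) t[of n] by (simp add: divide_right_mono)
      then show ?case using elim(1) by simp
    qed
  qed
  have near: "\<forall>\<^sub>F n in sequentially. \<bar>p n - x\<bar> < r" if "r > 0" for r
    using tendstoD[OF p that] by (simp add: dist_real_def)
  consider "h = 0" | "h > 0" | "h < 0" by linarith
  then have "\<forall>\<^sub>F n in sequentially. c < (f (p n) - f x) / t n"
  proof cases
    case 1
    obtain r L where r: "r > 0" and L: "L-lipschitz_on (ball x r) f"
      using lip unfolding locally_lipschitz_def by blast
    have "(\<lambda>n. - (L * \<bar>(p n - x) / t n\<bar>)) \<longlonglongrightarrow> - (L * \<bar>h\<bar>)" using h by (intro tendsto_intros)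
    moreover have "c < - (L * \<bar>h\<bar>)" using c 1 by (simp add: clarke_min_dd_def)
    ultimately have "\<forall>\<^sub>F n in sequentially. c < - (L * \<bar>(p n - x) / t n\<bar>)" by (rule order_tendstoD)
    then show ?thesis using near[OF r]
    proof eventually_elim
      case (elim n)
      have "\<bar>f (p n) - f x\<bar> \<le> L * \<bar>p n - x\<bar>"
        using lipschitz_onD[OF L, of "p n" x] elim(2) r by (simp add: dist_real_def abs_minus_commute)
      then have "\<bar>(f (p n) - f x) / t n\<bar> \<le> L * \<bar>(p n - x) / t n\<bar>"
        using t[of n] by (simp add: abs_divide divide_right_mono)
      then show ?case using elim(1) by linarith
    qed
  next
    case 2
    have "c / h < clarke_lower f x" using c 2 by (simp add: clarke_min_dd_def divide_less_eq)
    then obtain C where C: "c / h < C" "C < clarke_lower f x" using dense by blast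
    obtain r where r: "r > 0" "\<forall>y z. \<bar>y - x\<bar> < r \<and> \<bar>z - x\<bar> < r \<and> y < z \<longrightarrow> C * (z - y) < f z - f y"
      using clarke_lower_greaterD[OF lip C(2)] by blast
    show ?thesis
    proof (rule key)
      show "c < C * h" using C(1) 2 by (simp add: divide_less_eq)
      show "\<forall>\<^sub>F n in sequentially. C * (p n - x) \<le> f (p n) - f x"
        using near[OF r(1)] order_tendstoD(1)[OF h 2]
      proof eventually_elim
        case (elim n)
        then have "x < p n" using t[of n] by (simp add: zero_less_divide_iff)
        then show ?case using r(2)[rule_format, of x "p n"] r(1) elim by auto
      qed
    qed
  next
    case 3
    have "clarke_upper f x < c / h" using c 3 by (simp add: clarke_min_dd_def less_divide_eq)
    then obtain C where C: "C < c / h" "clarke_upper f x < C" using dense by blast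
    obtain r where r: "r > 0" "\<forall>y z. \<bar>y - x\<bar> < r \<and> \<bar>z - x\<bar> < r \<and> y < z \<longrightarrow> f z - f y < C * (z - y)"
      using clarke_upper_lessD[OF lip C(2)] by blast
    show ?thesis
    proof (rule key)
      show "c < C * h" using C(1) 3 by (simp add: less_divide_eq)
      show "\<forall>\<^sub>F n in sequentially. C * (p n - x) \<le> f (p n) - f x"
        using near[OF r(1)] order_tendstoD(2)[OF h 3]
      proof eventually_elim
        case (elim n)
        then have "p n < x" using t[of n] by (simp add: divide_less_0_iff)
        then show ?case using r(2)[rule_format, of "p n" x] r(1) elim by (auto simp: algebra_simps)
      qed
    qed
  qed
  then show "\<forall>\<^sub>F n in sequentially. c < min ((f (p n) - f x) / t n) ?m"
    by eventually_elim (use c in simp)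
next
  fix c assume "clarke_min_dd f x h < c"
  then show "\<forall>\<^sub>F n in sequentially. min ((f (p n) - f x) / t n) (clarke_min_dd f x h) < c"
    by (intro always_eventually) auto
qed

section \<open>Square-integrable functions and minimisers on order intervals\<close>

lemma finite_measure_lborel01: "finite_measure lborel01" "measure lborel01 (space lborel01) = 1"
proof -
  have "emeasure lborel01 (space lborel01) = 1"
    by (subst emeasure_restrict_space) (auto simp: space_restrict_space)
  then show "finite_measure lborel01" "measure lborel01 (space lborel01) = 1"
    by (auto intro!: finite_measureI simp: measure_def)
qed

interpretation lborel01: finite_measure lborel01
  by (rule finite_measure_lborel01)

lemma integral_const_lborel01 [simp]: "(LINT u|lborel01. (c::real)) = c"
  using finite_measure_lborel01(2) by simp

lemma space_lborel01 [simp]: "space lborel01 = {0<..<1}"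
  by (simp add: space_restrict_space)

lemma measure_lborel01_unit [simp]: "measure lborel01 {0<..<1} = 1"
  using finite_measure_lborel01(2) by simp

lemma measurable_id_lborel01 [measurable]: "(\<lambda>u. u) \<in> borel_measurable lborel01"
  by (rule measurable_restrict_space1) simp

lemma AE_lborel01: "(AE u in lborel01. P u) \<longleftrightarrow> (AE u in lborel. u \<in> {0<..<1} \<longrightarrow> P u)"
  by (rule AE_restrict_space_iff) simp

lemma AE_lborel01_neq: "AE u in lborel01. u \<noteq> t"
  unfolding AE_lborel01 using AE_lborel_singleton[of t] by eventually_elim simp

lemma AE_interval_witness:
  fixes a b :: real
  assumes "AE u in lborel. u \<in> {a<..<b} \<longrightarrow> P u" "a < b"
  shows "\<exists>u\<in>{a<..<b}. P u"
proof (rule ccontr)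
  assume "\<not> ?thesis"
  with assms(1) have "AE u in lborel. u \<notin> {a<..<b}" by (auto elim: eventually_mono)
  then have "emeasure lborel {a<..<b} = 0"
    using AE_iff_null_sets[of "{a<..<b}" lborel] by (simp add: null_setsD1)
  then show False using assms(2) by simp
qed

lemma L2_integrable_square: "f \<in> L2 \<Longrightarrow> integrable lborel01 (\<lambda>u. (f u)\<^sup>2)"
  by (simp add: L2_def)

lemma L2_bound:
  assumes "g \<in> L2" "f \<in> borel_measurable lborel01" "AE u in lborel01. \<bar>f u\<bar> \<le> \<bar>g u\<bar>"
  shows "f \<in> L2"
proof -
  have "integrable lborel01 (\<lambda>u. (f u)\<^sup>2)"
    by (rule Bochner_Integration.integrable_bound[OF L2_integrable_square[OF assms(1)]])
      (use assms(2,3) in \<open>auto elim!: eventually_mono simp: abs_le_square_iff\<close>)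
  then show ?thesis using assms(2) by (simp add: L2_def)
qed

lemma L2_mult_integrable:
  assumes "f \<in> L2" "g \<in> L2"
  shows "integrable lborel01 (\<lambda>u. f u * g u)"
proof (rule Bochner_Integration.integrable_bound)
  show "integrable lborel01 (\<lambda>u. (f u)\<^sup>2 + (g u)\<^sup>2)"
    using assms by (auto simp: L2_def)
  show "(\<lambda>u. f u * g u) \<in> borel_measurable lborel01"
    using assms by (auto simp: L2_def)
  have "\<bar>a * b\<bar> \<le> a\<^sup>2 + b\<^sup>2" for a b :: real
  proof -
    have "2 * (\<bar>a\<bar> * \<bar>b\<bar>) \<le> a\<^sup>2 + b\<^sup>2"
      using sum_squares_bound[of "\<bar>a\<bar>" "\<bar>b\<bar>"] by simp
    moreover have "0 \<le> \<bar>a\<bar> * \<bar>b\<bar>" by simp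
    ultimately show ?thesis unfolding abs_mult by linarith
  qed
  then show "AE u in lborel01. norm (f u * g u) \<le> norm ((f u)\<^sup>2 + (g u)\<^sup>2)" by auto
qed

lemma L2_const [simp, intro]: "(\<lambda>_. c) \<in> L2"
  by (simp add: L2_def)

lemma L2_integrable: "f \<in> L2 \<Longrightarrow> integrable lborel01 f"
  using L2_mult_integrable[of f "\<lambda>_. 1"] by simp

lemma L2_cmult: "f \<in> L2 \<Longrightarrow> (\<lambda>u. c * f u) \<in> L2"
  by (auto simp: L2_def power_mult_distrib)

lemma L2_add:
  assumes "f \<in> L2" "g \<in> L2"
  shows "(\<lambda>u. f u + g u) \<in> L2"
proof -
  have "integrable lborel01 (\<lambda>u. (f u)\<^sup>2 + (g u)\<^sup>2 + 2 * (f u * g u))"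
    using assms L2_mult_integrable[OF assms] by (auto simp: L2_def)
  then show ?thesis using assms by (auto simp: L2_def power2_sum mult.assoc)
qed

lemma L2_diff: "f \<in> L2 \<Longrightarrow> g \<in> L2 \<Longrightarrow> (\<lambda>u. f u - g u) \<in> L2"
  using L2_add[of f "\<lambda>u. - 1 * g u"] L2_cmult[of g "-1"] by simp

lemma L2_abs: "f \<in> L2 \<Longrightarrow> (\<lambda>u. \<bar>f u\<bar>) \<in> L2"
  by (auto simp: L2_def)

text \<open>
  An order interval \<open>[f, g]\<close> of square-integrable functions is bounded but not norm compact, so a
  minimising sequence of a convex \<open>\<Phi>\<close> need not converge, and weak compactness is replaced by a
  second minimisation. The sublevel sets \<open>S n\<close> of \<open>\<Phi>\<close> decrease, hence the infima \<open>r n\<close> of the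
  squared norm over them increase to a finite limit. A sequence of almost norm-minimal
  \<open>w n \<in> S n\<close> is Cauchy by the parallelogram law, because the midpoint of \<open>w i\<close> and \<open>w j\<close>
  stays in \<open>S i\<close> and cannot have squared norm below \<open>r i\<close>. A rapidly converging subsequence
  converges almost everywhere, and the continuity asked of \<open>\<Phi>\<close> is along such sequences only.
\<close>

lemma order_interval_minimizer:
  fixes M :: "'a measure" and f g :: "'a \<Rightarrow> real" and \<Phi> :: "('a \<Rightarrow> real) \<Rightarrow> real"
  defines "W \<equiv> {w \<in> borel_measurable M. \<forall>x. f x \<le> w x \<and> w x \<le> g x}"
  assumes fin: "finite_measure M"
    and f[measurable]: "f \<in> borel_measurable M" and g[measurable]: "g \<in> borel_measurable M"
    and fg: "\<And>x. f x \<le> g x"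
    and f2: "integrable M (\<lambda>x. (f x)\<^sup>2)" and g2: "integrable M (\<lambda>x. (g x)\<^sup>2)"
    and \<Phi>0: "\<And>w. w \<in> W \<Longrightarrow> 0 \<le> \<Phi> w"
    and conv: "\<And>v w. v \<in> W \<Longrightarrow> w \<in> W \<Longrightarrow> \<Phi> (\<lambda>x. (v x + w x) / 2) \<le> max (\<Phi> v) (\<Phi> w)"
    and cont: "\<And>w w'. (\<And>n::nat. w n \<in> W) \<Longrightarrow> w' \<in> W \<Longrightarrow> AE x in M. (\<lambda>n. w n x) \<longlonglongrightarrow> w' x \<Longrightarrow>
      (\<lambda>n. \<Phi> (w n)) \<longlonglongrightarrow> \<Phi> w'"
  shows "\<exists>w\<in>W. \<forall>v\<in>W. \<Phi> w \<le> \<Phi> v"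
proof -
  interpret finite_measure M by (rule fin)
  have fW: "f \<in> W" using fg by (auto simp: W_def)
  have Wm[measurable_dest]: "w \<in> borel_measurable M" if "w \<in> W" for w using that by (simp add: W_def)
  define N where "N w = (LINT x|M. (w x)\<^sup>2)" for w :: "'a \<Rightarrow> real"
  define R where "R = (LINT x|M. (f x)\<^sup>2 + (g x)\<^sup>2)"
  have R: "integrable M (\<lambda>x. (f x)\<^sup>2 + (g x)\<^sup>2)" using f2 g2 by simp
  have Wsq: "(w x)\<^sup>2 \<le> (f x)\<^sup>2 + (g x)\<^sup>2" if "w \<in> W" for w x
  proof (cases "w x \<ge> 0")
    case True
    then have "(w x)\<^sup>2 \<le> (g x)\<^sup>2" using that by (intro power_mono) (auto simp: W_def)
    then show ?thesis by (simp add: add_increasing)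
  next
    case False
    then have "(- w x)\<^sup>2 \<le> (- f x)\<^sup>2" using that by (intro power_mono) (auto simp: W_def)
    then show ?thesis by (simp add: add_increasing2)
  qed
  have Wint: "integrable M (\<lambda>x. (w x)\<^sup>2)" if "w \<in> W" for w
  proof (rule Bochner_Integration.integrable_bound[OF R])
    show "(\<lambda>x. (w x)\<^sup>2) \<in> borel_measurable M" using Wm[OF that] by measurable
  qed (use Wsq[OF that] in auto)
  have NR: "N w \<le> R" if "w \<in> W" for w
    unfolding N_def R_def by (intro integral_mono Wint[OF that] R Wsq[OF that])
  have N0: "0 \<le> N w" for w unfolding N_def by simp
  have mid: "(\<lambda>x. (v x + w x) / 2) \<in> W" if "v \<in> W" "w \<in> W" for v w
  proof -
    have [measurable]: "v \<in> borel_measurable M" "w \<in> borel_measurable M" using that Wm by auto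
    have "f x \<le> (v x + w x) / 2 \<and> (v x + w x) / 2 \<le> g x" for x
      using that by (simp add: W_def) (smt (verit) field_sum_of_halves)
    then show ?thesis by (auto simp: W_def)
  qed
  define m where "m = (INF w\<in>W. \<Phi> w)"
  have bdd: "bdd_below (\<Phi> ` W)" using \<Phi>0 by (intro bdd_belowI[of _ 0]) auto
  have m: "m \<le> \<Phi> w" if "w \<in> W" for w unfolding m_def by (rule cINF_lower[OF bdd that])
  define e where "e n = 1 / (real n + 1)" for n :: nat
  have e: "0 < e n" for n by (simp add: e_def)
  have e_dec: "e j \<le> e i" if "i \<le> j" for i j using that by (simp add: e_def frac_le)
  have e_lim: "e \<longlonglongrightarrow> 0" unfolding e_def using LIMSEQ_inverse_real_of_nat by (simp add: inverse_eq_divide add.commute)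
  define S where "S n = {w \<in> W. \<Phi> w \<le> m + e n}" for n
  have S_ne: "S n \<noteq> {}" for n
  proof -
    have "(INF w\<in>W. \<Phi> w) < m + e n" using e[of n] by (simp add: m_def)
    then obtain w where "w \<in> W" "\<Phi> w < m + e n" using cINF_less_iff[OF _ bdd] fW by blast
    then show ?thesis by (auto simp: S_def)
  qed
  have S_dec: "S j \<subseteq> S i" if "i \<le> j" for i j using e_dec[OF that] by (force simp: S_def)
  define r where "r n = (INF w\<in>S n. N w)" for n
  have bddN: "bdd_below (N ` A)" for A using N0 by (intro bdd_belowI[of _ 0]) auto
  have r_le: "r n \<le> N w" if "w \<in> S n" for n w unfolding r_def by (rule cINF_lower[OF bddN that])
  have r_mono: "r i \<le> r j" if "i \<le> j" for i j
    unfolding r_def by (rule cINF_superset_mono[OF S_ne bddN S_dec[OF that]]) simp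
  have rR: "r n \<le> R" for n using S_ne[of n] r_le[of _ n] NR by (fastforce simp: S_def)
  obtain r' where r': "r \<longlonglongrightarrow> r'" "\<And>n. r n \<le> r'"
    using incseq_convergent[of r R] r_mono rR by (auto simp: incseq_def)
  have "\<exists>w. w \<in> S n \<and> N w \<le> r n + e n" for n
  proof -
    have "(INF w\<in>S n. N w) < r n + e n" using e[of n] by (simp add: r_def)
    then show ?thesis using cINF_less_iff[OF S_ne bddN] by (metis less_imp_le)
  qed
  then obtain w where wS: "\<And>n. w n \<in> S n" and wN: "\<And>n. N (w n) \<le> r n + e n" by metis
  have wW: "w n \<in> W" for n using wS by (auto simp: S_def)
  define \<eta> where "\<eta> n = 2 * (r' - r n) + 4 * e n" for n
  have \<eta>_lim: "\<eta> \<longlonglongrightarrow> 0"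
    unfolding \<eta>_def by (rule tendsto_eq_intros r'(1) e_lim refl | simp)+
  have cauchy: "N (\<lambda>x. w j x - w i x) \<le> \<eta> i" if "i \<le> j" for i j
  proof -
    let ?c = "\<lambda>x. (w i x + w j x) / 2"
    have "\<Phi> ?c \<le> m + e i"
      using conv[OF wW wW, of i j] wS[of i] wS[of j] e_dec[OF that] by (auto simp: S_def)
    then have "?c \<in> S i" using mid[OF wW wW] by (simp add: S_def)
    then have "r i \<le> N ?c" by (rule r_le)
    have "N (\<lambda>x. w j x - w i x) = (LINT x|M. 2 * (w i x)\<^sup>2 + 2 * (w j x)\<^sup>2 - 4 * (?c x)\<^sup>2)"
      unfolding N_def by (intro Bochner_Integration.integral_cong refl) (simp add: power2_eq_square field_simps)
    also have "\<dots> = 2 * N (w i) + 2 * N (w j) - 4 * N ?c"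
      unfolding N_def using Wint[OF wW] Wint[OF mid[OF wW wW]]
      by (subst Bochner_Integration.integral_diff Bochner_Integration.integral_add; simp)+
    also have "\<dots> \<le> \<eta> i"
      using \<open>r i \<le> N ?c\<close> wN[of i] wN[of j] r'(2)[of j] e_dec[OF that] by (simp add: \<eta>_def)
    finally show ?thesis .
  qed
  have "\<exists>k. \<forall>i\<ge>k. \<eta> i < (1/4) ^ n" for n
    using order_tendstoD(2)[OF \<eta>_lim, of "(1/4) ^ n"] by (simp add: eventually_sequentially)
  then obtain K where K: "\<And>n i. K n \<le> i \<Longrightarrow> \<eta> i < (1/4) ^ n" by metis
  \<comment> \<open>The added 1 forces \<open>n \<le> s n\<close>, so that the minimising property passes to the subsequence.\<close>
  define s where "s n = (\<Sum>k\<le>n. K k + 1)" for n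
  have s_step: "s n \<le> s (Suc n)" for n by (simp add: s_def)
  have s_K: "K n \<le> s n" for n unfolding s_def by (cases n) (auto simp: )
  have s_n: "n \<le> s n" for n
  proof (induction n)
    case (Suc n) then show ?case by (simp add: s_def)
  qed simp
  define v where "v n = w (s n)" for n
  have vW: "v n \<in> W" for n by (simp add: v_def wW)
  then have vm[measurable]: "v n \<in> borel_measurable M" for n using Wm by blast
  define D where "D n x = \<bar>v (Suc n) x - v n x\<bar>" for n x
  have D[measurable]: "D n \<in> borel_measurable M" for n unfolding D_def by measurable
  have Dint: "integrable M (\<lambda>x. (D n x)\<^sup>2)" for n
  proof (rule Bochner_Integration.integrable_bound)
    show "integrable M (\<lambda>x. 2 * (v (Suc n) x)\<^sup>2 + 2 * (v n x)\<^sup>2)" using Wint[OF vW] by simp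
    have "(D n x)\<^sup>2 \<le> 2 * (v (Suc n) x)\<^sup>2 + 2 * (v n x)\<^sup>2" for x
      using zero_le_power2[of "v (Suc n) x + v n x"] by (simp add: D_def power2_eq_square algebra_simps)
    then show "AE x in M. norm ((D n x)\<^sup>2) \<le> norm (2 * (v (Suc n) x)\<^sup>2 + 2 * (v n x)\<^sup>2)" by auto
  qed simp
  have DN: "(LINT x|M. (D n x)\<^sup>2) \<le> (1/4) ^ n" for n
    using cauchy[OF s_step[of n]] K[OF s_K[of n]] by (simp add: D_def N_def v_def)
  \<comment> \<open>This trades the square integral of \<open>D n\<close>, of order \<open>4\<close> to the power \<open>-n\<close>, for a summable bound on its integral.\<close>
  have D_bound: "D n x \<le> (1/2) ^ n + 2 ^ n * (D n x)\<^sup>2" for n x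
  proof (cases "D n x \<le> (1/2) ^ n")
    case True
    have "0 \<le> 2 ^ n * (D n x)\<^sup>2" by simp
    then show ?thesis using True by linarith
  next
    case False
    then have "2 ^ n * (1/2) ^ n \<le> 2 ^ n * D n x" by (intro mult_left_mono) auto
    then have "1 * D n x \<le> (2 ^ n * D n x) * D n x"
      by (intro mult_right_mono) (auto simp: D_def power_one_over)
    then have "D n x \<le> 2 ^ n * (D n x)\<^sup>2" by (simp add: power2_eq_square mult.assoc)
    moreover have "(0::real) \<le> (1/2) ^ n" by simp
    ultimately show ?thesis by linarith
  qed
  define \<mu> where "\<mu> = measure M (space M)"
  have Dnn: "(\<integral>\<^sup>+x. ennreal (D n x) \<partial>M) \<le> ennreal ((1/2) ^ n * (\<mu> + 1))" for n
  proof -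
    have "(\<integral>\<^sup>+x. ennreal (D n x) \<partial>M) \<le> (\<integral>\<^sup>+x. ennreal ((1/2) ^ n + 2 ^ n * (D n x)\<^sup>2) \<partial>M)"
      by (intro nn_integral_mono ennreal_leI D_bound)
    also have "\<dots> = ennreal (LINT x|M. (1/2) ^ n + 2 ^ n * (D n x)\<^sup>2)"
      by (rule nn_integral_eq_integral) (use Dint in auto)
    also have "\<dots> \<le> ennreal ((1/2) ^ n * (\<mu> + 1))"
    proof (rule ennreal_leI)
      have "(LINT x|M. (1/2) ^ n + 2 ^ n * (D n x)\<^sup>2) = (1/2) ^ n * \<mu> + 2 ^ n * (LINT x|M. (D n x)\<^sup>2)"
        using Dint[of n] by (simp add: \<mu>_def)
      also have "\<dots> \<le> (1/2) ^ n * \<mu> + 2 ^ n * (1/4) ^ n"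
        using DN[of n] by (intro add_left_mono mult_left_mono) auto
      also have "(2::real) ^ n * (1/4) ^ n = (1/2) ^ n" by (simp add: power_mult_distrib[symmetric])
      finally show "(LINT x|M. (1/2) ^ n + 2 ^ n * (D n x)\<^sup>2) \<le> (1/2) ^ n * (\<mu> + 1)"
        by (simp add: algebra_simps)
    qed
    finally show ?thesis .
  qed
  have "(\<integral>\<^sup>+x. (\<Sum>n. ennreal (D n x)) \<partial>M) = (\<Sum>n. \<integral>\<^sup>+x. ennreal (D n x) \<partial>M)"
    by (rule nn_integral_suminf) measurable
  also have "\<dots> \<le> (\<Sum>n. ennreal ((1/2) ^ n * (\<mu> + 1)))"
    by (intro suminf_le Dnn) auto
  also have "\<dots> < top"
  proof -
    have "(\<Sum>n. ennreal ((1/2) ^ n * (\<mu> + 1))) \<noteq> top"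
      by (intro ennreal_suminf_neq_top summable_mult2 summable_geometric) (auto simp: \<mu>_def)
    then show ?thesis by (simp add: less_top)
  qed
  finally have "AE x in M. (\<Sum>n. ennreal (D n x)) \<noteq> \<infinity>"
    by (intro nn_integral_PInf_AE) auto
  then have conv_v: "AE x in M. convergent (\<lambda>n. v n x)"
  proof eventually_elim
    case (elim x)
    then have "summable (\<lambda>n. D n x)"
      by (intro summable_suminf_not_top) (auto simp: D_def)
    then have "summable (\<lambda>n. v (Suc n) x - v n x)"
      unfolding D_def by (rule summable_rabs_cancel)
    then have "convergent (\<lambda>n. v n x - v 0 x)"
      unfolding summable_iff_convergent by (subst (asm) sum_lessThan_telescope)
    then have "convergent (\<lambda>n. (v n x - v 0 x) + v 0 x)"
      by (intro convergent_add convergent_const)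
    then show ?case by simp
  qed
  \<comment> \<open>Clamping makes the limit a member of the order interval also on the null set of divergence.\<close>
  define w' where "w' x = max (f x) (min (g x) (lim (\<lambda>n. v n x)))" for x
  have "w' \<in> borel_measurable M" unfolding w'_def by measurable
  then have w'W: "w' \<in> W" using fg by (auto simp: W_def w'_def)
  have "AE x in M. (\<lambda>n. v n x) \<longlonglongrightarrow> w' x"
    using conv_v
  proof eventually_elim
    case (elim x)
    then have l: "(\<lambda>n. v n x) \<longlonglongrightarrow> lim (\<lambda>n. v n x)" by (simp add: convergent_LIMSEQ_iff)
    have "f x \<le> lim (\<lambda>n. v n x)" "lim (\<lambda>n. v n x) \<le> g x"
      using vW by (auto intro!: LIMSEQ_le_const[OF l] LIMSEQ_le_const2[OF l] simp: W_def)
    then show ?case using l by (simp add: w'_def)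
  qed
  then have "(\<lambda>n. \<Phi> (v n)) \<longlonglongrightarrow> \<Phi> w'" by (rule cont[OF vW w'W])
  moreover have "(\<lambda>n. m + e n) \<longlonglongrightarrow> m + 0" by (intro tendsto_intros e_lim)
  moreover have "\<Phi> (v n) \<le> m + e n" for n
    using wS[of "s n"] e_dec[OF s_n[of n]] by (auto simp: S_def v_def)
  ultimately have "\<Phi> w' \<le> m + 0" by (intro LIMSEQ_le[of _ "\<Phi> w'" _ "m + 0"]) auto
  then show ?thesis using w'W m by force
qed

section \<open>Tail integrals and the polar of the monotone cone\<close>

lemma Fubini_kernel:
  fixes c :: "'a \<Rightarrow> real" and v :: "'b \<Rightarrow> real"
  assumes M: "sigma_finite_measure M" and N: "sigma_finite_measure N"
    and c: "integrable M c" and v: "integrable N v"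
    and R[measurable]: "Measurable.pred (M \<Otimes>\<^sub>M N) (\<lambda>x. R (fst x) (snd x))"
  shows "(LINT t|M. c t * (LINT u|N. (if R t u then v u else 0))) =
    (LINT u|N. v u * (LINT t|M. (if R t u then c t else 0)))"
proof -
  interpret M: sigma_finite_measure M by (rule M)
  interpret N: sigma_finite_measure N by (rule N)
  interpret pair_sigma_finite M N ..
  have [measurable]: "c \<in> borel_measurable M" "v \<in> borel_measurable N" using c v by auto
  let ?f = "\<lambda>(t, u). c t * (if R t u then v u else 0)"
  have m[measurable]: "?f \<in> borel_measurable (M \<Otimes>\<^sub>M N)"
    by (simp add: case_prod_beta) measurable
  have Rt: "Measurable.pred N (\<lambda>u. R t u)" if "t \<in> space M" for t
    using measurable_compose[OF measurable_Pair1'[OF that] R] by simp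
  have iu: "integrable N (\<lambda>u. if R t u then v u else 0)" if "t \<in> space M" for t
  proof (rule Bochner_Integration.integrable_bound[OF v])
    have [measurable]: "Measurable.pred N (\<lambda>u. R t u)" by (rule Rt[OF that])
    show "(\<lambda>u. if R t u then v u else 0) \<in> borel_measurable N" by measurable
  qed auto
  have int: "integrable (M \<Otimes>\<^sub>M N) ?f"
  proof (rule Fubini_integrable[OF m])
    show "integrable M (\<lambda>t. LINT u|N. norm (?f (t, u)))"
    proof (rule Bochner_Integration.integrable_bound)
      show "integrable M (\<lambda>t. \<bar>c t\<bar> * (LINT u|N. \<bar>v u\<bar>))" using c by simp
      show "(\<lambda>t. LINT u|N. norm (?f (t, u))) \<in> borel_measurable M" by measurable
      have "(LINT u|N. \<bar>c t * (if R t u then v u else 0)\<bar>) \<le> \<bar>c t\<bar> * (LINT u|N. \<bar>v u\<bar>)"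
        if "t \<in> space M" for t
      proof -
        have "(LINT u|N. \<bar>c t * (if R t u then v u else 0)\<bar>) \<le> (LINT u|N. \<bar>c t\<bar> * \<bar>v u\<bar>)"
          using iu[OF that] v by (intro integral_mono) (auto simp: abs_mult)
        then show ?thesis by simp
      qed
      then show "AE t in M. norm (LINT u|N. norm (?f (t, u))) \<le> norm (\<bar>c t\<bar> * (LINT u|N. \<bar>v u\<bar>))"
        by (intro AE_I2) (simp add: abs_mult)
    qed
    show "AE t in M. integrable N (\<lambda>u. ?f (t, u))"
      using iu by (intro AE_I2) simp
  qed
  have "(LINT t|M. c t * (LINT u|N. (if R t u then v u else 0))) = (LINT t|M. LINT u|N. ?f (t, u))"
    by simp
  also have "\<dots> = (LINT u|N. LINT t|M. ?f (t, u))"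
    using Fubini_integral[of "\<lambda>t u. ?f (t, u)"] int by simp
  also have "\<dots> = (LINT u|N. v u * (LINT t|M. (if R t u then c t else 0)))"
  proof (rule Bochner_Integration.integral_cong[OF refl])
    fix u
    have "(\<lambda>t. ?f (t, u)) = (\<lambda>t. v u * (if R t u then c t else 0))" by auto
    then show "(LINT t|M. ?f (t, u)) = v u * (LINT t|M. (if R t u then c t else 0))" by simp
  qed
  finally show ?thesis .
qed

text \<open>
  Pairing with the step functions that jump from 0 to 1 at \<open>t\<close>, the extreme rays of the monotone
  cone modulo constants.
\<close>

definition tail_integral :: "(real \<Rightarrow> real) \<Rightarrow> real \<Rightarrow> real" where
  "tail_integral v t = (LINT u|lborel01. (if t < u then v u else 0))"

lemma tail_integrable:
  fixes v :: "real \<Rightarrow> real"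
  assumes "integrable lborel01 v"
  shows "integrable lborel01 (\<lambda>u. if t < u then v u else 0)"
proof (rule Bochner_Integration.integrable_bound[OF assms])
  show "(\<lambda>u. if t < u then v u else 0) \<in> borel_measurable lborel01"
    using assms by (auto dest: borel_measurable_integrable)
qed auto

lemma tail_integral_bound:
  assumes "integrable lborel01 v" "integrable lborel01 H" "AE u in lborel01. \<bar>v u\<bar> \<le> H u"
  shows "\<bar>tail_integral v t\<bar> \<le> (LINT u|lborel01. H u)"
proof -
  have "\<bar>tail_integral v t\<bar> \<le> (LINT u|lborel01. \<bar>if t < u then v u else 0\<bar>)"
    unfolding tail_integral_def by (rule integral_abs_bound)
  also have "\<dots> \<le> (LINT u|lborel01. H u)"
    using tail_integrable[OF assms(1)] assms(2,3)
    by (intro integral_mono_AE integrable_abs) (auto elim: eventually_mono)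
  finally show ?thesis .
qed

lemma tail_integral_continuous:
  assumes v: "integrable lborel01 v"
  shows "continuous_on UNIV (tail_integral v)"
  unfolding continuous_on_sequentially
proof (intro allI ballI impI, elim conjE)
  fix x :: "nat \<Rightarrow> real" and t assume x: "x \<longlonglongrightarrow> t"
  have [measurable]: "v \<in> borel_measurable lborel01" using v by auto
  have "(\<lambda>n. LINT u|lborel01. (if x n < u then v u else 0)) \<longlonglongrightarrow> (LINT u|lborel01. (if t < u then v u else 0))"
  proof (rule integral_dominated_convergence[where w="\<lambda>u. \<bar>v u\<bar>"])
    show "AE u in lborel01. (\<lambda>n. if x n < u then v u else 0) \<longlonglongrightarrow> (if t < u then v u else 0)"
      using AE_lborel01_neq[of t]
    proof eventually_elim
      case (elim u)
      have "\<forall>\<^sub>F n in sequentially. (if x n < u then v u else 0) = (if t < u then v u else 0)"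
      proof (cases "t < u")
        case True
        from order_tendstoD(2)[OF x this] show ?thesis by eventually_elim (use True in simp)
      next
        case False
        then have "u < t" using elim by simp
        from order_tendstoD(1)[OF x this] show ?thesis by eventually_elim (use False in simp)
      qed
      then show ?case by (rule tendsto_eventually)
    qed
  qed (use v in auto)
  then show "(tail_integral v \<circ> x) \<longlonglongrightarrow> tail_integral v t" by (simp add: tail_integral_def o_def)
qed

lemma tail_integral_measurable [measurable]:
  assumes v: "integrable lborel01 v"
  shows "tail_integral v \<in> borel_measurable lborel01"
  using borel_measurable_continuous_onI[OF tail_integral_continuous[OF v]]
  by (intro measurable_restrict_space1) simp

lemma tail_integral_full:
  "t \<le> 0 \<Longrightarrow> tail_integral v t = (LINT u|lborel01. v u)"
  unfolding tail_integral_def by (intro Bochner_Integration.integral_cong refl) auto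

lemma mono_on_borel_lborel01:
  fixes r :: "real \<Rightarrow> real"
  assumes "mono_on {0<..<1} r"
  shows "r \<in> borel_measurable lborel01"
proof -
  have "r \<in> borel_measurable (restrict_space borel {0<..<1})"
    by (rule borel_measurable_mono_on_fnc[OF assms])
  moreover have "sets (restrict_space borel {0<..<1::real}) = sets lborel01" by (simp add: sets_restrict_space)
  ultimately show ?thesis by (simp cong: measurable_cong_sets)
qed

lemma monotone_coneI:
  fixes r :: "real \<Rightarrow> real"
  assumes "r \<in> L2" "mono_on {0<..<1} r"
  shows "r \<in> monotone_cone"
  using assms by (auto simp: monotone_cone_def)

text \<open>
  A superlevel set of a nondecreasing function on \<open>(0, 1)\<close> is, up to one point, empty or a right
  end segment.
\<close>

lemma integral_superlevel_nonpos:
  fixes r :: "real \<Rightarrow> real"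
  assumes z: "integrable lborel01 z" and z0: "(LINT u|lborel01. z u) = 0"
    and tail: "\<And>t. t \<in> {0<..<1} \<Longrightarrow> tail_integral z t \<le> 0"
    and r: "mono_on {0<..<1} r"
  shows "(LINT u|lborel01. (if s < r u then z u else 0)) \<le> 0"
proof (cases "\<exists>u\<in>{0<..<1}. s < r u")
  case False
  then have "(LINT u|lborel01. (if s < r u then z u else 0)) = (LINT u|lborel01. 0)"
    by (intro Bochner_Integration.integral_cong) auto
  then show ?thesis by simp
next
  case True
  have [measurable]: "z \<in> borel_measurable lborel01" "r \<in> borel_measurable lborel01"
    using z mono_on_borel_lborel01[OF r] by auto
  define S where "S = {u\<in>{0<..<1}. s < r u}"
  define t where "t = Inf S"
  have S: "S \<noteq> {}" "bdd_below S" "S \<subseteq> {0<..<1}" using True by (auto simp: S_def intro!: bdd_belowI[of _ 0])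
  have t0: "0 \<le> t" unfolding t_def by (rule cInf_greatest[OF S(1)]) (use S(3) in force)
  have lower: "t \<le> u" if "u \<in> S" for u unfolding t_def by (rule cInf_lower[OF that S(2)])
  then have t1: "t < 1" using S(1,3) by fastforce
  have above: "u \<in> S" if u: "t < u" "u \<in> {0<..<1}" for u
  proof -
    obtain u' where u': "u' \<in> S" "u' < u" using cInf_less_iff[OF S(1,2)] u(1) by (auto simp: t_def)
    then have "r u' \<le> r u" using u by (intro mono_onD[OF r]) (auto simp: S_def)
    then show ?thesis using u u' by (auto simp: S_def)
  qed
  have "(LINT u|lborel01. (if s < r u then z u else 0)) = tail_integral z t"
    unfolding tail_integral_def
  proof (rule integral_cong_AE)
    show "AE u in lborel01. (if s < r u then z u else 0) = (if t < u then z u else 0)"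
      using AE_lborel01_neq[of t] AE_space
    proof eventually_elim
      case (elim u)
      have "s < r u \<longleftrightarrow> t < u"
        using above[of u] lower[of u] elim by (auto simp: S_def)
      then show ?case by simp
    qed
  qed measurable
  also have "\<dots> \<le> 0"
    using tail[of t] t0 t1 tail_integral_full[of t z] z0 by (cases "t = 0") auto
  finally show ?thesis .
qed

text \<open>
  The layer-cake formula for a real number truncated to \<open>[-N, N]\<close>.
\<close>

lemma integral_clamp_eq:
  fixes x :: real
  assumes "0 \<le> N"
  shows "(LINT s|lborel. (if s < x then indicator {- N..N} s else 0)) = max (- N) (min N x) + N"
proof -
  have "(LINT s|lborel. (if s < x then indicator {- N..N} s else 0)) = (LINT s|lborel. (indicator {- N..<max (- N) (min N x)} s :: real))"
  proof (rule integral_cong_AE)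
    show "AE s in lborel. (if s < x then indicator {- N..N} s else 0) = (indicator {- N..<max (- N) (min N x)} s :: real)"
      using AE_lborel_singleton[of N] AE_lborel_singleton[of "- N"]
      by eventually_elim (auto simp: indicator_def)
  qed auto
  also have "\<dots> = max (- N) (min N x) + N"
    using assms by simp
  finally show ?thesis .
qed

text \<open>
  By the layer-cake formula a bounded nondecreasing function is a constant plus an average of
  indicators of its superlevel sets; Fubini's theorem turns the pairing with \<open>z\<close> into an average of
  nonpositive numbers. Truncation and dominated convergence cover the unbounded functions.
\<close>

lemma monotone_cone_polarI:
  assumes z: "z \<in> L2" and z0: "(LINT u|lborel01. z u) = 0"
    and tail: "\<And>t. t \<in> {0<..<1} \<Longrightarrow> tail_integral z t \<le> 0"
    and k: "k \<in> monotone_cone"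
  shows "(LINT u|lborel01. z u * k u) \<le> 0"
proof -
  obtain r where r: "mono_on {0<..<1} r" and kr: "AE u in lborel01. k u = r u" and kL: "k \<in> L2"
    using k by (auto simp: monotone_cone_def)
  have [measurable]: "z \<in> borel_measurable lborel01" "r \<in> borel_measurable lborel01" "k \<in> borel_measurable lborel01"
    using mono_on_borel_lborel01[OF r] z kL by (auto simp: L2_def)
  have rL: "r \<in> L2" by (rule L2_bound[OF kL]) (use kr in \<open>auto elim: eventually_mono\<close>)
  have zi: "integrable lborel01 z" by (rule L2_integrable[OF z])
  define c where "c n x = max (- real n) (min (real n) x)" for n and x :: real
  have [measurable]: "c n \<in> borel_measurable borel" for n unfolding c_def by measurable
  have cb: "\<bar>c n x\<bar> \<le> \<bar>x\<bar>" for n x by (auto simp: c_def)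
  have zc: "integrable lborel01 (\<lambda>u. z u * c n (r u))" for n
    by (rule L2_mult_integrable[OF z], rule L2_bound[OF rL]) (use cb in auto)
  have le0: "(LINT u|lborel01. z u * c n (r u)) \<le> 0" for n
  proof -
    have "(LINT u|lborel01. z u * c n (r u)) = (LINT u|lborel01. z u * (c n (r u) + real n) - real n * z u)"
      by (simp add: algebra_simps)
    also have "\<dots> = (LINT u|lborel01. z u * (c n (r u) + real n)) - (LINT u|lborel01. real n * z u)"
      using zc[of n] zi by (intro Bochner_Integration.integral_diff) (auto simp: algebra_simps)
    also have "\<dots> = (LINT u|lborel01. z u * (LINT s|lborel. (if s < r u then indicator {- real n..real n} s else 0)))"
      by (simp add: z0 c_def integral_clamp_eq)
    also have "\<dots> = (LINT s|lborel. indicator {- real n..real n} s * (LINT u|lborel01. (if s < r u then z u else 0)))"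
      by (rule Fubini_kernel[symmetric])
        (auto intro!: sigma_finite_lborel finite_measure.axioms(1) finite_measure_lborel01 zi, measurable)
    also have "\<dots> \<le> 0"
    proof -
      have "0 \<le> (LINT s|lborel. - (indicator {- real n..real n} s * (LINT u|lborel01. (if s < r u then z u else 0))))"
        using integral_superlevel_nonpos[OF zi z0 tail r]
        by (intro Bochner_Integration.integral_nonneg) (simp add: mult_nonneg_nonpos)
      then show ?thesis by simp
    qed
    finally show ?thesis .
  qed
  have "(\<lambda>n. LINT u|lborel01. z u * c n (r u)) \<longlonglongrightarrow> (LINT u|lborel01. z u * r u)"
  proof (rule integral_dominated_convergence[where w="\<lambda>u. \<bar>z u * r u\<bar>"])
    show "integrable lborel01 (\<lambda>u. \<bar>z u * r u\<bar>)" using L2_mult_integrable[OF z rL] by simp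
    have "(\<lambda>n. c n x) \<longlonglongrightarrow> x" for x
    proof -
      obtain m :: nat where m: "\<bar>x\<bar> \<le> real m" using real_arch_simple by blast
      have "c n x = x" if "m \<le> n" for n
      proof -
        have "\<bar>x\<bar> \<le> real n" using m that by linarith
        then show ?thesis by (auto simp: c_def)
      qed
      then have "\<forall>\<^sub>F n in sequentially. c n x = x" by (auto simp: eventually_sequentially)
      then show ?thesis by (rule tendsto_eventually)
    qed
    then show "AE u in lborel01. (\<lambda>n. z u * c n (r u)) \<longlonglongrightarrow> z u * r u"
      by (intro AE_I2 tendsto_intros)
    show "AE u in lborel01. norm (z u * c n (r u)) \<le> \<bar>z u * r u\<bar>" for n
      using cb by (intro AE_I2) (simp add: abs_mult mult_left_mono)
  qed measurable
  then have "(LINT u|lborel01. z u * r u) \<le> 0" by (rule LIMSEQ_le_const2) (use le0 in auto)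
  moreover have "(LINT u|lborel01. z u * k u) = (LINT u|lborel01. z u * r u)"
    by (rule integral_cong_AE) (use kr in \<open>auto elim: eventually_mono\<close>)
  ultimately show ?thesis by simp
qed

section \<open>The normal cone at strictly increasing functions\<close>

text \<open>
  The positive and the negative part of \<open>z\<close> on \<open>(c, d)\<close> are densities of two finite measures that
  agree on all half lines, so the measures and then the densities agree.
\<close>

lemma zero_tail_integral_imp_AE_zero:
  fixes z :: "real \<Rightarrow> real"
  assumes z: "integrable lborel01 z" and cd: "c < d"
    and tail: "\<And>t. t \<in> {c..d} \<Longrightarrow> tail_integral z t = 0"
  shows "AE u in lborel01. u \<in> {c<..<d} \<longrightarrow> z u = 0"
proof -
  have [measurable]: "z \<in> borel_measurable lborel01" using z by auto
  define y where "y u = (if u \<in> {c<..<d} then z u else 0)" for u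
  have ym[measurable]: "y \<in> borel_measurable lborel01" unfolding y_def by measurable
  have yi: "integrable lborel01 y"
    by (rule Bochner_Integration.integrable_bound[OF z ym]) (auto simp: y_def)
  have ytail: "tail_integral y t = 0" for t
  proof -
    have "tail_integral y t = (LINT u|lborel01. (if max c t < u then z u else 0) - (if max d t < u then z u else 0))"
      unfolding tail_integral_def
    proof (rule integral_cong_AE)
      show "AE u in lborel01. (if t < u then y u else 0) = (if max c t < u then z u else 0) - (if max d t < u then z u else 0)"
        using AE_lborel01_neq[of d] by eventually_elim (use cd in \<open>auto simp: y_def\<close>)
    qed measurable
    also have "\<dots> = tail_integral z (max c t) - tail_integral z (max d t)"
      unfolding tail_integral_def by (intro Bochner_Integration.integral_diff tail_integrable z)
    also have "\<dots> = 0"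
      using tail[of "max c t"] tail[of "max d t"] cd by (cases "t \<le> d") (auto simp: max_def)
    finally show ?thesis .
  qed
  define P where "P s u = indicator {0<..<1} u * max 0 (s * y u)" for s u :: real
  have Pm[measurable]: "P s \<in> borel_measurable lborel" for s
  proof -
    have "(\<lambda>u. max 0 (s * y u)) \<in> borel_measurable lborel01" by measurable
    then show ?thesis unfolding P_def[abs_def] by (subst (asm) borel_measurable_restrict_space_iff) auto
  qed
  have mi: "integrable lborel01 (\<lambda>u. max 0 (s * y u))" for s using yi by auto
  have em: "emeasure (density lborel (\<lambda>u. ennreal (P s u))) {t<..} = ennreal (tail_integral (\<lambda>u. max 0 (s * y u)) t)" for s t
  proof -
    have "emeasure (density lborel (\<lambda>u. ennreal (P s u))) {t<..} = (\<integral>\<^sup>+u. ennreal (P s u) * indicator {t<..} u \<partial>lborel)"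
      by (rule emeasure_density) auto
    also have "\<dots> = (\<integral>\<^sup>+u. ennreal (if t < u then max 0 (s * y u) else 0) * indicator {0<..<1} u \<partial>lborel)"
      by (intro nn_integral_cong) (auto simp: P_def indicator_def)
    also have "\<dots> = (\<integral>\<^sup>+u. ennreal (if t < u then max 0 (s * y u) else 0) \<partial>lborel01)"
      by (rule nn_integral_restrict_space[symmetric]) simp
    also have "\<dots> = ennreal (tail_integral (\<lambda>u. max 0 (s * y u)) t)"
      unfolding tail_integral_def by (rule nn_integral_eq_integral[OF tail_integrable[OF mi]]) auto
    finally show ?thesis .
  qed
  have eq: "tail_integral (\<lambda>u. max 0 (1 * y u)) t = tail_integral (\<lambda>u. max 0 (- 1 * y u)) t" for t
  proof -
    have "tail_integral y t = (LINT u|lborel01. (if t < u then max 0 (1 * y u) else 0) - (if t < u then max 0 (- 1 * y u) else 0))"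
      unfolding tail_integral_def by (intro Bochner_Integration.integral_cong) auto
    also have "\<dots> = tail_integral (\<lambda>u. max 0 (1 * y u)) t - tail_integral (\<lambda>u. max 0 (- 1 * y u)) t"
      unfolding tail_integral_def by (intro Bochner_Integration.integral_diff tail_integrable mi)
    finally show ?thesis using ytail by simp
  qed
  have "density lborel (\<lambda>u. ennreal (P 1 u)) = density lborel (\<lambda>u. ennreal (P (- 1) u))"
    by (rule measure_eqI_lessThan) (auto simp: em eq[simplified] less_top[symmetric])
  then have "AE u in lborel. ennreal (P 1 u) = ennreal (P (- 1) u)"
    by (subst (asm) sigma_finite_measure.density_unique_iff[OF sigma_finite_lborel]) auto
  then show ?thesis
    unfolding AE_lborel01
  proof eventually_elim
    case (elim u)
    then have "P 1 u = P (- 1) u" by (auto simp: P_def ennreal_eq_0_iff split: split_indicator_asm)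
    then show ?case by (auto simp: P_def y_def max_def split: if_splits)
  qed
qed

lemma monotone_cone_const: "(\<lambda>_. a) \<in> monotone_cone"
  by (rule monotone_coneI) (auto simp: mono_on_def)

lemma monotone_cone_add:
  assumes "h \<in> monotone_cone" "k \<in> monotone_cone"
  shows "(\<lambda>u. h u + k u) \<in> monotone_cone"
proof -
  obtain r s where "mono_on {0<..<1} r" "AE u in lborel01. h u = r u"
    "mono_on {0<..<1} s" "AE u in lborel01. k u = s u" "h \<in> L2" "k \<in> L2"
    using assms by (auto simp: monotone_cone_def)
  then have "(\<lambda>u. h u + k u) \<in> L2" "mono_on {0<..<1} (\<lambda>u. r u + s u)" "AE u in lborel01. h u + k u = r u + s u"
    by (auto intro: L2_add elim: eventually_elim2 simp: mono_on_def add_mono)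
  then show ?thesis unfolding monotone_cone_def by blast
qed

lemma monotone_cone_scale:
  assumes "h \<in> monotone_cone" "0 \<le> c"
  shows "(\<lambda>u. c * h u) \<in> monotone_cone"
proof -
  obtain r where "mono_on {0<..<1} r" "AE u in lborel01. h u = r u" "h \<in> L2"
    using assms by (auto simp: monotone_cone_def)
  then have "(\<lambda>u. c * h u) \<in> L2" "mono_on {0<..<1} (\<lambda>u. c * r u)" "AE u in lborel01. c * h u = c * r u"
    using assms(2) by (auto intro: L2_cmult elim: eventually_mono simp: mono_on_def mult_left_mono)
  then show ?thesis unfolding monotone_cone_def by blast
qed

text \<open>
  As the monotone cone is closed under addition and positive scaling, its normal cone at \<open>q\<close>
  consists of the polar functions that are orthogonal to \<open>q\<close>. They have mean zero because the
  monotone cone contains the constants of both signs.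
\<close>

lemma normal_cone_monotone_coneD:
  assumes z: "z \<in> normal_cone monotone_cone q" and q: "q \<in> monotone_cone"
  shows "z \<in> L2" "(LINT u|lborel01. z u) = 0" "(LINT u|lborel01. z u * q u) = 0"
    and "k \<in> monotone_cone \<Longrightarrow> (LINT u|lborel01. z u * k u) \<le> 0"
proof -
  show zL: "z \<in> L2" using z by (simp add: normal_cone_def)
  have N: "(LINT u|lborel01. z u * (h u - q u)) \<le> 0" if "h \<in> monotone_cone" for h
    using z that by (simp add: normal_cone_def L2_inner_def)
  show polar: "(LINT u|lborel01. z u * k u) \<le> 0" if "k \<in> monotone_cone" for k
    using N[OF monotone_cone_add[OF that q]] by simp
  show "(LINT u|lborel01. z u) = 0"
    using polar[OF monotone_cone_const[of 1]] polar[OF monotone_cone_const[of "-1"]] by simp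
  show "(LINT u|lborel01. z u * q u) = 0"
    using polar[OF q] N[OF monotone_cone_const[of 0]] by simp
qed

text \<open>
  For \<open>a < b\<close> in the interval, a monotone representative \<open>\<rho>\<close> of \<open>q\<close> is the sum of two
  nondecreasing functions: its truncation \<open>\<kappa>\<close> to \<open>[\<rho> a, \<rho> b]\<close> and \<open>\<rho> - \<kappa>\<close>. Both pairings with \<open>z\<close>
  are nonpositive and their sum \<open>\<langle>z, q\<rangle>\<close> is zero, so \<open>\<langle>z, \<kappa>\<rangle> = 0\<close>. As \<open>\<rho> a < \<rho> b\<close>, normalising \<open>\<kappa>\<close>
  gives a ramp \<open>g a b\<close> that rises from 0 to 1 between \<open>a\<close> and \<open>b\<close> and is orthogonal to \<open>z\<close>.
  Letting \<open>a\<close> increase to \<open>b = t\<close> shows that all tail integrals of \<open>z\<close> from points of the interval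
  vanish.
\<close>

lemma normal_cone_zero_where_strictly_increasing:
  assumes z: "z \<in> normal_cone monotone_cone q" and q: "q \<in> monotone_cone"
    and I: "{c<..<d} \<subseteq> {0<..<1}" and inc: "ae_strictly_increasing_on {c<..<d} q"
  shows "AE u in lborel. u \<in> {c<..<d} \<longrightarrow> z u = 0"
proof (cases "c < d")
  case cd: True
  note zD = normal_cone_monotone_coneD[OF z q]
  have zi: "integrable lborel01 z" by (rule L2_integrable[OF zD(1)])
  obtain \<rho> where \<rho>: "mono_on {0<..<1} \<rho>" and q\<rho>: "AE u in lborel01. q u = \<rho> u" and qL: "q \<in> L2"
    using q by (auto simp: monotone_cone_def)
  obtain r where r: "strict_mono_on {c<..<d} r" and qr: "AE u in lborel. u \<in> {c<..<d} \<longrightarrow> q u = r u"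
    using inc by (auto simp: ae_strictly_increasing_on_def)
  have [measurable]: "z \<in> borel_measurable lborel01" "\<rho> \<in> borel_measurable lborel01" "q \<in> borel_measurable lborel01"
    using zi mono_on_borel_lborel01[OF \<rho>] qL by (auto simp: L2_def)
  have \<rho>L: "\<rho> \<in> L2" by (rule L2_bound[OF qL]) (use q\<rho> in \<open>auto elim: eventually_mono\<close>)
  have eqI: "AE u in lborel. u \<in> {c<..<d} \<longrightarrow> \<rho> u = r u"
    using q\<rho>[unfolded AE_lborel01] qr by eventually_elim (use I in auto)
  have strict: "\<rho> x < \<rho> y" if xy: "x \<in> {c<..<d}" "y \<in> {c<..<d}" "x < y" for x y
  proof -
    define m where "m = (x + y) / 2"
    have m: "x < m" "m < y" using xy by (auto simp: m_def)
    have "AE u in lborel. u \<in> {x<..<m} \<longrightarrow> \<rho> u = r u" "AE u in lborel. u \<in> {m<..<y} \<longrightarrow> \<rho> u = r u"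
      using eqI xy m by (auto elim!: eventually_mono)
    from AE_interval_witness[OF this(1) m(1)] AE_interval_witness[OF this(2) m(2)]
    obtain x' y' where x': "x' \<in> {x<..<m}" "\<rho> x' = r x'" and y': "y' \<in> {m<..<y}" "\<rho> y' = r y'" by blast
    have in01: "u \<in> {0<..<1}" if "u \<in> {x..y}" for u using I xy that by (auto simp: subset_iff)
    have "\<rho> x \<le> \<rho> x'" using x' m in01[of x] in01[of x'] by (intro mono_onD[OF \<rho>]) auto
    also have "\<dots> < \<rho> y'"
      unfolding x'(2) y'(2) using x' y' xy by (intro strict_mono_onD[OF r]) auto
    also have "\<dots> \<le> \<rho> y" using y' m in01[of y] in01[of y'] by (intro mono_onD[OF \<rho>]) auto
    finally show ?thesis .
  qed
  define g where "g a b u = (max (\<rho> a) (min (\<rho> b) (\<rho> u)) - \<rho> a) / (\<rho> b - \<rho> a)" for a b u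
  have [measurable]: "g a b \<in> borel_measurable lborel01" for a b unfolding g_def by measurable
  have gz: "(LINT u|lborel01. z u * g a b u) = 0" if ab: "a \<in> {c<..<d}" "b \<in> {c<..<d}" "a < b" for a b
  proof -
    define \<kappa> where "\<kappa> u = max (\<rho> a) (min (\<rho> b) (\<rho> u))" for u
    have \<kappa>L: "\<kappa> \<in> L2" unfolding \<kappa>_def
    proof (rule L2_bound[OF L2_add[OF L2_abs[OF \<rho>L] L2_const[of "\<bar>\<rho> a\<bar> + \<bar>\<rho> b\<bar>"]]])
      show "AE u in lborel01. \<bar>max (\<rho> a) (min (\<rho> b) (\<rho> u))\<bar> \<le> \<bar>\<bar>\<rho> u\<bar> + (\<bar>\<rho> a\<bar> + \<bar>\<rho> b\<bar>)\<bar>"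
        by (intro AE_I2) (auto simp: max_def min_def)
    qed measurable
    have \<kappa>K: "\<kappa> \<in> monotone_cone"
    proof (rule monotone_coneI[OF \<kappa>L], rule mono_onI)
      fix x y :: real assume "x \<in> {0<..<1}" "y \<in> {0<..<1}" "x \<le> y"
      then have "\<rho> x \<le> \<rho> y" by (intro mono_onD[OF \<rho>])
      then show "\<kappa> x \<le> \<kappa> y" by (auto simp: \<kappa>_def max_def min_def)
    qed
    have "(\<lambda>u. \<rho> u - \<kappa> u) \<in> monotone_cone"
    proof (rule monotone_coneI[OF L2_diff[OF \<rho>L \<kappa>L]], rule mono_onI)
      fix x y :: real assume "x \<in> {0<..<1}" "y \<in> {0<..<1}" "x \<le> y"
      then have "\<rho> x \<le> \<rho> y" by (intro mono_onD[OF \<rho>])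
      then show "\<rho> x - \<kappa> x \<le> \<rho> y - \<kappa> y" using strict[OF ab] by (auto simp: \<kappa>_def max_def min_def)
    qed
    then have "(LINT u|lborel01. z u * (\<rho> u - \<kappa> u)) \<le> 0" by (rule zD(4))
    moreover have "(LINT u|lborel01. z u * (\<rho> u - \<kappa> u)) = (LINT u|lborel01. z u * \<rho> u) - (LINT u|lborel01. z u * \<kappa> u)"
      unfolding right_diff_distrib
      by (intro Bochner_Integration.integral_diff L2_mult_integrable zD(1) \<rho>L \<kappa>L)
    moreover have "(LINT u|lborel01. z u * \<rho> u) = (LINT u|lborel01. z u * q u)"
      by (rule integral_cong_AE) (use q\<rho> in \<open>auto elim: eventually_mono\<close>)
    ultimately have \<kappa>0: "(LINT u|lborel01. z u * \<kappa> u) = 0" using zD(3) zD(4)[OF \<kappa>K] by simp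
    have "(LINT u|lborel01. z u * g a b u) = (LINT u|lborel01. (z u * \<kappa> u - \<rho> a * z u) / (\<rho> b - \<rho> a))"
      by (intro Bochner_Integration.integral_cong) (auto simp: g_def \<kappa>_def algebra_simps diff_divide_distrib)
    also have "\<dots> = ((LINT u|lborel01. z u * \<kappa> u) - (LINT u|lborel01. \<rho> a * z u)) / (\<rho> b - \<rho> a)"
      using L2_mult_integrable[OF zD(1) \<kappa>L] zi by simp
    finally show ?thesis using \<kappa>0 zD(2) by simp
  qed
  have tail0: "tail_integral z t = 0" if t: "t \<in> {c<..<d}" for t
  proof -
    define a where "a n = t - (t - c) / 2 * inverse (real (Suc n))" for n
    have a: "a n \<in> {c<..<d}" "a n < t" for n
    proof -
      have "0 < (t - c) / 2 * inverse (real (Suc n))" using t by simp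
      moreover have "(t - c) / 2 * inverse (real (Suc n)) \<le> (t - c) / 2 * 1"
        using t by (intro mult_left_mono) (auto simp: field_simps)
      ultimately show "a n \<in> {c<..<d}" "a n < t" using t by (auto simp: a_def)
    qed
    have "a \<longlonglongrightarrow> t - (t - c) / 2 * 0"
      unfolding a_def by (intro tendsto_intros LIMSEQ_inverse_real_of_nat)
    then have alim: "a \<longlonglongrightarrow> t" by simp
    have "(\<lambda>n. LINT u|lborel01. z u * g (a n) t u) \<longlonglongrightarrow> (LINT u|lborel01. (if t < u then z u else 0))"
    proof (rule integral_dominated_convergence[where w="\<lambda>u. \<bar>z u\<bar>"])
      show "AE u in lborel01. (\<lambda>n. z u * g (a n) t u) \<longlonglongrightarrow> (if t < u then z u else 0)"
        using AE_lborel01_neq[of t] AE_space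
      proof eventually_elim
        case (elim u)
        have "\<forall>\<^sub>F n in sequentially. z u * g (a n) t u = (if t < u then z u else 0)"
        proof (cases "t < u")
          case True
          have "t \<in> {0<..<1}" using t I by auto
          then have "\<rho> t \<le> \<rho> u" using True elim by (intro mono_onD[OF \<rho>]) auto
          then have "g (a n) t u = 1" for n
            using strict[OF a(1) t a(2), of n] by (simp add: g_def)
          then show ?thesis using True by simp
        next
          case False
          then have "u < t" using elim by simp
          from order_tendstoD(1)[OF alim this] show ?thesis
          proof eventually_elim
            case (elim n)
            have "a n \<in> {0<..<1}" using a(1) I by blast
            then have "\<rho> u \<le> \<rho> (a n)" using elim \<open>u \<in> space lborel01\<close> by (intro mono_onD[OF \<rho>]) auto
            then have "g (a n) t u = 0" using strict[OF a(1) t a(2), of n] by (simp add: g_def)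
            then show ?case using False by simp
          qed
        qed
        then show ?case by (rule tendsto_eventually)
      qed
      have "\<bar>g (a n) t u\<bar> \<le> 1" for n u
        using strict[OF a(1) t a(2), of n] by (auto simp: g_def divide_le_eq)
      then show "AE u in lborel01. norm (z u * g (a n) t u) \<le> \<bar>z u\<bar>" for n
        by (intro AE_I2) (simp add: abs_mult mult_left_le)
    qed (use zi in auto)
    then have "(\<lambda>n. 0) \<longlonglongrightarrow> tail_integral z t"
      using gz[OF a(1) t a(2)] by (simp add: tail_integral_def)
    then show ?thesis using LIMSEQ_unique tendsto_const by blast
  qed
  have "tail_integral z t = 0" if "t \<in> {c..d}" for t
  proof -
    have "closed {t. tail_integral z t = 0}"
      by (intro closed_Collect_eq tail_integral_continuous zi continuous_on_const)
    then have "closure {c<..<d} \<subseteq> {t. tail_integral z t = 0}"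
      using tail0 by (intro closure_minimal) auto
    then show ?thesis using that cd by (auto simp: closure_greaterThanLessThan)
  qed
  then have "AE u in lborel01. u \<in> {c<..<d} \<longrightarrow> z u = 0"
    by (rule zero_tail_integral_imp_AE_zero[OF zi cd])
  then show ?thesis unfolding AE_lborel01 by eventually_elim (use I in auto)
qed simp

section \<open>Selection from an order interval\<close>

text \<open>
  For \<open>q\<close> of mean zero, this is the orthogonal projection of \<open>w\<close> onto the complement of the span
  of the constant 1 and \<open>q\<close>.
\<close>

definition residual :: "(real \<Rightarrow> real) \<Rightarrow> (real \<Rightarrow> real) \<Rightarrow> real \<Rightarrow> real" where
  "residual q w u = w u - (LINT x|lborel01. w x) - (LINT x|lborel01. w x * q x) / (LINT x|lborel01. (q x)\<^sup>2) * q u"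

lemma residual_L2:
  assumes "q \<in> L2" "w \<in> L2"
  shows "residual q w \<in> L2"
  unfolding residual_def[abs_def] by (intro L2_diff L2_cmult L2_const assms)

lemma residual_inner:
  assumes q: "q \<in> L2" and w: "w \<in> L2" and k: "k \<in> L2"
  shows "(LINT u|lborel01. residual q w u * k u) = (LINT u|lborel01. w u * k u)
    - (LINT u|lborel01. w u) * (LINT u|lborel01. k u)
    - (LINT u|lborel01. w u * q u) / (LINT u|lborel01. (q u)\<^sup>2) * (LINT u|lborel01. q u * k u)"
proof -
  let ?a = "LINT x|lborel01. w x" and ?b = "(LINT x|lborel01. w x * q x) / (LINT x|lborel01. (q x)\<^sup>2)"
  have "(LINT u|lborel01. residual q w u * k u) = (LINT u|lborel01. w u * k u - ?a * k u - ?b * (q u * k u))"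
    by (simp add: residual_def algebra_simps)
  also have "\<dots> = (LINT u|lborel01. w u * k u) - (LINT u|lborel01. ?a * k u) - (LINT u|lborel01. ?b * (q u * k u))"
    using L2_mult_integrable[OF w k] L2_mult_integrable[OF q k] L2_integrable[OF k]
    by (subst Bochner_Integration.integral_diff; simp)+
  finally show ?thesis by simp
qed

lemma residual_self_adjoint:
  assumes q: "q \<in> L2" and w: "w \<in> L2" and k: "k \<in> L2"
  shows "(LINT u|lborel01. residual q w u * k u) = (LINT u|lborel01. w u * residual q k u)"
  using residual_inner[OF q w k] residual_inner[OF q k w] by (simp add: mult.commute)

lemma residual_orthogonal:
  assumes q: "q \<in> L2" and q0: "(LINT u|lborel01. q u) = 0" and q1: "(LINT u|lborel01. (q u)\<^sup>2) \<noteq> 0" and w: "w \<in> L2"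
  shows "(LINT u|lborel01. residual q w u) = 0" "(LINT u|lborel01. residual q w u * q u) = 0"
  using residual_inner[OF q w L2_const[of 1]] residual_inner[OF q w q] q0 q1
  by (simp_all add: power2_eq_square)

lemma residual_combination:
  assumes q: "q \<in> L2" and v: "v \<in> L2" and w: "w \<in> L2"
  shows "residual q (\<lambda>u. a * v u + b * w u) = (\<lambda>u. a * residual q v u + b * residual q w u)"
proof -
  have 1: "(LINT x|lborel01. a * v x + b * w x) = a * (LINT x|lborel01. v x) + b * (LINT x|lborel01. w x)"
    using L2_integrable[OF v] L2_integrable[OF w] by simp
  have "(LINT x|lborel01. (a * v x + b * w x) * q x) = (LINT x|lborel01. a * (v x * q x) + b * (w x * q x))"
    by (simp add: algebra_simps)
  also have "\<dots> = a * (LINT x|lborel01. v x * q x) + b * (LINT x|lborel01. w x * q x)"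
    using L2_mult_integrable[OF v q] L2_mult_integrable[OF w q] by simp
  finally show ?thesis unfolding residual_def 1 by (simp add: fun_eq_iff algebra_simps add_divide_distrib)
qed

lemma tail_integral_combination:
  assumes v: "integrable lborel01 v" and w: "integrable lborel01 w"
  shows "tail_integral (\<lambda>u. a * v u + b * w u) t = a * tail_integral v t + b * tail_integral w t"
proof -
  have "tail_integral (\<lambda>u. a * v u + b * w u) t =
      (LINT u|lborel01. a * (if t < u then v u else 0) + b * (if t < u then w u else 0))"
    unfolding tail_integral_def by (intro Bochner_Integration.integral_cong) auto
  then show ?thesis
    using tail_integrable[OF v, of t] tail_integrable[OF w, of t] by (simp add: tail_integral_def)
qed

text \<open>
  This is the minimax step. The hypothesis says that for each single residual \<open>h\<close> of a monotone
  function some \<open>w \<in> [f, g]\<close> satisfies \<open>\<langle>w, h\<rangle> \<le> 0\<close>, namely \<open>f\<close> where \<open>h > 0\<close> and \<open>g\<close> elsewhere. The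
  conclusion provides one \<open>w\<close> that serves all step functions simultaneously.

  Let \<open>Z w t\<close> be the tail integral of the residual of \<open>w\<close> and let \<open>w\<close> minimise the integral \<open>\<Phi>\<close> of
  the squared positive part of \<open>Z w\<close>. With \<open>c\<close> this positive part, stationarity gives
  \<open>\<integral> c * Z v \<ge> \<integral> c * Z w = \<Phi> w\<close> for all competitors \<open>v\<close>. By Fubini's theorem and self-adjointness
  the left-hand side is the pairing of \<open>v\<close> with the residual of the primitive \<open>k\<close> of \<open>c\<close>. As
  \<open>c \<ge> 0\<close>, \<open>k\<close> is nondecreasing, and the hypothesis supplies a competitor \<open>v\<close> with a nonpositive
  pairing. Hence \<open>\<Phi> w \<le> 0\<close>, and \<open>Z w \<le> 0\<close> follows by continuity.
\<close>

lemma order_interval_selection: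
  assumes f: "f \<in> L2" and g: "g \<in> L2" and fg: "\<And>u. f u \<le> g u"
    and q: "q \<in> L2" and q1: "(LINT u|lborel01. (q u)\<^sup>2) \<noteq> 0"
    and hyp: "\<And>k. k \<in> monotone_cone \<Longrightarrow>
      (LINT u|lborel01. (if residual q k u > 0 then f u else g u) * residual q k u) \<le> 0"
  shows "\<exists>w\<in>borel_measurable lborel01. (\<forall>u. f u \<le> w u \<and> w u \<le> g u) \<and>
    (\<forall>t\<in>{0<..<1}. tail_integral (residual q w) t \<le> 0)"
proof -
  define W where "W = {w \<in> borel_measurable lborel01. \<forall>u. f u \<le> w u \<and> w u \<le> g u}"
  define G where "G u = \<bar>f u\<bar> + \<bar>g u\<bar>" for u
  have G: "G \<in> L2" unfolding G_def by (intro L2_add L2_abs f g)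
  have WG: "\<bar>w u\<bar> \<le> G u" if "w \<in> W" for w u
  proof -
    have "f u \<le> w u" "w u \<le> g u" using that by (auto simp: W_def)
    then show ?thesis unfolding G_def by linarith
  qed
  have Wm: "w \<in> borel_measurable lborel01" if "w \<in> W" for w using that by (simp add: W_def)
  have G0: "0 \<le> G u" for u by (simp add: G_def)
  have WL: "w \<in> L2" if "w \<in> W" for w
    by (rule L2_bound[OF G Wm[OF that]]) (use WG[OF that] G0 in auto)
  define Z where "Z w = tail_integral (residual q w)" for w
  have rL: "residual q w \<in> L2" if "w \<in> W" for w by (rule residual_L2[OF q WL[OF that]])
  have ri: "integrable lborel01 (residual q w)" if "w \<in> W" for w by (rule L2_integrable[OF rL[OF that]])
  define s where "s = (LINT u|lborel01. (q u)\<^sup>2)"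
  have s: "s > 0"
  proof -
    have "0 \<le> s" unfolding s_def by simp
    then show ?thesis using q1 unfolding s_def by linarith
  qed
  \<comment> \<open>A bound for the residuals of all members of the order interval at once.\<close>
  define H where "H u = G u + (LINT x|lborel01. G x) + (LINT x|lborel01. G x * \<bar>q x\<bar>) / s * \<bar>q u\<bar>" for u
  have HL: "H \<in> L2" unfolding H_def by (intro L2_add L2_cmult L2_abs L2_const G q)
  have Hi: "integrable lborel01 H" by (rule L2_integrable[OF HL])
  have rH: "\<bar>residual q w u\<bar> \<le> H u" if w: "w \<in> W" for w u
  proof -
    have "\<bar>LINT x|lborel01. w x\<bar> \<le> (LINT x|lborel01. \<bar>w x\<bar>)" by (rule integral_abs_bound)
    also have "\<dots> \<le> (LINT x|lborel01. G x)"
      by (intro integral_mono integrable_abs L2_integrable WL w G WG)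
    finally have 1: "\<bar>LINT x|lborel01. w x\<bar> \<le> (LINT x|lborel01. G x)" .
    have "\<bar>LINT x|lborel01. w x * q x\<bar> \<le> (LINT x|lborel01. \<bar>w x * q x\<bar>)" by (rule integral_abs_bound)
    also have "\<dots> \<le> (LINT x|lborel01. G x * \<bar>q x\<bar>)"
      by (intro integral_mono integrable_abs L2_mult_integrable WL w G L2_abs q)
        (use WG[OF w] in \<open>auto simp: abs_mult intro!: mult_right_mono\<close>)
    finally have 2: "\<bar>LINT x|lborel01. w x * q x\<bar> / s * \<bar>q u\<bar> \<le> (LINT x|lborel01. G x * \<bar>q x\<bar>) / s * \<bar>q u\<bar>"
      using s by (intro mult_right_mono divide_right_mono) auto
    have "\<bar>residual q w u\<bar> \<le> \<bar>w u\<bar> + \<bar>LINT x|lborel01. w x\<bar> + \<bar>(LINT x|lborel01. w x * q x) / s * q u\<bar>"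
      unfolding residual_def s_def[symmetric] by linarith
    also have "\<bar>(LINT x|lborel01. w x * q x) / s * q u\<bar> = \<bar>LINT x|lborel01. w x * q x\<bar> / s * \<bar>q u\<bar>"
      using s by (simp add: abs_mult)
    finally show ?thesis using 1 2 WG[OF w, of u] unfolding H_def by linarith
  qed
  define B where "B = (LINT u|lborel01. H u)"
  have ZB: "\<bar>Z w t\<bar> \<le> B" if "w \<in> W" for w t
    unfolding Z_def B_def by (rule tail_integral_bound[OF ri[OF that] Hi]) (use rH[OF that] in auto)
  have Zm: "Z w \<in> borel_measurable lborel01" if "w \<in> W" for w
    unfolding Z_def by (rule tail_integral_measurable[OF ri[OF that]])
  have B0: "0 \<le> B" unfolding B_def using G0 s by (intro Bochner_Integration.integral_nonneg) (simp add: H_def)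
  define \<Phi> where "\<Phi> w = (LINT t|lborel01. (max 0 (Z w t))\<^sup>2)" for w
  have sq_bd: "(max 0 x)\<^sup>2 \<le> B\<^sup>2" if "\<bar>x\<bar> \<le> B" for x
    using that B0 by (intro power_mono) auto
  have \<Phi>i: "integrable lborel01 (\<lambda>t. (max 0 (Z w t))\<^sup>2)" if "w \<in> W" for w
  proof (rule lborel01.integrable_const_bound[where B="B\<^sup>2"])
    have [measurable]: "Z w \<in> borel_measurable lborel01" by (rule Zm[OF that])
    show "(\<lambda>t. (max 0 (Z w t))\<^sup>2) \<in> borel_measurable lborel01" by measurable
    show "AE t in lborel01. norm ((max 0 (Z w t))\<^sup>2) \<le> B\<^sup>2" using sq_bd[OF ZB[OF that]] by auto
  qed
  have Zlin: "Z (\<lambda>u. a * v u + b * w u) t = a * Z v t + b * Z w t" if "v \<in> W" "w \<in> W" for a b v w t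
    unfolding Z_def residual_combination[OF q WL[OF that(1)] WL[OF that(2)]]
    by (rule tail_integral_combination[OF ri[OF that(1)] ri[OF that(2)]])
  have "\<exists>w\<in>W. \<forall>v\<in>W. \<Phi> w \<le> \<Phi> v"
    unfolding W_def
  proof (rule order_interval_minimizer, unfold W_def[symmetric])
    show "0 \<le> \<Phi> w" for w by (simp add: \<Phi>_def)
    fix v w assume vw: "v \<in> W" "w \<in> W"
    have mid: "Z (\<lambda>u. (v u + w u) / 2) t = (Z v t + Z w t) / 2" for t
      using Zlin[OF vw, of "1/2" "1/2" t] by (simp add: add_divide_distrib)
    have "(max 0 ((x + y) / 2))\<^sup>2 \<le> ((max 0 x)\<^sup>2 + (max 0 y)\<^sup>2) / 2" for x y :: real
    proof -
      have "(max 0 ((x + y) / 2))\<^sup>2 \<le> ((max 0 x + max 0 y) / 2)\<^sup>2"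
        by (intro power_mono max.boundedI divide_right_mono add_mono) auto
      also have "\<dots> \<le> ((max 0 x)\<^sup>2 + (max 0 y)\<^sup>2) / 2"
        using zero_le_power2[of "max 0 x - max 0 y"] by (simp add: power2_eq_square algebra_simps)
      finally show ?thesis .
    qed
    moreover have "(\<lambda>u. (v u + w u) / 2) \<in> W"
    proof -
      have "f u \<le> (v u + w u) / 2 \<and> (v u + w u) / 2 \<le> g u" for u
      proof -
        have "f u \<le> v u" "f u \<le> w u" "v u \<le> g u" "w u \<le> g u" using vw by (auto simp: W_def)
        then show ?thesis by (simp add: le_divide_eq divide_le_eq)
      qed
      then show ?thesis using Wm[OF vw(1)] Wm[OF vw(2)] by (auto simp: W_def)
    qed
    ultimately have "\<Phi> (\<lambda>u. (v u + w u) / 2) \<le> (LINT t|lborel01. ((max 0 (Z v t))\<^sup>2 + (max 0 (Z w t))\<^sup>2) / 2)"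
      unfolding \<Phi>_def mid
      by (intro integral_mono Bochner_Integration.integrable_divide Bochner_Integration.integrable_add \<Phi>i vw)
        (use \<Phi>i[of "\<lambda>u. (v u + w u) / 2"] in \<open>auto simp: mid\<close>)
    also have "\<dots> = (\<Phi> v + \<Phi> w) / 2" unfolding \<Phi>_def using \<Phi>i[OF vw(1)] \<Phi>i[OF vw(2)] by simp
    finally show "\<Phi> (\<lambda>u. (v u + w u) / 2) \<le> max (\<Phi> v) (\<Phi> w)" by (auto simp: max_def)
  next
    fix w :: "nat \<Rightarrow> real \<Rightarrow> real" and w'
    assume wW: "\<And>n. w n \<in> W" and w'W: "w' \<in> W" and lim: "AE u in lborel01. (\<lambda>n. w n u) \<longlonglongrightarrow> w' u"
    have [measurable]: "w n \<in> borel_measurable lborel01" "w' \<in> borel_measurable lborel01" "q \<in> borel_measurable lborel01" for n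
      using Wm wW w'W q by (auto simp: L2_def)
    have l1: "(\<lambda>n. LINT x|lborel01. w n x) \<longlonglongrightarrow> (LINT x|lborel01. w' x)"
      by (rule integral_dominated_convergence[where w=G]) (use lim L2_integrable[OF G] WG[OF wW] in auto)
    have l2: "(\<lambda>n. LINT x|lborel01. w n x * q x) \<longlonglongrightarrow> (LINT x|lborel01. w' x * q x)"
    proof (rule integral_dominated_convergence[where w="\<lambda>x. G x * \<bar>q x\<bar>"])
      show "integrable lborel01 (\<lambda>x. G x * \<bar>q x\<bar>)" by (intro L2_mult_integrable G L2_abs q)
      show "AE x in lborel01. (\<lambda>n. w n x * q x) \<longlonglongrightarrow> w' x * q x"
        using lim by eventually_elim (intro tendsto_intros)
      show "AE x in lborel01. norm (w n x * q x) \<le> G x * \<bar>q x\<bar>" for n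
        using WG[OF wW] by (auto simp: abs_mult intro!: mult_right_mono)
    qed measurable
    have rlim: "AE u in lborel01. (\<lambda>n. residual q (w n) u) \<longlonglongrightarrow> residual q w' u"
      using lim
    proof eventually_elim
      case (elim u)
      show ?case unfolding residual_def by (intro tendsto_intros elim l1 l2) (use q1 in auto)
    qed
    have Zlim: "(\<lambda>n. Z (w n) t) \<longlonglongrightarrow> Z w' t" for t
      unfolding Z_def tail_integral_def
    proof (rule integral_dominated_convergence[where w=H])
      show "AE u in lborel01. (\<lambda>n. if t < u then residual q (w n) u else 0) \<longlonglongrightarrow> (if t < u then residual q w' u else 0)"
        using rlim by eventually_elim auto
      show "AE u in lborel01. norm (if t < u then residual q (w n) u else 0) \<le> H u" for n
        using rH[OF wW[of n]] by (auto intro: order_trans[OF abs_ge_zero])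
    qed (use tail_integrable[OF ri] wW w'W Hi in auto)
    show "(\<lambda>n. \<Phi> (w n)) \<longlonglongrightarrow> \<Phi> w'"
      unfolding \<Phi>_def
    proof (rule integral_dominated_convergence[where w="\<lambda>_. B\<^sup>2"])
      show "AE t in lborel01. (\<lambda>n. (max 0 (Z (w n) t))\<^sup>2) \<longlonglongrightarrow> (max 0 (Z w' t))\<^sup>2"
        by (intro AE_I2 tendsto_intros Zlim)
      show "AE t in lborel01. norm ((max 0 (Z (w n) t))\<^sup>2) \<le> B\<^sup>2" for n
        using sq_bd[OF ZB[OF wW]] by auto
    qed (use \<Phi>i wW w'W in auto)
  qed (use f g fg finite_measure_lborel01 in \<open>auto simp: L2_def\<close>)
  then obtain w where w: "w \<in> W" and wmin: "\<And>v. v \<in> W \<Longrightarrow> \<Phi> w \<le> \<Phi> v" by blast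
  define c where "c t = max 0 (Z w t)" for t
  define k where "k u = (LINT t|lborel01. (if t < u then c t else 0))" for u
  have Zw[measurable]: "Z w \<in> borel_measurable lborel01" by (rule Zm[OF w])
  have c[measurable]: "c \<in> borel_measurable lborel01" and c0: "0 \<le> c t" and cB: "\<bar>c t\<bar> \<le> B" for t
    using ZB[OF w, of t] B0 unfolding c_def by (measurable, auto)
  have ci: "integrable lborel01 c" by (rule lborel01.integrable_const_bound[where B=B]) (use cB in auto)
  have cui: "integrable lborel01 (\<lambda>t. if t < u then c t else 0)" for u
  proof (rule Bochner_Integration.integrable_bound[OF ci])
    show "(\<lambda>t. if t < u then c t else 0) \<in> borel_measurable lborel01" by measurable
  qed auto
  have kmono: "k u \<le> k u'" if "u \<le> u'" for u u'
    unfolding k_def using that c0 by (intro integral_mono cui) auto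
  have kb: "\<bar>k u\<bar> \<le> (LINT t|lborel01. c t)" for u
  proof -
    have "0 \<le> k u" unfolding k_def using c0 by (intro Bochner_Integration.integral_nonneg) auto
    moreover have "k u \<le> (LINT t|lborel01. c t)"
      unfolding k_def using c0 by (intro integral_mono cui ci) auto
    ultimately show ?thesis by simp
  qed
  have kmono_on: "mono_on {0<..<1} k" using kmono by (intro mono_onI)
  have kL: "k \<in> L2"
  proof (rule L2_bound[OF L2_const])
    show "k \<in> borel_measurable lborel01" by (rule mono_on_borel_lborel01[OF kmono_on])
    show "AE u in lborel01. \<bar>k u\<bar> \<le> \<bar>LINT t|lborel01. c t\<bar>" using kb by (auto intro: order_trans[OF _ abs_ge_self])
  qed
  have kK: "k \<in> monotone_cone" by (rule monotone_coneI[OF kL kmono_on])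
  define v where "v u = (if residual q k u > 0 then f u else g u)" for u
  have [measurable]: "residual q k \<in> borel_measurable lborel01" "f \<in> borel_measurable lborel01" "g \<in> borel_measurable lborel01"
    using residual_L2[OF q kL] f g by (auto simp: L2_def)
  have v: "v \<in> W" unfolding W_def v_def using fg by auto
  have [measurable]: "Z v \<in> borel_measurable lborel01" by (rule Zm[OF v])
  have cZ: "integrable lborel01 (\<lambda>t. c t * Z x t)" if "x \<in> W" for x
  proof (rule lborel01.integrable_const_bound[where B="B * B"])
    have [measurable]: "Z x \<in> borel_measurable lborel01" by (rule Zm[OF that])
    show "(\<lambda>t. c t * Z x t) \<in> borel_measurable lborel01" by measurable
    show "AE t in lborel01. norm (c t * Z x t) \<le> B * B"
      using cB ZB[OF that] B0 by (auto simp: abs_mult intro!: mult_mono)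
  qed
  have cZv: "(LINT t|lborel01. c t * Z v t) \<le> 0"
  proof -
    have "(LINT t|lborel01. c t * Z v t) = (LINT u|lborel01. residual q v u * k u)"
      unfolding Z_def tail_integral_def k_def
      by (rule Fubini_kernel) (auto intro!: finite_measure.axioms(1) finite_measure_lborel01 ci ri v, measurable)
    also have "\<dots> = (LINT u|lborel01. v u * residual q k u)"
      by (rule residual_self_adjoint[OF q WL[OF v] kL])
    also have "\<dots> \<le> 0" unfolding v_def by (rule hyp[OF kK])
    finally show ?thesis .
  qed
  define Y where "Y t = Z v t - Z w t" for t
  have [measurable]: "Y \<in> borel_measurable lborel01" unfolding Y_def by measurable
  have cYi: "integrable lborel01 (\<lambda>t. c t * Y t)"
    unfolding Y_def right_diff_distrib by (intro Bochner_Integration.integrable_diff cZ v w)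
  have YB: "\<bar>Y t\<bar> \<le> 2 * B" for t using ZB[OF v, of t] ZB[OF w, of t] unfolding Y_def by linarith
  have Y2i: "integrable lborel01 (\<lambda>t. (Y t)\<^sup>2)"
  proof (rule lborel01.integrable_const_bound[where B="(2 * B)\<^sup>2"])
    show "AE t in lborel01. norm ((Y t)\<^sup>2) \<le> (2 * B)\<^sup>2"
      using power_mono[OF YB abs_ge_zero, where n=2] by (intro AE_I2) simp
  qed measurable
  define a b where "a = (LINT t|lborel01. c t * Y t)" and "b = (LINT t|lborel01. (Y t)\<^sup>2)"
  have b0: "0 \<le> b" unfolding b_def by simp
  have dir: "0 \<le> 2 * a + l * b" if l: "0 < l" "l \<le> 1" for l
  proof -
    let ?x = "\<lambda>u. (1 - l) * w u + l * v u"
    have "?x \<in> W"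
    proof -
      have "f u \<le> ?x u \<and> ?x u \<le> g u" for u
      proof -
        have "(1 - l) * f u + l * f u \<le> ?x u" "?x u \<le> (1 - l) * g u + l * g u"
          using l v w by (auto simp: W_def intro!: add_mono mult_left_mono)
        then show ?thesis by (simp add: algebra_simps)
      qed
      then show ?thesis using Wm[OF v] Wm[OF w] by (auto simp: W_def)
    qed
    have Zx: "Z ?x t = Z w t + l * Y t" for t
      using Zlin[OF w v, of "1 - l" l t] by (simp add: Y_def algebra_simps)
    \<comment> \<open>The square of the positive part lies below its second-order expansion.\<close>
    have pw: "(max 0 (x + y))\<^sup>2 \<le> (max 0 x)\<^sup>2 + 2 * max 0 x * y + y\<^sup>2" for x y :: real
    proof (cases "x \<ge> 0")
      case True
      have "(max 0 (x + y))\<^sup>2 \<le> (x + y)\<^sup>2" by (auto simp: max_def)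
      then show ?thesis using True by (simp add: power2_sum algebra_simps)
    next
      case False
      then have "(max 0 (x + y))\<^sup>2 \<le> \<bar>y\<bar>\<^sup>2" by (intro power_mono) auto
      then show ?thesis using False by simp
    qed
    have "\<Phi> w \<le> \<Phi> ?x" by (rule wmin[OF \<open>?x \<in> W\<close>])
    also have "\<dots> \<le> (LINT t|lborel01. (max 0 (Z w t))\<^sup>2 + 2 * l * (c t * Y t) + l\<^sup>2 * (Y t)\<^sup>2)"
      unfolding \<Phi>_def
    proof (rule integral_mono[OF \<Phi>i[OF \<open>?x \<in> W\<close>]])
      show "integrable lborel01 (\<lambda>t. (max 0 (Z w t))\<^sup>2 + 2 * l * (c t * Y t) + l\<^sup>2 * (Y t)\<^sup>2)"
        using \<Phi>i[OF w] cYi Y2i by simp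
      show "(max 0 (Z ?x t))\<^sup>2 \<le> (max 0 (Z w t))\<^sup>2 + 2 * l * (c t * Y t) + l\<^sup>2 * (Y t)\<^sup>2" for t
        unfolding Zx using pw[of "Z w t" "l * Y t"] by (simp add: c_def power_mult_distrib algebra_simps)
    qed
    also have "\<dots> = \<Phi> w + 2 * l * a + l\<^sup>2 * b"
      unfolding \<Phi>_def a_def b_def using \<Phi>i[OF w] cYi Y2i by simp
    finally have "0 \<le> l * (2 * a + l * b)" by (simp add: power2_eq_square algebra_simps)
    then show ?thesis using l by (simp add: zero_le_mult_iff)
  qed
  have "0 \<le> a"
  proof (rule ccontr)
    assume "\<not> 0 \<le> a"
    \<comment> \<open>A step small enough for the linear term \<open>2 * a < 0\<close> to dominate.\<close>
    define l where "l = min 1 (- a / (b + 1))"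
    have l: "0 < l" "l \<le> 1" using \<open>\<not> 0 \<le> a\<close> b0 by (auto simp: l_def divide_neg_pos)
    have "l * b \<le> - a / (b + 1) * b" using b0 by (intro mult_right_mono) (auto simp: l_def)
    also have "\<dots> \<le> - a" using \<open>\<not> 0 \<le> a\<close> b0 by (simp add: field_simps)
    finally show False using dir[OF l] \<open>\<not> 0 \<le> a\<close> by linarith
  qed
  moreover have "a = (LINT t|lborel01. c t * Z v t) - \<Phi> w"
  proof -
    have "a = (LINT t|lborel01. c t * Z v t - c t * Z w t)" unfolding a_def Y_def by (simp add: right_diff_distrib)
    also have "\<dots> = (LINT t|lborel01. c t * Z v t) - (LINT t|lborel01. c t * Z w t)"
      by (intro Bochner_Integration.integral_diff cZ v w)
    also have "(LINT t|lborel01. c t * Z w t) = \<Phi> w"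
      unfolding \<Phi>_def c_def by (intro Bochner_Integration.integral_cong) (auto simp: max_def power2_eq_square)
    finally show ?thesis .
  qed
  ultimately have "\<Phi> w \<le> 0" using cZv by simp
  then have "(LINT t|lborel01. (max 0 (Z w t))\<^sup>2) = 0"
    unfolding \<Phi>_def by (intro antisym) auto
  then have "AE t in lborel01. (max 0 (Z w t))\<^sup>2 = 0"
    using integral_nonneg_eq_0_iff_AE[OF \<Phi>i[OF w]] by simp
  then have AEZ: "AE t in lborel. t \<in> {0<..<1} \<longrightarrow> Z w t \<le> 0"
    unfolding AE_lborel01 by eventually_elim (auto simp: max_def split: if_splits)
  have "Z w t \<le> 0" if t: "t \<in> {0<..<1}" for t
  proof (rule ccontr)
    assume "\<not> Z w t \<le> 0"
    then have "t \<in> {x. 0 < Z w x}" by simp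
    moreover have "open {x. 0 < Z w x}"
      unfolding Z_def by (intro open_Collect_less continuous_intros tail_integral_continuous ri w)
    ultimately have "open ({x. 0 < Z w x} \<inter> {0<..<1})" "t \<in> {x. 0 < Z w x} \<inter> {0<..<1}" using t by auto
    then obtain e where e: "e > 0" "ball t e \<subseteq> {x. 0 < Z w x} \<inter> {0<..<1}" using open_contains_ball by blast
    have "AE x in lborel. x \<in> {t<..<t+e} \<longrightarrow> Z w x \<le> 0"
      using AEZ
    proof eventually_elim
      case (elim x)
      show ?case
      proof
        assume "x \<in> {t<..<t+e}"
        then have "x \<in> ball t e" by (auto simp: dist_real_def)
        then show "Z w x \<le> 0" using e elim by auto
      qed
    qed
    from AE_interval_witness[OF this] obtain x where x: "x \<in> {t<..<t+e}" "Z w x \<le> 0" using e(1) by auto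
    then have "x \<in> ball t e" by (auto simp: dist_real_def)
    then show False using e(2) x(2) by auto
  qed
  then show ?thesis using w unfolding W_def Z_def by blast
qed

section \<open>Optimality conditions\<close>

lemma growth_integrable:
  assumes d[measurable]: "d \<in> borel_measurable borel" and d0: "\<And>u. 0 \<le> d u" and dC: "\<And>u. d u \<le> C"
    and U[measurable]: "U \<in> borel_measurable borel" and a: "0 \<le> a" and b: "0 \<le> b"
    and growth: "\<And>x y. \<bar>U y - U x\<bar> \<le> (a + b * (\<bar>x\<bar> + \<bar>y\<bar>)) * \<bar>y - x\<bar>"
    and p: "p \<in> L2"
  shows "integrable lborel01 (\<lambda>u. d u * U (p u))"
proof (rule Bochner_Integration.integrable_bound)
  have [measurable]: "p \<in> borel_measurable lborel01" using p by (simp add: L2_def)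
  have [measurable]: "d \<in> borel_measurable lborel01" by (rule measurable_restrict_space1) simp
  show "integrable lborel01 (\<lambda>u. C * (\<bar>U 0\<bar> + (a * \<bar>p u\<bar> + b * (p u)\<^sup>2)))"
    using L2_integrable[OF p] L2_integrable_square[OF p]
    by (intro Bochner_Integration.integrable_mult_right Bochner_Integration.integrable_add integrable_abs lborel01.integrable_const)
  show "(\<lambda>u. d u * U (p u)) \<in> borel_measurable lborel01" by measurable
  have "\<bar>d u * U x\<bar> \<le> C * (\<bar>U 0\<bar> + (a * \<bar>x\<bar> + b * x\<^sup>2))" for u x
  proof -
    have "\<bar>U x\<bar> \<le> \<bar>U 0\<bar> + (a + b * \<bar>x\<bar>) * \<bar>x\<bar>" using growth[of x 0] by simp
    also have "(a + b * \<bar>x\<bar>) * \<bar>x\<bar> = a * \<bar>x\<bar> + b * x\<^sup>2" by (simp add: algebra_simps power2_eq_square)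
    finally have "\<bar>d u\<bar> * \<bar>U x\<bar> \<le> C * (\<bar>U 0\<bar> + (a * \<bar>x\<bar> + b * x\<^sup>2))"
      using d0[of u] dC[of u] by (intro mult_mono) auto
    then show ?thesis by (simp add: abs_mult)
  qed
  then show "AE u in lborel01. norm (d u * U (p u)) \<le> norm (C * (\<bar>U 0\<bar> + (a * \<bar>p u\<bar> + b * (p u)\<^sup>2)))"
    by (intro AE_I2) (auto intro: order_trans[OF _ abs_ge_self])
qed

lemma moment_set_centred:
  assumes "q \<in> moment_set \<mu> \<sigma>"
  shows "q \<in> L2" "(LINT u|lborel01. q u - \<mu>) = 0" "(LINT u|lborel01. (q u - \<mu>)\<^sup>2) = \<sigma>\<^sup>2"
proof -
  show q: "q \<in> L2" using assms by (simp add: moment_set_def)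
  have 1: "(LINT u|lborel01. q u) = \<mu>" and 2: "(LINT u|lborel01. (q u)\<^sup>2) = \<mu>\<^sup>2 + \<sigma>\<^sup>2"
    using assms by (simp_all add: moment_set_def L2_inner_def power2_eq_square)
  show "(LINT u|lborel01. q u - \<mu>) = 0" using L2_integrable[OF q] 1 by simp
  have "(LINT u|lborel01. (q u - \<mu>)\<^sup>2) = (LINT u|lborel01. (q u)\<^sup>2 - 2 * \<mu> * q u + \<mu>\<^sup>2)"
    by (simp add: power2_diff algebra_simps)
  also have "\<dots> = (LINT u|lborel01. (q u)\<^sup>2) - 2 * \<mu> * (LINT u|lborel01. q u) + \<mu>\<^sup>2"
    using L2_integrable[OF q] L2_integrable_square[OF q] by simp
  finally show "(LINT u|lborel01. (q u - \<mu>)\<^sup>2) = \<sigma>\<^sup>2" using 1 2 by (simp add: power2_eq_square)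
qed

text \<open>
  The residual \<open>h\<close> of a nondecreasing \<open>k\<close> is a feasible direction with an explicit feasible curve:
  \<open>q + t * h\<close> is a positive combination of \<open>k\<close> and \<open>q\<close> plus a constant as soon as \<open>t\<close> is small, and
  since \<open>h\<close> is orthogonal to \<open>1\<close> and \<open>q - \<mu>\<close>, the mean is unchanged and the variance becomes
  \<open>\<sigma>\<^sup>2 + t\<^sup>2 * V\<close>, where \<open>V\<close> is the squared norm of \<open>h\<close>. Rescaling the deviation from the mean by
  \<open>c = \<sigma> / sqrt (\<sigma>\<^sup>2 + t\<^sup>2 * V)\<close> returns to the moment set and changes the curve to second order in
  \<open>t\<close> only. Dividing the optimality inequality by \<open>t\<close> and passing to the limit gives the claim,
  the growth bound on the subdifferential providing an integrable majorant.
\<close>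

lemma directional_first_order_condition:
  fixes \<mu> \<sigma> a b C :: real and U q d k :: "real \<Rightarrow> real"
  defines "h \<equiv> residual (\<lambda>u. q u - \<mu>) k"
  assumes d[measurable]: "d \<in> borel_measurable borel" and d0: "\<And>u. 0 \<le> d u" and dC: "\<And>u. d u \<le> C"
    and F: "\<And>p. p \<in> L2 \<Longrightarrow> F p = (LINT u|lborel01. d u * U (p u))"
    and lip: "locally_lipschitz U" and a: "0 \<le> a" and b: "0 \<le> b"
    and A3: "\<And>x \<zeta>. \<zeta> \<in> clarke_subdiff_real U x \<Longrightarrow> \<bar>\<zeta>\<bar> \<le> a + b * \<bar>x\<bar>"
    and \<sigma>: "0 < \<sigma>" and max: "L2_local_maximizer F (moment_set \<mu> \<sigma> \<inter> monotone_cone) q"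
    and k: "k \<in> monotone_cone"
  shows "(LINT u|lborel01. d u * clarke_min_dd U (q u) (h u)) \<le> 0"
proof -
  define q0 where "q0 u = q u - \<mu>" for u
  have hq: "h = residual q0 k" by (simp add: h_def q0_def[abs_def])
  have qS: "q \<in> moment_set \<mu> \<sigma>" "q \<in> monotone_cone" using max by (auto simp: L2_local_maximizer_def)
  note q = moment_set_centred[OF qS(1)]
  have q0L: "q0 \<in> L2" unfolding q0_def by (intro L2_diff q(1) L2_const)
  have q00: "(LINT u|lborel01. q0 u) = 0" and q01: "(LINT u|lborel01. (q0 u)\<^sup>2) = \<sigma>\<^sup>2"
    using q by (simp_all add: q0_def)
  have kL: "k \<in> L2" using k by (simp add: monotone_cone_def)
  have hL: "h \<in> L2" unfolding hq by (rule residual_L2[OF q0L kL])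
  have h0: "(LINT u|lborel01. h u) = 0" and h1: "(LINT u|lborel01. h u * q0 u) = 0"
    using residual_orthogonal[OF q0L q00 _ kL] q01 \<sigma> by (simp_all add: hq)
  have [measurable]: "q \<in> borel_measurable lborel01" "h \<in> borel_measurable lborel01" "q0 \<in> borel_measurable lborel01"
    using q(1) hL q0L by (auto simp: L2_def)
  have [measurable]: "d \<in> borel_measurable lborel01" by (rule measurable_restrict_space1) simp
  have [measurable]: "U \<in> borel_measurable borel"
    by (rule borel_measurable_continuous_onI[OF locally_lipschitz_imp_continuous_on[OF lip]])
  note [measurable] = clarke_endpoint_measurable[OF lip]
  note growth = clarke_growth[OF lip b A3]
  have Fi: "integrable lborel01 (\<lambda>u. d u * U (p u))" if "p \<in> L2" for p
    by (rule growth_integrable[OF d d0 dC _ a b growth(3) that]) measurable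
  define V where "V = (LINT u|lborel01. (h u)\<^sup>2)"
  have V0: "0 \<le> V" unfolding V_def by simp
  define t where "t n = inverse (real (Suc n))" for n
  have t: "0 < t n" "t n \<le> 1" for n by (auto simp: t_def field_simps)
  have tlim: "t \<longlonglongrightarrow> 0" unfolding t_def by (rule LIMSEQ_inverse_real_of_nat)
  define c where "c n = \<sigma> / sqrt (\<sigma>\<^sup>2 + (t n)\<^sup>2 * V)" for n
  have pos: "0 < \<sigma>\<^sup>2 + (t n)\<^sup>2 * V" for n using \<sigma> V0 by (intro add_pos_nonneg) auto
  have c2: "(c n)\<^sup>2 * (\<sigma>\<^sup>2 + (t n)\<^sup>2 * V) = \<sigma>\<^sup>2" for n
    using pos[of n] by (simp add: c_def power_divide)
  have c: "0 < c n" "c n \<le> 1" for n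
  proof -
    show "0 < c n" unfolding c_def using \<sigma> pos[of n] by (intro divide_pos_pos) auto
    have "\<sigma> \<le> sqrt (\<sigma>\<^sup>2 + (t n)\<^sup>2 * V)" using V0 by (intro real_le_rsqrt) auto
    then show "c n \<le> 1" using pos[of n] by (simp add: c_def divide_le_eq)
  qed
  define E where "E = V / \<sigma>\<^sup>2"
  have E0: "0 \<le> E" using V0 by (simp add: E_def)
  have c1: "1 - c n \<le> (t n)\<^sup>2 * E" for n
  proof -
    have "(c n)\<^sup>2 \<le> c n" using c[of n] by (simp add: power2_eq_square mult_left_le)
    moreover have "(c n)\<^sup>2 * \<sigma>\<^sup>2 \<ge> \<sigma>\<^sup>2 - (t n)\<^sup>2 * V"
    proof -
      have "(c n)\<^sup>2 * ((t n)\<^sup>2 * V) \<le> 1 * ((t n)\<^sup>2 * V)"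
        using c[of n] V0 by (intro mult_right_mono) (auto simp: power_le_one)
      then show ?thesis using c2[of n] by (simp add: algebra_simps)
    qed
    then have "1 - (c n)\<^sup>2 \<le> (t n)\<^sup>2 * E" using \<sigma> by (simp add: E_def field_simps)
    ultimately show ?thesis by linarith
  qed
  \<comment> \<open>The curve is \<open>p n = q + t n * v n\<close> with \<open>v n = c n * h - e n * q0\<close>, and \<open>e n\<close> tends to 0.\<close>
  define e where "e n = (1 - c n) / t n" for n
  have e: "0 \<le> e n" "e n \<le> t n * E" for n
    using c[of n] c1[of n] t[of n] by (auto simp: e_def divide_le_eq power2_eq_square mult_ac)
  have elim0: "e \<longlonglongrightarrow> 0"
  proof (rule tendsto_sandwich[OF _ _ tendsto_const])
    show "(\<lambda>n. t n * E) \<longlonglongrightarrow> 0" using tendsto_mult_right[OF tlim, of E] by simp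
  qed (use e in auto)
  have ceq: "c n = 1 - t n * e n" for n using t[of n] by (simp add: e_def)
  have clim: "c \<longlonglongrightarrow> 1"
    unfolding ceq[abs_def] using tendsto_diff[OF tendsto_const[of 1] tendsto_mult[OF tlim elim0]] by simp
  define p where "p n u = \<mu> + c n * (q0 u + t n * h u)" for n u
  define v where "v n u = c n * h u - e n * q0 u" for n u
  have pv: "p n u = q u + t n * v n u" for n u
    by (simp add: p_def v_def ceq q0_def algebra_simps)
  have pL: "p n \<in> L2" for n unfolding p_def by (intro L2_add L2_const L2_cmult q0L hL)
  have p_moment: "p n \<in> moment_set \<mu> \<sigma>" for n
  proof -
    note ints = L2_integrable[OF q0L] L2_integrable[OF hL] L2_integrable_square[OF q0L] L2_integrable_square[OF hL]
      L2_mult_integrable[OF hL q0L]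
    have "(LINT u|lborel01. p n u) = \<mu>" unfolding p_def using ints q00 h0 by simp
    moreover have "(LINT u|lborel01. p n u * p n u) = \<mu>\<^sup>2 + \<sigma>\<^sup>2"
    proof -
      have "(LINT u|lborel01. p n u * p n u) = (LINT u|lborel01. \<mu>\<^sup>2 + 2 * \<mu> * c n * q0 u + 2 * \<mu> * c n * t n * h u
          + (c n)\<^sup>2 * (q0 u)\<^sup>2 + 2 * (c n)\<^sup>2 * t n * (h u * q0 u) + (c n)\<^sup>2 * (t n)\<^sup>2 * (h u)\<^sup>2)"
        by (intro Bochner_Integration.integral_cong) (auto simp: p_def power2_eq_square algebra_simps)
      also have "\<dots> = \<mu>\<^sup>2 + (c n)\<^sup>2 * \<sigma>\<^sup>2 + (c n)\<^sup>2 * (t n)\<^sup>2 * V"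
        using ints q00 h0 h1 q01 by (simp add: V_def)
      also have "\<dots> = \<mu>\<^sup>2 + \<sigma>\<^sup>2" using c2[of n] by (simp add: algebra_simps)
      finally show ?thesis .
    qed
    ultimately show ?thesis using pL by (simp add: moment_set_def L2_inner_def)
  qed
  define \<alpha> \<beta> where "\<alpha> = (LINT x|lborel01. k x)" and "\<beta> = (LINT x|lborel01. k x * q0 x) / (LINT x|lborel01. (q0 x)\<^sup>2)"
  have h_eq: "h u = k u - \<alpha> - \<beta> * (q u - \<mu>)" for u by (simp add: hq residual_def \<alpha>_def \<beta>_def q0_def)
  have p_mono: "\<forall>\<^sub>F n in sequentially. p n \<in> monotone_cone"
  proof -
    have "(\<lambda>n. t n * \<beta>) \<longlonglongrightarrow> 0" using tendsto_mult_right[OF tlim, of \<beta>] by simp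
    from order_tendstoD(2)[OF this, of 1] have "\<forall>\<^sub>F n in sequentially. t n * \<beta> < 1" by simp
    then show ?thesis
    proof eventually_elim
      case (elim n)
      have "p n = (\<lambda>u. (c n * t n) * k u + ((c n * (1 - t n * \<beta>)) * q u + (\<mu> - c n * \<mu> - c n * t n * \<alpha> + c n * t n * \<beta> * \<mu>)))"
        by (simp add: p_def h_eq q0_def fun_eq_iff algebra_simps)
      also have "\<dots> \<in> monotone_cone"
        using elim c[of n] t[of n]
        by (intro monotone_cone_add monotone_cone_scale monotone_cone_const k qS(2) mult_nonneg_nonneg) auto
      finally show ?case .
    qed
  qed
  define D where "D u = E * \<bar>q0 u\<bar> + \<bar>h u\<bar>" for u
  have DL: "D \<in> L2" unfolding D_def by (intro L2_add L2_cmult L2_abs q0L hL)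
  have D0: "0 \<le> D u" for u using E0 by (simp add: D_def)
  have vD: "\<bar>v n u\<bar> \<le> D u" for n u
  proof -
    have "\<bar>v n u\<bar> \<le> \<bar>c n * h u\<bar> + \<bar>e n * q0 u\<bar>" unfolding v_def by (rule abs_triangle_ineq4)
    also have "\<dots> = c n * \<bar>h u\<bar> + e n * \<bar>q0 u\<bar>" using c[of n] e[of n] by (simp add: abs_mult)
    also have "\<dots> \<le> 1 * \<bar>h u\<bar> + E * \<bar>q0 u\<bar>"
    proof (intro add_mono mult_right_mono)
      show "e n \<le> E" using e(2)[of n] t[of n] E0 mult_right_mono[of "t n" 1 E] by simp
    qed (use c[of n] in auto)
    finally show ?thesis by (simp add: D_def)
  qed
  have near: "\<forall>\<^sub>F n in sequentially. L2_norm (\<lambda>u. p n u - q u) < \<epsilon>" if "0 < \<epsilon>" for \<epsilon>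
  proof -
    define J where "J = (LINT u|lborel01. (D u)\<^sup>2)"
    have "L2_norm (\<lambda>u. p n u - q u) \<le> t n * sqrt J" for n
    proof -
      have "(LINT u|lborel01. (p n u - q u)\<^sup>2) \<le> (LINT u|lborel01. (t n)\<^sup>2 * (D u)\<^sup>2)"
      proof (rule integral_mono)
        show "integrable lborel01 (\<lambda>u. (p n u - q u)\<^sup>2)" by (rule L2_integrable_square[OF L2_diff[OF pL q(1)]])
        show "integrable lborel01 (\<lambda>u. (t n)\<^sup>2 * (D u)\<^sup>2)" using L2_integrable_square[OF DL] by simp
        show "(p n u - q u)\<^sup>2 \<le> (t n)\<^sup>2 * (D u)\<^sup>2" for u
          using power_mono[OF vD[of n u] abs_ge_zero, where n=2] by (simp add: pv power_mult_distrib mult_left_mono)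
      qed
      also have "\<dots> = (t n)\<^sup>2 * J" by (simp add: J_def)
      finally have "sqrt (LINT u|lborel01. (p n u - q u)\<^sup>2) \<le> sqrt ((t n)\<^sup>2 * J)" by (rule real_sqrt_le_mono)
      also have "sqrt ((t n)\<^sup>2 * J) = t n * sqrt J" using t[of n] by (simp add: real_sqrt_mult)
      finally show ?thesis by (simp add: L2_norm_def L2_inner_def power2_eq_square)
    qed
    moreover have "(\<lambda>n. t n * sqrt J) \<longlonglongrightarrow> 0" using tendsto_mult_right[OF tlim, of "sqrt J"] by simp
    from order_tendstoD(2)[OF this that] have "\<forall>\<^sub>F n in sequentially. t n * sqrt J < \<epsilon>" .
    ultimately show ?thesis by (auto elim!: eventually_mono intro: le_less_trans)
  qed
  obtain \<epsilon> where "0 < \<epsilon>" and \<epsilon>: "\<And>p. p \<in> moment_set \<mu> \<sigma> \<inter> monotone_cone \<Longrightarrow> L2_norm (\<lambda>u. p u - q u) < \<epsilon> \<Longrightarrow> F p \<le> F q"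
    using max by (auto simp: L2_local_maximizer_def)
  have Fle: "\<forall>\<^sub>F n in sequentially. F (p n) \<le> F q"
    using p_mono near[OF \<open>0 < \<epsilon>\<close>] by eventually_elim (use \<epsilon> p_moment in auto)
  define X where "X n u = (U (p n u) - U (q u)) / t n" for n u
  define m where "m u = clarke_min_dd U (q u) (h u)" for u
  have mm[measurable]: "m \<in> borel_measurable lborel01" unfolding m_def clarke_min_dd_def by measurable
  have [measurable]: "p n \<in> borel_measurable lborel01" for n using pL by (simp add: L2_def)
  have [measurable]: "X n \<in> borel_measurable lborel01" for n unfolding X_def by measurable
  define G where "G u = (a + b * (2 * \<bar>q u\<bar> + D u)) * D u" for u
  have GL: "integrable lborel01 (\<lambda>u. C * G u)"
    unfolding G_def
    by (intro Bochner_Integration.integrable_mult_right L2_mult_integrable L2_add L2_cmult L2_abs L2_const q(1) DL)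
  have XG: "\<bar>X n u\<bar> \<le> G u" for n u
  proof -
    have 1: "\<bar>p n u - q u\<bar> = t n * \<bar>v n u\<bar>" using t[of n] by (simp add: pv abs_mult)
    have "t n * \<bar>v n u\<bar> \<le> 1 * D u" using t[of n] vD[of n u] by (intro mult_mono) auto
    then have 2: "\<bar>p n u\<bar> \<le> \<bar>q u\<bar> + D u" using 1 by linarith
    have "\<bar>U (p n u) - U (q u)\<bar> \<le> (a + b * (\<bar>q u\<bar> + \<bar>p n u\<bar>)) * \<bar>p n u - q u\<bar>" by (rule growth(3))
    also have "\<dots> = (a + b * (\<bar>q u\<bar> + \<bar>p n u\<bar>)) * \<bar>v n u\<bar> * t n" by (simp add: 1)
    also have "\<dots> \<le> (a + b * (2 * \<bar>q u\<bar> + D u)) * D u * t n"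
    proof (intro mult_right_mono mult_mono)
      show "a + b * (\<bar>q u\<bar> + \<bar>p n u\<bar>) \<le> a + b * (2 * \<bar>q u\<bar> + D u)"
        using 2 b by (intro add_left_mono mult_left_mono) auto
      show "0 \<le> a + b * (2 * \<bar>q u\<bar> + D u)" using a b D0[of u] by simp
    qed (use vD[of n u] t[of n] in auto)
    finally show ?thesis using t[of n] by (simp add: X_def G_def abs_divide divide_le_eq)
  qed
  have mG: "\<bar>m u\<bar> \<le> G u" for u
  proof -
    obtain x where x: "m u = x * h u" "\<bar>x\<bar> \<le> a + b * \<bar>q u\<bar>"
      using growth(1,2)[of "q u"] unfolding m_def clarke_min_dd_def by metis
    have "\<bar>m u\<bar> \<le> (a + b * \<bar>q u\<bar>) * \<bar>h u\<bar>"
      unfolding x(1) abs_mult by (rule mult_right_mono[OF x(2) abs_ge_zero])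
    also have "\<dots> \<le> (a + b * (2 * \<bar>q u\<bar> + D u)) * D u"
      using a b D0[of u] E0 by (intro mult_mono add_mono mult_left_mono) (auto simp: D_def)
    finally show ?thesis by (simp add: G_def)
  qed
  have dCG: "\<bar>d u * x\<bar> \<le> C * G u" if "\<bar>x\<bar> \<le> G u" for x u
    unfolding abs_mult using d0[of u] dC[of u] that by (intro mult_mono) auto
  have Yi: "integrable lborel01 (\<lambda>u. d u * min (X n u) (m u))" for n
  proof (rule Bochner_Integration.integrable_bound[OF GL])
    show "AE u in lborel01. norm (d u * min (X n u) (m u)) \<le> norm (C * G u)"
      using dCG XG mG by (intro AE_I2) (auto simp: min_def intro!: order_trans[OF _ abs_ge_self])
  qed measurable
  have "\<forall>\<^sub>F n in sequentially. (LINT u|lborel01. d u * min (X n u) (m u)) \<le> 0"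
    using Fle
  proof eventually_elim
    case (elim n)
    have dX: "(\<lambda>u. d u * X n u) = (\<lambda>u. (d u * U (p n u) - d u * U (q u)) / t n)"
      by (simp add: X_def fun_eq_iff algebra_simps)
    have "(LINT u|lborel01. d u * min (X n u) (m u)) \<le> (LINT u|lborel01. d u * X n u)"
      using d0 Fi[OF pL] Fi[OF q(1)] by (intro integral_mono Yi mult_left_mono) (auto simp: dX)
    also have "\<dots> = (F (p n) - F q) / t n"
      unfolding dX using Fi[OF pL] Fi[OF q(1)] F[OF pL] F[OF q(1)] by simp
    also have "\<dots> \<le> 0" using elim t[of n] by (simp add: divide_le_0_iff)
    finally show ?case .
  qed
  moreover have "(\<lambda>n. LINT u|lborel01. d u * min (X n u) (m u)) \<longlonglongrightarrow> (LINT u|lborel01. d u * m u)"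
  proof (rule integral_dominated_convergence[where w="\<lambda>u. C * G u"])
    have "(\<lambda>n. min (X n u) (m u)) \<longlonglongrightarrow> m u" for u
      unfolding X_def m_def
    proof (rule tendsto_min_clarke_quotient[OF lip t(1)])
      have "(\<lambda>n. v n u) \<longlonglongrightarrow> 1 * h u - 0 * q0 u" unfolding v_def by (intro tendsto_intros clim elim0)
      then have vlim: "(\<lambda>n. v n u) \<longlonglongrightarrow> h u" by simp
      have "(\<lambda>n. q u + t n * v n u) \<longlonglongrightarrow> q u + 0 * h u" by (intro tendsto_intros tlim vlim)
      then show "(\<lambda>n. p n u) \<longlonglongrightarrow> q u" by (simp add: pv)
      have "(p n u - q u) / t n = v n u" for n using t[of n] by (simp add: pv)
      then show "(\<lambda>n. (p n u - q u) / t n) \<longlonglongrightarrow> h u" using vlim by simp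
    qed
    then show "AE u in lborel01. (\<lambda>n. d u * min (X n u) (m u)) \<longlonglongrightarrow> d u * m u"
      by (intro AE_I2 tendsto_intros)
    show "AE u in lborel01. norm (d u * min (X n u) (m u)) \<le> C * G u" for n
      using dCG XG mG by (intro AE_I2) (auto simp: min_def)
  qed (use GL in auto)
  ultimately have "(LINT u|lborel01. d u * m u) \<le> 0"
    by (intro tendsto_upperbound[where F=sequentially]) auto
  then show ?thesis by (simp add: m_def)
qed

text \<open>
  The selected \<open>w\<close> plays the part of \<open>\<phi>' * \<xi>\<close>, the multipliers are the coefficients of its
  projection onto the span of \<open>1\<close> and \<open>q\<close>, and \<open>z\<close> is its residual. Splitting off the projection
  makes the orthogonality \<open>\<langle>z, q\<rangle> = 0\<close> automatic, so that membership in the normal cone is just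
  polarity to the monotone cone.
\<close>

lemma kkt_existence:
  fixes \<mu> \<sigma> a b :: real and \<phi> U q :: "real \<Rightarrow> real"
  assumes \<sigma>0: "\<sigma> \<ge> 0" and \<phi>: "\<phi> \<in> distortions"
    and A1: "absolutely_continuous_on {0..1} \<phi>" "deriv \<phi> \<in> Linfty"
    and lip: "locally_lipschitz U"
    and a: "a \<ge> 0" and b: "b \<ge> 0" and A3: "\<And>x \<zeta>. \<zeta> \<in> clarke_subdiff_real U x \<Longrightarrow> \<bar>\<zeta>\<bar> \<le> a + b * \<bar>x\<bar>"
    and LICQ: "L2_lin_indep (\<lambda>_. 1) (\<lambda>u. 2 * q u)"
    and max: "L2_local_maximizer (Psi \<phi> U) (moment_set \<mu> \<sigma> \<inter> monotone_cone) q"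
  shows "\<exists>l1 l2 z \<xi>. kkt_system \<phi> U q l1 l2 z \<xi>"
proof -
  have qS: "q \<in> moment_set \<mu> \<sigma>" "q \<in> monotone_cone" using max by (auto simp: L2_local_maximizer_def)
  note q = moment_set_centred[OF qS(1)]
  define q0 where "q0 u = q u - \<mu>" for u
  have q0L: "q0 \<in> L2" unfolding q0_def by (intro L2_diff q(1) L2_const)
  have q00: "(LINT u|lborel01. q0 u) = 0" and q01: "(LINT u|lborel01. (q0 u)\<^sup>2) = \<sigma>\<^sup>2"
    using q by (simp_all add: q0_def)
  have \<sigma>: "0 < \<sigma>"
  proof (rule ccontr)
    assume "\<not> 0 < \<sigma>"
    then have "(LINT u|lborel01. (q0 u)\<^sup>2) = 0" using \<sigma>0 q01 by simp
    then have "AE u in lborel01. (q0 u)\<^sup>2 = 0"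
      using integral_nonneg_eq_0_iff_AE[OF L2_integrable_square[OF q0L]] by simp
    then have "AE u in lborel01. (2 * \<mu>) * 1 + (- 1) * (2 * q u) = 0"
      by eventually_elim (simp add: q0_def)
    then show False using LICQ unfolding L2_lin_indep_def by (metis one_neq_neg_one neg_equal_0_iff_equal zero_neq_one)
  qed
  obtain d :: "real \<Rightarrow> real" and C where d[measurable]: "d \<in> borel_measurable borel" and d0: "\<And>u. 0 \<le> d u"
    and dC: "\<And>u. d u \<le> C" and d\<phi>: "AE u in lborel01. d u = deriv \<phi> u"
    and dens: "stieltjes01 \<phi> = density lborel (\<lambda>u. ennreal (indicator {0<..<1} u * d u))"
    using distortion_density[OF \<phi> A1] by blast
  have [measurable]: "U \<in> borel_measurable borel"
    by (rule borel_measurable_continuous_onI[OF locally_lipschitz_imp_continuous_on[OF lip]])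
  have [measurable]: "q \<in> borel_measurable lborel01" using q(1) by (simp add: L2_def)
  have [measurable]: "d \<in> borel_measurable lborel01" by (rule measurable_restrict_space1) simp
  note [measurable] = clarke_endpoint_measurable[OF lip]
  note growth = clarke_growth[OF lip b A3]
  have F: "Psi \<phi> U p = (LINT u|lborel01. d u * U (p u))" if "p \<in> L2" for p
    using that by (intro Psi_eq_weighted_integral[OF _ _ _ d0 dens]) (auto simp: L2_def)
  define f g where "f u = d u * clarke_lower U (q u)" and "g u = d u * clarke_upper U (q u)" for u
  have [measurable]: "f \<in> borel_measurable lborel01" "g \<in> borel_measurable lborel01" unfolding f_def g_def by measurable
  have BL: "(\<lambda>u. C * (a + b * \<bar>q u\<bar>)) \<in> L2" by (intro L2_cmult L2_add L2_const L2_abs q(1))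
  have bd: "\<bar>d u * x\<bar> \<le> \<bar>C * (a + b * \<bar>q u\<bar>)\<bar>" if "\<bar>x\<bar> \<le> a + b * \<bar>q u\<bar>" for x u
  proof -
    have "\<bar>d u\<bar> * \<bar>x\<bar> \<le> C * (a + b * \<bar>q u\<bar>)" using d0[of u] dC[of u] that by (intro mult_mono) auto
    then show ?thesis by (simp add: abs_mult[symmetric])
  qed
  have fL: "f \<in> L2" by (rule L2_bound[OF BL]) (use bd growth(2) in \<open>auto simp: f_def\<close>)
  have gL: "g \<in> L2" by (rule L2_bound[OF BL]) (use bd growth(1) in \<open>auto simp: g_def\<close>)
  have fg: "f u \<le> g u" for u
    unfolding f_def g_def by (intro mult_left_mono clarke_lower_le_upper[OF lip] d0)
  have "(LINT u|lborel01. (if residual q0 k u > 0 then f u else g u) * residual q0 k u) \<le> 0"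
    if "k \<in> monotone_cone" for k
  proof -
    have "(\<lambda>u. (if residual q0 k u > 0 then f u else g u) * residual q0 k u) =
      (\<lambda>u. d u * clarke_min_dd U (q u) (residual q0 k u))"
      by (auto simp: f_def g_def clarke_min_dd_def fun_eq_iff)
    then show ?thesis
      using directional_first_order_condition[OF d d0 dC F lip a b A3 \<sigma> max that]
      by (simp add: q0_def[abs_def])
  qed
  then obtain w where w[measurable]: "w \<in> borel_measurable lborel01" and fwg: "\<And>u. f u \<le> w u" "\<And>u. w u \<le> g u"
    and tail: "\<And>t. t \<in> {0<..<1} \<Longrightarrow> tail_integral (residual q0 w) t \<le> 0"
    using order_interval_selection[OF fL gL fg q0L] q01 \<sigma> by auto
  have wL: "w \<in> L2"
  proof (rule L2_bound[OF L2_add[OF L2_abs[OF fL] L2_abs[OF gL]] w])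
    have "\<bar>w u\<bar> \<le> \<bar>\<bar>f u\<bar> + \<bar>g u\<bar>\<bar>" for u using fwg[of u] by linarith
    then show "AE u in lborel01. \<bar>w u\<bar> \<le> \<bar>\<bar>f u\<bar> + \<bar>g u\<bar>\<bar>" by auto
  qed
  define z where "z = residual q0 w"
  have zL: "z \<in> L2" unfolding z_def by (rule residual_L2[OF q0L wL])
  have z0: "(LINT u|lborel01. z u) = 0" and z1: "(LINT u|lborel01. z u * q0 u) = 0"
    using residual_orthogonal[OF q0L q00 _ wL] q01 \<sigma> by (simp_all add: z_def)
  have zN: "z \<in> normal_cone monotone_cone q"
    unfolding normal_cone_def
  proof (intro CollectI conjI zL ballI)
    fix h assume h: "h \<in> monotone_cone"
    then have hL: "h \<in> L2" by (simp add: monotone_cone_def)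
    have "L2_inner z (\<lambda>u. h u - q u) = (LINT u|lborel01. z u * h u - z u * q0 u - \<mu> * z u)"
      unfolding L2_inner_def by (intro Bochner_Integration.integral_cong) (auto simp: q0_def algebra_simps)
    also have "\<dots> = (LINT u|lborel01. z u * h u) - (LINT u|lborel01. z u * q0 u) - (LINT u|lborel01. \<mu> * z u)"
      using L2_mult_integrable[OF zL hL] L2_mult_integrable[OF zL q0L] L2_integrable[OF zL]
      by (subst Bochner_Integration.integral_diff; simp)+
    also have "\<dots> \<le> 0"
      using monotone_cone_polarI[OF zL z0 _ h] tail z0 z1 by (simp add: z_def)
    finally show "L2_inner z (\<lambda>u. h u - q u) \<le> 0" .
  qed
  \<comment> \<open>Where the weight vanishes, so does \<open>w\<close>, and any element of the subdifferential will do.\<close>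
  define \<xi> where "\<xi> u = (if d u > 0 then w u / d u else clarke_lower U (q u))" for u
  have \<xi>m: "\<xi> \<in> borel_measurable lborel01" unfolding \<xi>_def by measurable
  have \<xi>: "\<xi> u \<in> clarke_subdiff_real U (q u)" for u
  proof (rule clarke_interval_subset_subdiff[OF lip])
    show "clarke_lower U (q u) \<le> \<xi> u" "\<xi> u \<le> clarke_upper U (q u)"
      using fwg[of u] clarke_lower_le_upper[OF lip, of "q u"]
      by (auto simp: \<xi>_def f_def g_def le_divide_eq divide_le_eq mult.commute)
  qed
  have d\<xi>: "d u * \<xi> u = w u" for u
  proof (cases "d u > 0")
    case False
    then have "d u = 0" using d0[of u] by simp
    then show ?thesis using fwg[of u] by (simp add: f_def g_def)
  qed (simp add: \<xi>_def)
  define l2 where "l2 = (LINT x|lborel01. w x * q0 x) / (LINT x|lborel01. (q0 x)\<^sup>2) / 2"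
  define l1 where "l1 = (LINT x|lborel01. w x) - 2 * l2 * \<mu>"
  have "AE u in lborel01. 0 = - (deriv \<phi> u * \<xi> u) + l1 + 2 * l2 * q u + z u"
    using d\<phi>
  proof eventually_elim
    case (elim u)
    have "deriv \<phi> u * \<xi> u = w u" using d\<xi>[of u] elim by simp
    moreover have "z u = w u - (LINT x|lborel01. w x) - 2 * l2 * (q u - \<mu>)"
      by (simp add: z_def residual_def l2_def q0_def)
    ultimately show ?case by (simp add: l1_def algebra_simps)
  qed
  then have "kkt_system \<phi> U q l1 l2 z \<xi>"
    using zN \<xi>m \<xi> by (simp add: kkt_system_def)
  then show ?thesis by blast
qed

lemma kkt_pointwise:
  assumes kkt: "kkt_system \<phi> U q l1 l2 z \<xi>" and q: "q \<in> monotone_cone"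
    and I: "{c<..<d} \<subseteq> {0<..<1}" and inc: "ae_strictly_increasing_on {c<..<d} q"
  shows "AE u in lborel. u \<in> {c<..<d} \<longrightarrow>
    l1 + 2 * l2 * q u \<in> (\<lambda>\<zeta>. deriv \<phi> u * \<zeta>) ` clarke_subdiff_real U (q u)"
proof -
  have z: "z \<in> normal_cone monotone_cone q"
    and \<xi>: "AE u in lborel01. \<xi> u \<in> clarke_subdiff_real U (q u)"
    and eq: "AE u in lborel01. 0 = - (deriv \<phi> u * \<xi> u) + l1 + 2 * l2 * q u + z u"
    using kkt by (auto simp: kkt_system_def)
  show ?thesis
    using normal_cone_zero_where_strictly_increasing[OF z q I inc] \<xi>[unfolded AE_lborel01] eq[unfolded AE_lborel01]
  proof eventually_elim
    case (elim u)
    show ?case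
    proof
      assume u: "u \<in> {c<..<d}"
      then have "l1 + 2 * l2 * q u = deriv \<phi> u * \<xi> u" "\<xi> u \<in> clarke_subdiff_real U (q u)"
        using elim I by auto
      then show "l1 + 2 * l2 * q u \<in> (\<lambda>\<zeta>. deriv \<phi> u * \<zeta>) ` clarke_subdiff_real U (q u)" by blast
    qed
  qed
qed

theorem corollary1:
  fixes \<mu> \<sigma> a b :: real and \<phi> U q :: "real \<Rightarrow> real"
  assumes "\<sigma> \<ge> 0"
    and "\<phi> \<in> distortions"
    and "mono U"
    and A1: "absolutely_continuous_on {0..1} \<phi>" "deriv \<phi> \<in> Linfty"
    and A2: "locally_lipschitz U"
    and A3: "a \<ge> 0" "b \<ge> 0" "\<And>x \<zeta>. \<zeta> \<in> clarke_subdiff_real U x \<Longrightarrow> \<bar>\<zeta>\<bar> \<le> a + b * \<bar>x\<bar>"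
    and "q \<in> moment_set \<mu> \<sigma> \<inter> monotone_cone"
    and LICQ: "L2_lin_indep (\<lambda>_. 1) (\<lambda>u. 2 * q u)"
    and "L2_local_maximizer (Psi \<phi> U) (moment_set \<mu> \<sigma> \<inter> monotone_cone) q"
  shows "(\<exists>l1 l2 z \<xi>. kkt_system \<phi> U q l1 l2 z \<xi>) \<and>
    (\<forall>l1 l2 z \<xi>. kkt_system \<phi> U q l1 l2 z \<xi> \<longrightarrow>
      (\<forall>c d. {c<..<d} \<subseteq> {0<..<1} \<and> ae_strictly_increasing_on {c<..<d} q \<longrightarrow>
        (AE u in lborel. u \<in> {c<..<d} \<longrightarrow>
          l1 + 2 * l2 * q u \<in> (\<lambda>\<zeta>. deriv \<phi> u * \<zeta>) ` clarke_subdiff_real U (q u))))"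
proof (intro conjI allI impI)
  have q: "q \<in> monotone_cone" using assms by blast
  show "\<exists>l1 l2 z \<xi>. kkt_system \<phi> U q l1 l2 z \<xi>"
    using assms by (intro kkt_existence[where \<mu>=\<mu> and \<sigma>=\<sigma> and a=a and b=b])
  fix l1 l2 z \<xi> c d
  assume "kkt_system \<phi> U q l1 l2 z \<xi>" "{c<..<d} \<subseteq> {0<..<1} \<and> ae_strictly_increasing_on {c<..<d} q"
  then show "AE u in lborel. u \<in> {c<..<d} \<longrightarrow>
      l1 + 2 * l2 * q u \<in> (\<lambda>\<zeta>. deriv \<phi> u * \<zeta>) ` clarke_subdiff_real U (q u)"
    using kkt_pointwise[OF _ q] by blast
qed

end
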